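(* Let $X$ be a symmetric Laakso-type fractal space, i.e. the limit space of a simple iterated graph system that is doubling, non-degenerate and symmetric, with generator $G_1=(V_1,E_1,\xi_1)$. For every symmetric $\Theta^{(1)}$-admissible density $\rho\colon E_1\to(0,1)$, the metric $d_\rho$ on $X$ is such that $(X,d_\rho)$ is $Q$-Ahlfors regular, where $Q\ge1$ is the unique value satisfying $\sum_{e\in E_1}\rho(e)^Q=1$. Moreover, for any two such densities $\rho$ and $\nu$, the spaces $(X,d_\rho)$ and $(X,d_\nu)$ are quasisymmetrically equivalent.
   Context: Graphs. A graph is a triple $G=(V,E,\xi)$ with $V$ a finite non-empty set (vertices), $E$ a finite set (edges) and $\xi\colon E\to\{\{v,w\}: v,w\in V,\ v\neq w\}$ (multiple edges allowed). Write $v\in e$ for $v\in\xi(e)$, $e\cap f:=\xi(e)\cap\xi(f)$, and $\deg(v)$ for the number of edges $e$ with $v\in e$. A path from $v_0$ to $v_k$ is an alternating sequence $[v_0,e_1,v_1,\dots,e_k,v_k]$ with $\xi(e_i)=\{v_{i-1},v_i\}$ for all $i$; $\Theta(A,B)$ is the set of all paths from a vertex of $A$ to a vertex of $B$. Simple iterated graph system (IGS). It consists of a finite connected graph $G_1=(V_1,E_1,\xi_1)$ (the generator), a finite non-empty set $I$, two injective maps $\phi_-,\phi_+\colon I\to V_1$, and a labelling $\xi_1(e)=\{e^-,e^+\}$ of the endpoints of each $e\in E_1$; set $I_\pm:=\phi_\pm(I)$ and $\phi_{e^\pm,e}:=\phi_\pm$. It is required that $I_-\cap I_+=\varnothing$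 and that no edge has both endpoints in $I_-$ or both in $I_+$. Replacement graphs $G_n=(V_n,E_n,\xi_n)$ are defined recursively: $V_{n+1}:=(V_1\times E_n)/\sim$, where $\sim$ is generated by $(\phi_{v,e}(i),e)\sim(\phi_{v,f}(i),f)$ for all $i\in I$ and all $e,f\in E_n$ sharing the endpoint $v$; the class of $(v,e)$ is $[v,e]$; $E_{n+1}:=E_1\times E_n$, $\xi_{n+1}(e,f):=\{[e^-,f],[e^+,f]\}$, with labels $(e,f)^\pm:=[e^\pm,f]$ and gluing maps $\phi_{(e,f)^\pm,(e,f)}:=\phi_\pm$. Projections on edges: $\pi_{n+1}(e,f):=f$ for $(e,f)\in E_{n+1}$, $\pi_{n,k}:=\pi_{k+1}\circ\dots\circ\pi_n$ for $n>k$, $\pi_{n,n}=\mathrm{id}$. For $e\in E_k$ write $|e|:=k$, and for $n\ge k$ let $e\cdot G_{n-k}$ be the subgraph of $G_n$ consisting of all edges $f\in E_n$ with $\pi_{n,k}(f)=e$ and their endpoints. The IGS is doubling if $\deg(v)=1$ for all $v\in I_-\cup I_+$; non-degenerate if no edge of $G_1$ joins a vertex of $I_-$ to a vertex of $I_+$; symmetric if there is a graph isomorphism $\eta\colon G_1\to G_1$ with $\eta\circ\phi_\pm=\phi_\mp$ (fixed from now on). Limit space. $\Sigma:=\{(e_i)_{i\ge1}: e_i\in E_i,\ \pi_{i+1}(e_{i+1})=e_i\ \forall i\}$ and $X:=\Sigma/\sim$ with $(e_i)\sim(f_i)$ iff $e_i\cap f_i\ne\varnothing$ for all $i$. Densities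 and metrics. $\Theta^{(1)}:=\Theta(I_-,I_+)$ (paths in $G_1$). A density $\rho$ on $E_1$ is $\Theta^{(1)}$-admissible if $\sum_{i=1}^k\rho(e_i)\ge1$ for every $[v_0,e_1,\dots,e_k,v_k]\in\Theta^{(1)}$, and symmetric if $\rho(\eta(e))=\rho(e)$ for all $e\in E_1$. For a $\Theta^{(1)}$-admissible $\rho\colon E_1\to(0,1)$ put $\rho_1:=\rho$ and $\rho_{n+1}((e,f)):=\rho(e)\rho_n(f)$ for $(e,f)\in E_{n+1}=E_1\times E_n$. For $v\neq w$ in $V_n$ let $d_{\rho,n}(v,w)$ be the infimum of $\sum_{e\in\Omega}\rho_{|e|}(e)$ over all sets $\Omega\subset\bigcup_{i=1}^nE_i$ such that $v$ and $w$ are connected by a path in $\bigcup_{e\in\Omega}e\cdot G_{n-|e|}$; $d_{\rho,n}(v,v)=0$; $d_{\rho,n}(e,f):=\min\{d_{\rho,n}(v,w):v\in e,w\in f\}$ for $e,f\in E_n$. Then $d_\rho([(e_i)],[(f_i)]):=\lim_{i\to\infty}d_{\rho,i}(e_i,f_i)$, which is a well-defined metric on $X$. A metric space is $Q$-Ahlfors regular ($Q>0$) if there are a Radon measure $\mu$ and $C\ge1$ with $C^{-1}r^Q\le\mu(B(x,r))\le Cr^Q$ for all $x$ and $0<r\le2\,\mathrm{diam}$. Metrics $d,\delta$ on $X$ are quasisymmetrically equivalent if the identity map $(X,d)\to(X,\delta)$ is a homeomorphism and there is a homeomorphism $\psi\colon[0,\infty)\to[0,\infty)$ with $\delta(x,y)/\delta(x,z)\le\psi(d(x,y)/d(x,z))$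 for all $x,y,z\in X$, $x\neq z$. *)

theory Defs
  imports "HOL-Analysis.Analysis"
begin

text \<open>Finite multigraphs without loops; \<open>ends\<close> is the incidence map \<open>\<xi>\<close>.\<close>

record ('v, 'e) multigraph =
  verts :: "'v set"
  edges :: "'e set"
  ends  :: "'e \<Rightarrow> 'v set"

definition finite_multigraph :: "('v, 'e) multigraph \<Rightarrow> bool" where
  "finite_multigraph G \<longleftrightarrow>
     finite (verts G) \<and> verts G \<noteq> {} \<and> finite (edges G) \<and>
     (\<forall>e\<in>edges G. \<exists>v\<in>verts G. \<exists>w\<in>verts G. v \<noteq> w \<and> ends G e = {v, w})"

definition degree_of :: "('v, 'e) multigraph \<Rightarrow> 'v \<Rightarrow> nat" where
  "degree_of G v = card {e \<in> edges G. v \<in> ends G e}"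

text \<open>
  The path \<open>[v\<^sub>0, e\<^sub>1, v\<^sub>1, \<dots>, e\<^sub>k, v\<^sub>k]\<close> is the pair of the lists
  \<open>[v\<^sub>0, \<dots>, v\<^sub>k]\<close> and \<open>[e\<^sub>1, \<dots>, e\<^sub>k]\<close>; the trivial paths with \<open>k = 0\<close> are included.
\<close>

definition is_path :: "('v, 'e) multigraph \<Rightarrow> 'v list \<Rightarrow> 'e list \<Rightarrow> bool" where
  "is_path G vs es \<longleftrightarrow>
     length vs = Suc (length es) \<and> set vs \<subseteq> verts G \<and> set es \<subseteq> edges G \<and>
     (\<forall>i<length es. ends G (es ! i) = {vs ! i, vs ! Suc i})"

definition paths :: "('v, 'e) multigraph \<Rightarrow> 'v set \<Rightarrow> 'v set \<Rightarrow> ('v list \<times> 'e list) set" where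
  "paths G A B = {(vs, es). is_path G vs es \<and> hd vs \<in> A \<and> last vs \<in> B}"

definition connected_multigraph :: "('v, 'e) multigraph \<Rightarrow> bool" where
  "connected_multigraph G \<longleftrightarrow> (\<forall>v\<in>verts G. \<forall>w\<in>verts G. paths G {v} {w} \<noteq> {})"

definition edge_subgraph :: "('v, 'e) multigraph \<Rightarrow> 'e set \<Rightarrow> ('v, 'e) multigraph" where
  "edge_subgraph G F = \<lparr>verts = (\<Union>e\<in>F. ends G e), edges = F, ends = ends G\<rparr>"

definition multigraph_iso ::
  "('v, 'e) multigraph \<Rightarrow> ('w, 'f) multigraph \<Rightarrow> ('v \<Rightarrow> 'w) \<Rightarrow> ('e \<Rightarrow> 'f) \<Rightarrow> bool" where
  "multigraph_iso G H h\<^sub>V h\<^sub>E \<longleftrightarrow>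
     bij_betw h\<^sub>V (verts G) (verts H) \<and> bij_betw h\<^sub>E (edges G) (edges H) \<and>
     (\<forall>e\<in>edges G. ends H (h\<^sub>E e) = h\<^sub>V ` ends G e)"

text \<open>
  Simple iterated graph systems.  The generator is \<open>G\<^sub>1\<close>, \<open>lab S Neg e\<close> and
  \<open>lab S Pos e\<close> are the endpoints \<open>e\<^sup>-\<close> and \<open>e\<^sup>+\<close>, and \<open>glue S Neg\<close>, \<open>glue S Pos\<close> are
  \<open>\<phi>\<^sub>-\<close> and \<open>\<phi>\<^sub>+\<close>.
\<close>

datatype side = Neg | Pos

record ('v, 'e, 'i) igs =
  gen  :: "('v, 'e) multigraph"
  idx  :: "'i set"
  glue :: "side \<Rightarrow> 'i \<Rightarrow> 'v"
  lab  :: "side \<Rightarrow> 'e \<Rightarrow> 'v"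

definition bdry :: "('v, 'e, 'i) igs \<Rightarrow> side \<Rightarrow> 'v set" where
  "bdry S s = glue S s ` idx S"

definition simple_igs :: "('v, 'e, 'i) igs \<Rightarrow> bool" where
  "simple_igs S \<longleftrightarrow>
     finite_multigraph (gen S) \<and> connected_multigraph (gen S) \<and>
     finite (idx S) \<and> idx S \<noteq> {} \<and>
     (\<forall>s. inj_on (glue S s) (idx S) \<and> bdry S s \<subseteq> verts (gen S)) \<and>
     (\<forall>e\<in>edges (gen S). ends (gen S) e = {lab S Neg e, lab S Pos e}) \<and>
     bdry S Neg \<inter> bdry S Pos = {} \<and>
     (\<forall>e\<in>edges (gen S). \<forall>s. \<not> ends (gen S) e \<subseteq> bdry S s)"

definition doubling_igs :: "('v, 'e, 'i) igs \<Rightarrow> bool" where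
  "doubling_igs S \<longleftrightarrow> (\<forall>v\<in>bdry S Neg \<union> bdry S Pos. degree_of (gen S) v = 1)"

definition nondegenerate_igs :: "('v, 'e, 'i) igs \<Rightarrow> bool" where
  "nondegenerate_igs S \<longleftrightarrow>
     \<not> (\<exists>e\<in>edges (gen S). \<exists>v\<in>bdry S Neg. \<exists>w\<in>bdry S Pos. ends (gen S) e = {v, w})"

definition igs_symmetry :: "('v, 'e, 'i) igs \<Rightarrow> ('v \<Rightarrow> 'v) \<Rightarrow> ('e \<Rightarrow> 'e) \<Rightarrow> bool" where
  "igs_symmetry S \<eta>\<^sub>V \<eta>\<^sub>E \<longleftrightarrow>
     multigraph_iso (gen S) (gen S) \<eta>\<^sub>V \<eta>\<^sub>E \<and>
     (\<forall>i\<in>idx S. \<eta>\<^sub>V (glue S Neg i) = glue S Pos i \<and> \<eta>\<^sub>V (glue S Pos i) = glue S Neg i)"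

text \<open>
  An edge of the replacement graph \<open>G\<^sub>n\<close> is a list of \<open>n\<close> edges of the generator: the pair
  \<open>(e, f) \<in> E\<^sub>1 \<times> E\<^sub>n\<close> is \<open>e # f\<close>, and \<open>e \<in> E\<^sub>1\<close> is \<open>[e]\<close>.  Hence \<open>|e|\<close> is the
  length of \<open>e\<close>, the projection \<open>\<pi>\<^sub>n\<close> is \<^const>\<open>tl\<close>, and \<open>\<pi>\<close> from level \<open>n\<close> to level
  \<open>k\<close> drops the first \<open>n - k\<close> entries.
\<close>

definition repl_edges :: "('v, 'e, 'i) igs \<Rightarrow> nat \<Rightarrow> 'e list set" where
  "repl_edges S n = {e. length e = n \<and> set e \<subseteq> edges (gen S)}"

definition edge_proj :: "nat \<Rightarrow> nat \<Rightarrow> 'e list \<Rightarrow> 'e list" where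
  "edge_proj n k f = drop (n - k) f"

definition generated_equiv :: "'a set \<Rightarrow> ('a \<times> 'a) set \<Rightarrow> ('a \<times> 'a) set" where
  "generated_equiv A R = (R \<union> R\<inverse>)\<^sup>* \<inter> (A \<times> A)"

text \<open>
  \<open>vrel S n\<close> is the equivalence relation on \<open>V\<^sub>1 \<times> E\<^sub>n\<close> whose quotient is the vertex set of
  level \<open>Suc n\<close>.  With \<open>E\<^sub>0 = {[]}\<close> and the identity relation at \<open>n = 0\<close>, a vertex \<open>v\<close> of
  the generator appears at level 1 as \<open>{(v, [])}\<close>.  At level \<open>Suc n\<close>, two edges \<open>e\<close>, \<open>f\<close>
  share the vertex \<open>e\<^sup>s = f\<^sup>t\<close> iff the classes of the pairs \<open>(lab S s (hd e), tl e)\<close> and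
  \<open>(lab S t (hd f), tl f)\<close> coincide; the gluing maps of \<open>e\<close>, \<open>f\<close> at this vertex are then
  \<open>glue S s\<close> and \<open>glue S t\<close>.
\<close>

primrec vrel :: "('v, 'e, 'i) igs \<Rightarrow> nat \<Rightarrow> (('v \<times> 'e list) \<times> ('v \<times> 'e list)) set" where
  "vrel S 0 = Id_on (verts (gen S) \<times> repl_edges S 0)"
| "vrel S (Suc n) =
     generated_equiv (verts (gen S) \<times> repl_edges S (Suc n))
       {((glue S s i, e), (glue S t i, f)) | s t i e f.
          i \<in> idx S \<and> e \<in> repl_edges S (Suc n) \<and> f \<in> repl_edges S (Suc n) \<and>
          vrel S n `` {(lab S s (hd e), tl e)} = vrel S n `` {(lab S t (hd f), tl f)}}"

definition repl_lab :: "('v, 'e, 'i) igs \<Rightarrow> side \<Rightarrow> 'e list \<Rightarrow> ('v \<times> 'e list) set" where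
  "repl_lab S s e = vrel S (length e - 1) `` {(lab S s (hd e), tl e)}"

text \<open>The replacement graph \<open>G\<^sub>n\<close>, meaningful for \<open>n \<ge> 1\<close> only.\<close>

definition repl_graph ::
  "('v, 'e, 'i) igs \<Rightarrow> nat \<Rightarrow> (('v \<times> 'e list) set, 'e list) multigraph" where
  "repl_graph S n =
     \<lparr>verts = (verts (gen S) \<times> repl_edges S (n - 1)) // vrel S (n - 1),
      edges = repl_edges S n,
      ends = (\<lambda>e. {repl_lab S Neg e, repl_lab S Pos e})\<rparr>"

text \<open>The edge set of \<open>e \<cdot> G\<^bsub>n - |e|\<^esub>\<close>.\<close>

definition cell_edges :: "('v, 'e, 'i) igs \<Rightarrow> nat \<Rightarrow> 'e list \<Rightarrow> 'e list set" where
  "cell_edges S n e = {f \<in> repl_edges S n. edge_proj n (length e) f = e}"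

text \<open>
  The limit space.  Sequences are indexed from 0, but their entry at 0 is always \<open>[]\<close>.
\<close>

definition seq_space :: "('v, 'e, 'i) igs \<Rightarrow> (nat \<Rightarrow> 'e list) set" where
  "seq_space S = {x. \<forall>n. x n \<in> repl_edges S n \<and> tl (x (Suc n)) = x n}"

definition seq_rel ::
  "('v, 'e, 'i) igs \<Rightarrow> ((nat \<Rightarrow> 'e list) \<times> (nat \<Rightarrow> 'e list)) set" where
  "seq_rel S =
     {(x, y). x \<in> seq_space S \<and> y \<in> seq_space S \<and>
        (\<forall>n\<ge>1. ends (repl_graph S n) (x n) \<inter> ends (repl_graph S n) (y n) \<noteq> {})}"

definition limit_space :: "('v, 'e, 'i) igs \<Rightarrow> (nat \<Rightarrow> 'e list) set set" where
  "limit_space S = seq_space S // seq_rel S"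

definition admissible_density :: "('v, 'e, 'i) igs \<Rightarrow> ('e \<Rightarrow> real) \<Rightarrow> bool" where
  "admissible_density S \<rho> \<longleftrightarrow>
     (\<forall>(vs, es) \<in> paths (gen S) (bdry S Neg) (bdry S Pos). (\<Sum>e\<leftarrow>es. \<rho> e) \<ge> 1)"

definition symmetric_density :: "('v, 'e, 'i) igs \<Rightarrow> ('e \<Rightarrow> 'e) \<Rightarrow> ('e \<Rightarrow> real) \<Rightarrow> bool" where
  "symmetric_density S \<eta>\<^sub>E \<rho> \<longleftrightarrow> (\<forall>e\<in>edges (gen S). \<rho> (\<eta>\<^sub>E e) = \<rho> e)"

text \<open>The densities \<open>\<rho>\<^sub>n\<close> for all levels at once; the value at \<open>[]\<close> is never used.\<close>

primrec iter_density :: "('e \<Rightarrow> real) \<Rightarrow> 'e list \<Rightarrow> real" where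
  "iter_density \<rho> [] = 1"
| "iter_density \<rho> (e # f) = \<rho> e * iter_density \<rho> f"

definition vert_dist ::
  "('v, 'e, 'i) igs \<Rightarrow> ('e \<Rightarrow> real) \<Rightarrow> nat \<Rightarrow> ('v \<times> 'e list) set \<Rightarrow> ('v \<times> 'e list) set \<Rightarrow> real"
  where
  "vert_dist S \<rho> n v w =
     (if v = w then 0
      else Inf {(\<Sum>e\<in>\<Omega>. iter_density \<rho> e) | \<Omega>.
             \<Omega> \<subseteq> (\<Union>i\<in>{1..n}. repl_edges S i) \<and>
             paths (edge_subgraph (repl_graph S n) (\<Union>e\<in>\<Omega>. cell_edges S n e)) {v} {w} \<noteq> {}})"

definition edge_dist ::
  "('v, 'e, 'i) igs \<Rightarrow> ('e \<Rightarrow> real) \<Rightarrow> nat \<Rightarrow> 'e list \<Rightarrow> 'e list \<Rightarrow> real" where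
  "edge_dist S \<rho> n e f =
     Min {vert_dist S \<rho> n v w | v w. v \<in> ends (repl_graph S n) e \<and> w \<in> ends (repl_graph S n) f}"

text \<open>
  The limit must exist and be the same for all representatives of the two points.
  The value 0 off the limit space is needed since \<^locale>\<open>Metric_space\<close> requires
  nonnegativity and symmetry on the whole type.
\<close>

definition limit_dist ::
  "('v, 'e, 'i) igs \<Rightarrow> ('e \<Rightarrow> real) \<Rightarrow> (nat \<Rightarrow> 'e list) set \<Rightarrow> (nat \<Rightarrow> 'e list) set \<Rightarrow> real"
  where
  "limit_dist S \<rho> p q =
     (if p \<in> limit_space S \<and> q \<in> limit_space S
      then THE r. \<forall>x\<in>p. \<forall>y\<in>q. (\<lambda>n. edge_dist S \<rho> n (x n) (y n)) \<longlonglongrightarrow> r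
      else 0)"

text \<open>Borel measures that are finite on compact sets, outer regular on Borel sets and inner
  regular on open sets.\<close>

definition radon_measure :: "'a topology \<Rightarrow> 'a measure \<Rightarrow> bool" where
  "radon_measure T \<mu> \<longleftrightarrow>
     space \<mu> = topspace T \<and> sets \<mu> = sigma_sets (topspace T) {U. openin T U} \<and>
     (\<forall>K. compactin T K \<longrightarrow> emeasure \<mu> K < \<infinity>) \<and>
     (\<forall>A\<in>sets \<mu>. emeasure \<mu> A = (INF U\<in>{U. openin T U \<and> A \<subseteq> U}. emeasure \<mu> U)) \<and>
     (\<forall>U. openin T U \<longrightarrow> emeasure \<mu> U = (SUP K\<in>{K. compactin T K \<and> K \<subseteq> U}. emeasure \<mu> K))"

definition metric_diam :: "'a set \<Rightarrow> ('a \<Rightarrow> 'a \<Rightarrow> real) \<Rightarrow> ennreal" where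
  "metric_diam X d = (SUP x\<in>X. SUP y\<in>X. ennreal (d x y))"

definition ahlfors_regular :: "real \<Rightarrow> 'a set \<Rightarrow> ('a \<Rightarrow> 'a \<Rightarrow> real) \<Rightarrow> bool" where
  "ahlfors_regular Q X d \<longleftrightarrow>
     Metric_space X d \<and> Q > 0 \<and>
     (\<exists>\<mu> C. radon_measure (Metric_space.mtopology X d) \<mu> \<and> C \<ge> 1 \<and>
        (\<forall>x\<in>X. \<forall>r>0. ennreal r \<le> 2 * metric_diam X d \<longrightarrow>
           ennreal (inverse C * r powr Q) \<le> emeasure \<mu> (Metric_space.mball X d x r) \<and>
           emeasure \<mu> (Metric_space.mball X d x r) \<le> ennreal (C * r powr Q)))"

definition quasisymmetrically_equivalent ::
  "'a set \<Rightarrow> ('a \<Rightarrow> 'a \<Rightarrow> real) \<Rightarrow> ('a \<Rightarrow> 'a \<Rightarrow> real) \<Rightarrow> bool" where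
  "quasisymmetrically_equivalent X d \<delta> \<longleftrightarrow>
     Metric_space X d \<and> Metric_space X \<delta> \<and>
     homeomorphic_map (Metric_space.mtopology X d) (Metric_space.mtopology X \<delta>) id \<and>
     (\<exists>\<psi> \<psi>'. homeomorphism {0::real..} {0::real..} \<psi> \<psi>' \<and>
        (\<forall>x\<in>X. \<forall>y\<in>X. \<forall>z\<in>X. x \<noteq> z \<longrightarrow> \<delta> x y / \<delta> x z \<le> \<psi> (d x y / d x z)))"

end

theory Submission
  imports Defs "HOL-Probability.Infinite_Product_Measure"
begin

text \<open>
  The distance between two points is comparable to \<open>\<rho>\<^sub>n(x\<^sub>n)\<close>, where \<open>n\<close> is the last level
  at which the edges of the two sequences still meet; this level does not depend on \<open>\<rho>\<close>.
  For the upper bound, the two meeting edges already connect the points, and their weights are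
  comparable by the doubling and symmetry assumptions.  For the lower bound, a family \<open>\<Omega>\<close> of
  cells that is too light is avoided by a cut between the edge \<open>x\<^sub>n\<^sub>+\<^sub>1\<close> and all edges disjoint
  from it; by admissibility the cut can be refined from each level to the next one.

  Along a sequence, the weights for two densities are bounded by powers of each other, which gives
  a power quasisymmetry.  The push-forward of the Bernoulli measure with letter weights
  \<open>\<rho>(e)\<^sup>Q\<close> is Ahlfors regular, since at every level only boundedly many edges meet a given edge.
\<close>

section \<open>Paths and reachability\<close>

text \<open>The family \<open>\<Omega>\<close> may mix cells of all levels, and a connection through
  it may wander arbitrarily deep inside a cell, so admissibility cannot be applied to a path
  directly. The lower bound is therefore dual: the vertices of each level are coloured with two
  colours, and the mass of \<open>\<Omega>\<close> inside a crossed cell acts as a budget for the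
  next level. Admissibility itself enters only in G_1, where edges of total weight below 1 cannot
  join I_- to I_+. Symmetry is what keeps the comparison constant for meeting edges from
  deteriorating with the level: once two words have diverged, the letters added to both while they
  still meet have equal weight. Meeting of edges is not transitive at a single level. Non-degeneracy
  makes it transitive at the price of one level, which is harmless for infinite sequences. Words
  grow at the front, so the ancestors of a word are its suffixes, and \<open>drop (m - n)\<close>
  takes a word of level \<open>m\<close> to its ancestor of level \<open>n\<close>.\<close>

definition edge_step :: "('v, 'e) multigraph \<Rightarrow> 'e set \<Rightarrow> ('v \<times> 'v) set" where
  "edge_step G F = {(v, w). \<exists>e\<in>F. ends G e = {v, w}}"

lemma edge_step_mono: "F \<subseteq> F' \<Longrightarrow> edge_step G F \<subseteq> edge_step G F'"
  by (auto simp: edge_step_def)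

lemma sym_reach: "(v, w) \<in> (edge_step G F)\<^sup>* \<Longrightarrow> (w, v) \<in> (edge_step G F)\<^sup>*"
proof -
  have "sym (edge_step G F)"
    by (auto simp: sym_def edge_step_def insert_commute)
  then show "(v, w) \<in> (edge_step G F)\<^sup>* \<Longrightarrow> (w, v) \<in> (edge_step G F)\<^sup>*"
    by (meson sym_rtrancl symD)
qed

lemma reach_mono: "(v, w) \<in> (edge_step G F)\<^sup>* \<Longrightarrow> F \<subseteq> F' \<Longrightarrow> (v, w) \<in> (edge_step G F')\<^sup>*"
  using rtrancl_mono[OF edge_step_mono] by (rule subsetD)

lemma is_path_Cons:
  "is_path G (v # vs) (e # es) \<longleftrightarrow>
     v \<in> verts G \<and> e \<in> edges G \<and> vs \<noteq> [] \<and> ends G e = {v, hd vs} \<and> is_path G vs es"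
  by (cases vs) (auto simp: is_path_def All_less_Suc2)

lemma is_path_Nil: "is_path G vs [] \<longleftrightarrow> (\<exists>v\<in>verts G. vs = [v])"
  by (cases vs) (auto simp: is_path_def)

lemma is_path_nonempty: "is_path G vs es \<Longrightarrow> vs \<noteq> []"
  by (auto simp: is_path_def)

lemma is_path_ends: "is_path G vs es \<Longrightarrow> e \<in> set es \<Longrightarrow> ends G e \<subseteq> set vs"
proof -
  assume p: "is_path G vs es" "e \<in> set es"
  then obtain i where "i < length es" "e = es ! i" by (metis in_set_conv_nth)
  with p(1) show ?thesis by (auto simp: is_path_def)
qed

lemma is_path_drop: "is_path G vs es \<Longrightarrow> k \<le> length es \<Longrightarrow> is_path G (drop k vs) (drop k es)"
  by (auto simp: is_path_def dest: in_set_dropD)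

lemma path_reach: "is_path G vs es \<Longrightarrow> (hd vs, last vs) \<in> (edge_step G (set es))\<^sup>*"
proof (induction es arbitrary: vs)
  case Nil
  then show ?case by (auto simp: is_path_Nil)
next
  case (Cons e es)
  from Cons.prems obtain v us where vs: "vs = v # us"
    by (cases vs) (auto simp: is_path_def)
  with Cons.prems have e: "ends G e = {v, hd us}" "us \<noteq> []" and us: "is_path G us es"
    by (auto simp: is_path_Cons)
  have "(v, hd us) \<in> edge_step G (set (e # es))"
    using e by (auto simp: edge_step_def)
  moreover have "(hd us, last us) \<in> (edge_step G (set (e # es)))\<^sup>*"
    using Cons.IH[OF us] by (rule reach_mono) auto
  ultimately show ?case
    using vs e(2) by (auto intro: converse_rtrancl_into_rtrancl)
qed

text \<open>Whenever the new start vertex already lies on the path, the path is cut at that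
  occurrence. Distinct vertices force distinct edges, and these turn the sum along a path in
  \<open>admissible_density\<close> into a sum over a set of edges.\<close>

lemma reach_simple_path:
  assumes "(v, w) \<in> (edge_step G F)\<^sup>*" and F: "F \<subseteq> edges G" "\<And>e. e \<in> F \<Longrightarrow> ends G e \<subseteq> verts G"
    and w: "w \<in> verts G"
  shows "\<exists>vs es. is_path G vs es \<and> set es \<subseteq> F \<and> hd vs = v \<and> last vs = w \<and> distinct vs \<and> distinct es"
  using assms(1)
proof (induction rule: converse_rtrancl_induct)
  case base
  show ?case
    using w by (intro exI[of _ "[w]"] exI[of _ "[]"]) (auto simp: is_path_Nil)
next
  case (step v u)
  then obtain vs es where p: "is_path G vs es" "set es \<subseteq> F" "hd vs = u" "last vs = w"
    "distinct vs" "distinct es" by blast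
  from step(1) obtain e where e: "e \<in> F" "ends G e = {v, u}" by (auto simp: edge_step_def)
  show ?case
  proof (cases "v \<in> set vs")
    case True
    then obtain k where k: "k < length vs" "vs ! k = v" by (auto simp: in_set_conv_nth)
    with p(1) have k': "k \<le> length es" by (auto simp: is_path_def)
    show ?thesis
      using p k k' set_drop_subset[of k es]
      by (intro exI[of _ "drop k vs"] exI[of _ "drop k es"])
        (auto simp: is_path_drop hd_drop_conv_nth)
  next
    case False
    with p(1) e have "e \<notin> set es" using is_path_ends by fastforce
    moreover have "v \<in> verts G" using F(2)[OF e(1)] e(2) by simp
    moreover have "vs \<noteq> []" using p(1) by (rule is_path_nonempty)
    ultimately show ?thesis
      using p e F False
      by (intro exI[of _ "v # vs"] exI[of _ "e # es"]) (auto simp: is_path_Cons)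
  qed
qed

text \<open>The vertices of \<open>edge_subgraph\<close> are only the endpoints of \<open>F\<close>,
  so the trivial path at a vertex need not be a path of the subgraph; hence the condition
  \<open>v \<noteq> w\<close>.\<close>

lemma paths_edge_subgraph_iff:
  assumes "v \<noteq> w"
  shows "paths (edge_subgraph G F) {v} {w} \<noteq> {} \<longleftrightarrow> (v, w) \<in> (edge_step G F)\<^sup>*"
proof
  assume "paths (edge_subgraph G F) {v} {w} \<noteq> {}"
  then obtain vs es where p: "is_path (edge_subgraph G F) vs es" "hd vs = v" "last vs = w"
    by (auto simp: paths_def)
  then have "set es \<subseteq> F" by (auto simp: is_path_def edge_subgraph_def)
  moreover have "(v, w) \<in> (edge_step G (set es))\<^sup>*"
    using path_reach[OF p(1)] p by (simp add: edge_step_def edge_subgraph_def)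
  ultimately show "(v, w) \<in> (edge_step G F)\<^sup>*" by (blast intro: reach_mono)
next
  assume r: "(v, w) \<in> (edge_step G F)\<^sup>*"
  let ?H = "edge_subgraph G F"
  have r': "(v, w) \<in> (edge_step ?H F)\<^sup>*" using r by (simp add: edge_step_def edge_subgraph_def)
  from r assms obtain u where "(u, w) \<in> edge_step G F" by (meson rtranclE)
  then have "w \<in> verts ?H" by (auto simp: edge_step_def edge_subgraph_def)
  with reach_simple_path[OF r'] show "paths ?H {v} {w} \<noteq> {}"
    by (fastforce simp: paths_def edge_subgraph_def)
qed

section \<open>Incidence of words\<close>

locale laakso_igs =
  fixes S :: "('v, 'e, 'i) igs" and \<eta>\<^sub>V :: "'v \<Rightarrow> 'v" and \<eta>\<^sub>E :: "'e \<Rightarrow> 'e"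
  assumes simple: "simple_igs S" and doubling: "doubling_igs S"
    and nondegenerate: "nondegenerate_igs S" and symmetry: "igs_symmetry S \<eta>\<^sub>V \<eta>\<^sub>E"
begin

abbreviation "E \<equiv> edges (gen S)"
abbreviation "words \<equiv> repl_edges S"

text \<open>Stated through edge ends, so that no level has to be carried along. The empty word
  touches itself by reflexivity, which makes level 0 harmless.\<close>

definition touch :: "'e list \<Rightarrow> 'e list \<Rightarrow> bool" where
  "touch e f \<longleftrightarrow> (\<exists>s t. repl_lab S s e = repl_lab S t f)"

lemma UNIV_side: "(UNIV :: side set) = {Neg, Pos}"
  using side.exhaust by auto

lemma finite_side: "finite (UNIV :: side set)"
  by (simp add: UNIV_side)

lemma side_cases: "s = Neg \<or> s = Pos" for s :: side
  by (cases s) auto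

lemma finite_E: "finite E"
  using simple by (simp add: simple_igs_def finite_multigraph_def)

lemma ends_gen: "a \<in> E \<Longrightarrow> ends (gen S) a = {lab S Neg a, lab S Pos a}"
  using simple by (simp add: simple_igs_def)

lemma lab_gen:
  assumes "a \<in> E"
  shows lab_verts: "lab S s a \<in> verts (gen S)" and lab_neq: "lab S Neg a \<noteq> lab S Pos a"
proof -
  from assms simple obtain v w where vw: "v \<in> verts (gen S)" "w \<in> verts (gen S)" "v \<noteq> w"
    "ends (gen S) a = {v, w}"
    unfolding simple_igs_def finite_multigraph_def by blast
  then have *: "{lab S Neg a, lab S Pos a} = {v, w}"
    using ends_gen[OF assms] by simp
  then show "lab S s a \<in> verts (gen S)"
    using vw by (cases s) (auto simp: doubleton_eq_iff)
  show "lab S Neg a \<noteq> lab S Pos a"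
    using * vw(3) by (auto simp: doubleton_eq_iff)
qed

lemma lab_eq_side: "a \<in> E \<Longrightarrow> lab S s a = lab S t a \<Longrightarrow> s = t"
  using lab_neq[of a] by (cases s; cases t) auto

lemma ends_gen_iff: "a \<in> E \<Longrightarrow> v \<in> ends (gen S) a \<longleftrightarrow> (\<exists>s. v = lab S s a)"
proof -
  assume a: "a \<in> E"
  have "(\<exists>s. v = lab S s a) \<longleftrightarrow> v \<in> range (\<lambda>s. lab S s a)" by blast
  then show ?thesis by (simp add: ends_gen[OF a] UNIV_side)
qed

lemma glue_verts: "i \<in> idx S \<Longrightarrow> glue S s i \<in> verts (gen S)"
  using simple by (auto simp: simple_igs_def bdry_def)

lemma glue_inj:
  assumes "i \<in> idx S" "j \<in> idx S" "glue S s i = glue S t j"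
  shows "s = t" "i = j"
proof -
  have d: "glue S Neg k \<noteq> glue S Pos l" if "k \<in> idx S" "l \<in> idx S" for k l
    using simple that by (auto simp: simple_igs_def bdry_def)
  show st: "s = t" using d[of i j] d[of j i] assms by (cases s; cases t) auto
  have "inj_on (glue S s) (idx S)" using simple by (simp add: simple_igs_def)
  then show "i = j" using assms st by (auto dest: inj_onD)
qed

lemma idx_nonempty: "idx S \<noteq> {}"
  using simple by (simp add: simple_igs_def)

text \<open>Doubling means that a boundary vertex has a single edge. The end \<open>t\<close> is
  determined as well, since G_1 has no loops.\<close>

lemma glue_edge:
  assumes "i \<in> idx S"
  obtains a t where "a \<in> E" "lab S t a = glue S s i"
    "\<And>b u. b \<in> E \<Longrightarrow> lab S u b = glue S s i \<Longrightarrow> b = a \<and> u = t"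
proof -
  have "glue S s i \<in> bdry S Neg \<union> bdry S Pos"
    using assms by (cases s) (auto simp: bdry_def)
  then have "card {e \<in> E. glue S s i \<in> ends (gen S) e} = 1"
    using doubling by (auto simp: doubling_igs_def degree_of_def)
  then obtain a where a: "{e \<in> E. glue S s i \<in> ends (gen S) e} = {a}"
    by (meson card_1_singletonE)
  then have aE: "a \<in> E" "glue S s i \<in> ends (gen S) a" by auto
  then obtain t where t: "lab S t a = glue S s i" using ends_gen_iff[of a] by auto
  show thesis
  proof (rule that[OF aE(1) t])
    fix b u assume b: "b \<in> E" "lab S u b = glue S s i"
    then have "b \<in> {e \<in> E. glue S s i \<in> ends (gen S) e}" using ends_gen_iff[of b] by (auto intro: sym)
    with a have "b = a" by auto
    with b t lab_eq_side[OF aE(1)] show "b = a \<and> u = t" by metis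
  qed
qed

lemma E_nonempty: "E \<noteq> {}"
  using idx_nonempty glue_edge by (metis all_not_in_conv)

lemma glue_edge_unique:
  assumes "i \<in> idx S" "a \<in> E" "b \<in> E" "lab S s a = glue S u i" "lab S t b = glue S u i"
  shows "a = b" "s = t"
  using assms by (metis glue_edge)+

text \<open>The symmetry exchanges the two boundary vertices of index \<open>i\<close>, hence also
  the single edges at them.\<close>

lemma glue_edge_swap:
  assumes i: "i \<in> idx S" and ab: "a \<in> E" "b \<in> E"
    and a: "lab S s a = glue S u i" and b: "lab S t b = glue S v i" and "u \<noteq> v"
  shows "\<eta>\<^sub>E a = b"
proof -
  have iso: "multigraph_iso (gen S) (gen S) \<eta>\<^sub>V \<eta>\<^sub>E"
    and \<eta>: "\<eta>\<^sub>V (glue S Neg i) = glue S Pos i" "\<eta>\<^sub>V (glue S Pos i) = glue S Neg i"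
    using symmetry i by (auto simp: igs_symmetry_def)
  have "\<eta>\<^sub>E a \<in> E" using iso ab by (auto simp: multigraph_iso_def bij_betw_def)
  moreover have "\<eta>\<^sub>V (glue S u i) = glue S v i"
    using \<eta> \<open>u \<noteq> v\<close> by (cases u; cases v) auto
  moreover have "\<eta>\<^sub>V (lab S s a) \<in> ends (gen S) (\<eta>\<^sub>E a)"
    using iso ab ends_gen_iff[of a] by (auto simp: multigraph_iso_def)
  ultimately obtain r where "lab S r (\<eta>\<^sub>E a) = glue S v i" "\<eta>\<^sub>E a \<in> E"
    using a ends_gen_iff by metis
  then show ?thesis using glue_edge_unique[OF i _ ab(2) _ b] by blast
qed

section \<open>Words of letters and equality of vertices\<close>

lemma Cons_words: "a # e \<in> words (Suc n) \<longleftrightarrow> a \<in> E \<and> e \<in> words n"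
  by (auto simp: repl_edges_def)

lemma words_Suc: "e \<in> words (Suc n) \<longleftrightarrow> (\<exists>a f. e = a # f \<and> a \<in> E \<and> f \<in> words n)"
  by (cases e) (auto simp: repl_edges_def)

lemma words_0: "words 0 = {[]}"
  by (auto simp: repl_edges_def)

lemma length_words: "e \<in> words n \<Longrightarrow> length e = n"
  by (auto simp: repl_edges_def)

lemma finite_words: "finite (words n)"
  using finite_lists_length_eq[OF finite_E] by (auto simp: repl_edges_def conj_commute)

lemma equiv_generated_equiv: "equiv A (generated_equiv A R)"
proof -
  have "sym (R \<union> R\<inverse>)" by (auto simp: sym_def)
  then have "sym ((R \<union> R\<inverse>)\<^sup>*)" by (rule sym_rtrancl)
  then show ?thesis
    unfolding generated_equiv_def
    by (intro equivI) (auto simp: refl_on_def sym_def intro!: transI)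
qed

lemma equiv_vrel: "equiv (verts (gen S) \<times> words n) (vrel S n)"
proof (cases n)
  case 0
  then show ?thesis by (auto simp: equiv_def refl_on_def sym_def trans_def)
next
  case (Suc m)
  then show ?thesis using equiv_generated_equiv by simp
qed

text \<open>A symmetric and transitive relation lacks only the diagonal. Consequently equality of
  vertices needs no chains of gluings.\<close>

lemma generated_equiv_PER:
  assumes "R \<subseteq> A \<times> A" "sym R" "trans R"
  shows "generated_equiv A R = R \<union> Id_on A"
proof -
  have "R \<union> R\<inverse> = R" using assms(2) by (auto simp: sym_def)
  moreover have "R\<^sup>* = R \<union> Id" using assms(3)
    by (metis reflcl_trancl trancl_id)
  ultimately show ?thesis using assms(1) by (auto simp: generated_equiv_def)
qed

definition glued :: "nat \<Rightarrow> (('v \<times> 'e list) \<times> ('v \<times> 'e list)) set" where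
  "glued n = {((glue S s i, e), (glue S t i, f)) | s t i e f.
          i \<in> idx S \<and> e \<in> words (Suc n) \<and> f \<in> words (Suc n) \<and>
          repl_lab S s e = repl_lab S t f}"

text \<open>The generating relation is already transitive, because \<open>(s, i)\<close> is determined by
  \<open>glue S s i\<close>.\<close>

lemma vrel_Suc: "vrel S (Suc n) = glued n \<union> Id_on (verts (gen S) \<times> words (Suc n))"
proof -
  have "vrel S (Suc n) = generated_equiv (verts (gen S) \<times> words (Suc n)) (glued n)"
  proof -
    have "glued n = {((glue S s i, e), (glue S t i, f)) | s t i e f.
          i \<in> idx S \<and> e \<in> words (Suc n) \<and> f \<in> words (Suc n) \<and>
          vrel S n `` {(lab S s (hd e), tl e)} = vrel S n `` {(lab S t (hd f), tl f)}}"
      unfolding glued_def repl_lab_def by (intro Collect_cong ex_cong1) (auto simp: length_words)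
    then show ?thesis by simp
  qed
  also have "\<dots> = glued n \<union> Id_on (verts (gen S) \<times> words (Suc n))"
  proof (rule generated_equiv_PER)
    show "glued n \<subseteq> (verts (gen S) \<times> words (Suc n)) \<times> verts (gen S) \<times> words (Suc n)"
      by (auto simp: glued_def glue_verts)
    show "sym (glued n)" unfolding glued_def sym_def by (clarsimp) metis
    show "trans (glued n)"
    proof (rule transI)
      fix p q r assume "(p, q) \<in> glued n" "(q, r) \<in> glued n"
      then obtain s t i e f s' t' i' e' f' where
        *: "p = (glue S s i, e)" "q = (glue S t i, f)" "i \<in> idx S" "e \<in> words (Suc n)"
        "repl_lab S s e = repl_lab S t f"
        "q = (glue S s' i', e')" "r = (glue S t' i', f')" "i' \<in> idx S" "f' \<in> words (Suc n)"
        "repl_lab S s' e' = repl_lab S t' f'"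
        unfolding glued_def by auto
      then have "t = s'" "i = i'" "f = e'" using glue_inj[of i i' t s'] by auto
      with * show "(p, r) \<in> glued n" unfolding glued_def by blast
    qed
  qed
  finally show ?thesis .
qed

lemma repl_lab_Cons: "repl_lab S s (a # e) = vrel S (length e) `` {(lab S s a, e)}"
  by (simp add: repl_lab_def)

lemma repl_lab_eq_vrel:
  assumes "a # e \<in> words (Suc n)" "b # f \<in> words (Suc n)"
  shows "repl_lab S s (a # e) = repl_lab S t (b # f) \<longleftrightarrow> ((lab S s a, e), (lab S t b, f)) \<in> vrel S n"
  using assms eq_equiv_class_iff[OF equiv_vrel[of n], of "(lab S s a, e)" "(lab S t b, f)"]
  by (auto simp: Cons_words length_words lab_verts repl_lab_Cons)

lemma repl_lab_eq_0:
  assumes "a \<in> E" "b \<in> E"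
  shows "repl_lab S s [a] = repl_lab S t [b] \<longleftrightarrow> lab S s a = lab S t b"
proof -
  have "[a] \<in> words (Suc 0)" "[b] \<in> words (Suc 0)"
    using assms by (simp_all add: Cons_words words_0)
  from repl_lab_eq_vrel[OF this, of s t] show ?thesis
    using assms by (simp add: lab_verts words_0 Id_on_iff)
qed

lemma repl_lab_eq_Suc:
  assumes "a # e \<in> words (Suc (Suc n))" "b # f \<in> words (Suc (Suc n))"
  shows "repl_lab S s (a # e) = repl_lab S t (b # f) \<longleftrightarrow>
    e = f \<and> lab S s a = lab S t b \<or>
    (\<exists>u v i. i \<in> idx S \<and> lab S s a = glue S u i \<and> lab S t b = glue S v i \<and>
       repl_lab S u e = repl_lab S v f)"
  unfolding repl_lab_eq_vrel[OF assms] vrel_Suc glued_def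
  using assms by (auto simp: Cons_words lab_verts)

text \<open>This is uniform in \<open>n\<close>: at level 1 both words \<open>e\<close>, \<open>f\<close> are empty.\<close>

lemma repl_lab_eqE:
  assumes "repl_lab S s (a # e) = repl_lab S t (b # f)" "a # e \<in> words (Suc n)" "b # f \<in> words (Suc n)"
  obtains "e = f" "lab S s a = lab S t b"
  | u v i m where "n = Suc m" "i \<in> idx S" "lab S s a = glue S u i" "lab S t b = glue S v i"
    "repl_lab S u e = repl_lab S v f"
proof (cases n)
  case 0
  then show ?thesis using assms that(1) repl_lab_eq_0[of a b s t] by (auto simp: Cons_words words_0)
next
  case (Suc m)
  then show ?thesis using assms that repl_lab_eq_Suc[of a e m b f s t] by auto
qed

lemma repl_lab_glued:
  assumes "e \<in> words (Suc n)" "f \<in> words (Suc n)" "a \<in> E" "b \<in> E" "i \<in> idx S"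
    "lab S s a = glue S u i" "lab S t b = glue S v i" "repl_lab S u e = repl_lab S v f"
  shows "repl_lab S s (a # e) = repl_lab S t (b # f)"
  using assms repl_lab_eq_Suc[of a e n b f s t] by (auto simp: Cons_words)

lemma ends_repl: "ends (repl_graph S n) e = range (\<lambda>s. repl_lab S s e)"
  by (auto simp: repl_graph_def UNIV_side)

lemma touch_iff_ends: "touch e f \<longleftrightarrow> ends (repl_graph S n) e \<inter> ends (repl_graph S n) f \<noteq> {}"
  by (auto simp: touch_def ends_repl)

lemma touch_refl: "touch e e" and touch_sym: "touch e f \<Longrightarrow> touch f e"
  by (auto simp: touch_def intro: sym)

text \<open>A vertex shared by two children lies either in a common parent cell or on a vertex
  shared by the parents. Hence the levels at which two sequences meet form an initial
  segment.\<close>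

lemma touch_Cons:
  assumes "touch (a # e) (b # f)" "a # e \<in> words (Suc n)" "b # f \<in> words (Suc n)"
  shows "touch e f"
  using assms(1) unfolding touch_def
proof (elim exE)
  fix s t assume "repl_lab S s (a # e) = repl_lab S t (b # f)"
  then show "\<exists>s t. repl_lab S s e = repl_lab S t f"
    by (rule repl_lab_eqE) (use assms in auto)
qed

text \<open>Degrees do not grow with the level. A vertex whose letter vertex is not in the boundary
  of G_1 only sees children of its own cell, at most \<open>2 * card E\<close> edge ends. At a
  boundary vertex, doubling leaves at most one child end for each edge end at the corresponding
  vertex of the previous level.\<close>

lemma neighbour_degree:
  "e \<in> words (Suc n) \<Longrightarrow>
    card {(f, t). f \<in> words (Suc n) \<and> repl_lab S s e = repl_lab S t f} \<le> 2 * card E"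
proof (induction n arbitrary: e s)
  case 0
  have "{(f, t). f \<in> words (Suc 0) \<and> repl_lab S s e = repl_lab S t f} \<subseteq> (\<lambda>(b, t). ([b], t)) ` (E \<times> UNIV)"
    by (auto simp: words_Suc words_0)
  then have "card {(f, t). f \<in> words (Suc 0) \<and> repl_lab S s e = repl_lab S t f} \<le> card (E \<times> (UNIV :: side set))"
    by (intro surj_card_le) (auto simp: finite_E UNIV_side)
  then show ?case by (simp add: UNIV_side card_cartesian_product)
next
  case (Suc n)
  let ?N = "\<lambda>n s e. {(f, t). f \<in> words (Suc n) \<and> repl_lab S s e = repl_lab S t f}"
  have fin: "finite (?N n s e)" for n s e
    by (rule finite_subset[of _ "words (Suc n) \<times> UNIV"]) (auto simp: finite_words finite_side)
  from Suc.prems obtain a e' where e: "e = a # e'" "a \<in> E" "e' \<in> words (Suc n)"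
    using words_Suc[of e "Suc n"] by auto
  show ?case
  proof (cases "\<exists>u i. i \<in> idx S \<and> lab S s a = glue S u i")
    case True
    then obtain u i where ui: "i \<in> idx S" "lab S s a = glue S u i" by auto
    \<comment> \<open>\<open>P v\<close> describes the edge ends at \<open>glue S v i\<close>; by
      doubling there is only one, so \<open>h\<close> recovers the child end from the parent
      end.\<close>
    define P where "P v bt \<longleftrightarrow> fst bt \<in> E \<and> lab S (snd bt) (fst bt) = glue S v i" for v bt
    define h where "h = (\<lambda>(f, v). let (b, t) = (SOME bt. P v bt) in (b # f, t))"
    have "?N (Suc n) s e \<subseteq> h ` ?N n u e'"
    proof
      fix p assume "p \<in> ?N (Suc n) s e"
      then obtain b f t where p: "p = (b # f, t)" "b \<in> E" "f \<in> words (Suc n)"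
        "repl_lab S s e = repl_lab S t (b # f)" by (auto simp: words_Suc[of _ "Suc n"])
      have "\<exists>v. lab S t b = glue S v i \<and> repl_lab S u e' = repl_lab S v f"
        using p(4) unfolding e(1)
      proof (rule repl_lab_eqE)
        show "a # e' \<in> words (Suc (Suc n))" "b # f \<in> words (Suc (Suc n))"
          using e p by (auto simp: Cons_words)
      next
        assume "e' = f" "lab S s a = lab S t b"
        then show ?thesis using ui by metis
      next
        fix u' v' j m assume *: "j \<in> idx S" "lab S s a = glue S u' j" "lab S t b = glue S v' j"
          "repl_lab S u' e' = repl_lab S v' f"
        then have "u' = u" "j = i" using glue_inj[of i j u u'] ui by auto
        with * show ?thesis by auto
      qed
      then obtain v where v: "lab S t b = glue S v i" "repl_lab S u e' = repl_lab S v f" by auto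
      then have "P v (b, t)" using p by (simp add: P_def)
      moreover have "bt = (b, t)" if "P v bt" for bt
        using that glue_edge_unique[OF ui(1) _ p(2) _ v(1), of "fst bt" "snd bt"]
        by (cases bt) (auto simp: P_def)
      ultimately have "(SOME bt. P v bt) = (b, t)" by (rule some_equality)
      then have "p = h (f, v)" using p by (simp add: h_def)
      then show "p \<in> h ` ?N n u e'" using v p by auto
    qed
    then have "card (?N (Suc n) s e) \<le> card (?N n u e')" by (rule surj_card_le[OF fin])
    also have "\<dots> \<le> 2 * card E" using Suc.IH[OF e(3)] .
    finally show ?thesis .
  next
    case False
    have "?N (Suc n) s e \<subseteq> (\<lambda>(b, t). (b # e', t)) ` (E \<times> UNIV)"
    proof
      fix p assume "p \<in> ?N (Suc n) s e"
      then obtain b f t where p: "p = (b # f, t)" "b \<in> E" "f \<in> words (Suc n)"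
        "repl_lab S s e = repl_lab S t (b # f)" by (auto simp: words_Suc[of _ "Suc n"])
      have "f = e'" using p(4) unfolding e(1)
        by (rule repl_lab_eqE) (use False e p in \<open>auto simp: Cons_words\<close>)
      then show "p \<in> (\<lambda>(b, t). (b # e', t)) ` (E \<times> UNIV)" using p by auto
    qed
    then have "card (?N (Suc n) s e) \<le> card (E \<times> (UNIV :: side set))"
      by (intro surj_card_le) (auto simp: finite_E UNIV_side)
    then show ?thesis by (simp add: UNIV_side card_cartesian_product)
  qed
qed

lemma card_touch:
  assumes "e \<in> words (Suc n)"
  shows "card {f \<in> words (Suc n). touch e f} \<le> 4 * card E"
proof -
  let ?N = "\<lambda>s. {(f, t). f \<in> words (Suc n) \<and> repl_lab S s e = repl_lab S t f}"
  have fin: "finite (?N s)" for s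
    by (rule finite_subset[of _ "words (Suc n) \<times> UNIV"]) (auto simp: finite_words finite_side)
  have "{f \<in> words (Suc n). touch e f} \<subseteq> fst ` (?N Neg \<union> ?N Pos)"
  proof
    fix f assume "f \<in> {f \<in> words (Suc n). touch e f}"
    then obtain s t where "(f, t) \<in> ?N s" by (auto simp: touch_def)
    then have "(f, t) \<in> ?N Neg \<union> ?N Pos" using side_cases[of s] by blast
    then show "f \<in> fst ` (?N Neg \<union> ?N Pos)" by force
  qed
  then have "card {f \<in> words (Suc n). touch e f} \<le> card (?N Neg \<union> ?N Pos)"
    by (rule surj_card_le[rotated]) (use fin in auto)
  also have "\<dots> \<le> card (?N Neg) + card (?N Pos)" by (rule card_Un_le)
  also have "\<dots> \<le> 4 * card E" using neighbour_degree[OF assms, of Neg] neighbour_degree[OF assms, of Pos]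
    by linarith
  finally show ?thesis .
qed

end

section \<open>Connectivity of unions of cells\<close>

context laakso_igs
begin

abbreviation "reach n F \<equiv> (edge_step (repl_graph S n) F)\<^sup>*"

definition cover :: "nat \<Rightarrow> 'e list set \<Rightarrow> 'e list set" where
  "cover n \<Omega> = (\<Union>e\<in>\<Omega>. cell_edges S n e)"

definition lift :: "'e list set \<Rightarrow> 'e list set" where
  "lift F = {a # e | a e. a \<in> E \<and> e \<in> F}"

abbreviation "words_upto n \<equiv> (\<Union>i\<in>{1..n}. words i)"

text \<open>The condition on \<open>\<Omega>\<close> in \<open>vert_dist\<close>, with reachability
  in place of paths. For equal vertices the empty family qualifies, in accordance with the distance
  0.\<close>

definition joins :: "nat \<Rightarrow> 'e list set \<Rightarrow> ('v \<times> 'e list) set \<Rightarrow> ('v \<times> 'e list) set \<Rightarrow> bool" where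
  "joins n \<Omega> v w \<longleftrightarrow> \<Omega> \<subseteq> words_upto n \<and> (v, w) \<in> reach n (cover n \<Omega>)"

lemma mem_cell: "f \<in> cell_edges S n e \<longleftrightarrow> f \<in> words n \<and> drop (n - length e) f = e"
  by (simp add: cell_edges_def edge_proj_def)

lemma cover_subset: "cover n \<Omega> \<subseteq> words n"
  by (auto simp: cover_def mem_cell)

lemma cover_mono: "\<Omega> \<subseteq> \<Omega>' \<Longrightarrow> cover n \<Omega> \<subseteq> cover n \<Omega>'"
  by (auto simp: cover_def)

lemma cover_same: "\<Omega> \<subseteq> words n \<Longrightarrow> cover n \<Omega> = \<Omega>"
  by (force simp: cover_def mem_cell length_words)

text \<open>Cells of level at most \<open>n\<close> contain all children of their edges of level
  \<open>n\<close>, so the passage to the next level replaces each covered edge by all its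
  children.\<close>

lemma cover_Suc:
  assumes "\<Omega> \<subseteq> words_upto n"
  shows "cover (Suc n) \<Omega> = lift (cover n \<Omega>)"
proof -
  have len: "length h \<le> n" if "h \<in> \<Omega>" for h using assms that by (auto simp: length_words)
  show ?thesis
  proof (intro set_eqI iffI)
    fix f assume "f \<in> cover (Suc n) \<Omega>"
    then obtain h where h: "h \<in> \<Omega>" "f \<in> words (Suc n)" "drop (Suc n - length h) f = h"
      by (auto simp: cover_def mem_cell)
    with len[OF h(1)] show "f \<in> lift (cover n \<Omega>)"
      by (auto simp: cover_def mem_cell lift_def words_Suc Suc_diff_le)
  next
    fix f assume "f \<in> lift (cover n \<Omega>)"
    then obtain a x h where h: "f = a # x" "a \<in> E" "h \<in> \<Omega>" "x \<in> words n" "drop (n - length h) x = h"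
      by (auto simp: cover_def mem_cell lift_def)
    with len[OF h(3)] have "f \<in> cell_edges S (Suc n) h"
      by (simp add: mem_cell Cons_words Suc_diff_le)
    with h(3) show "f \<in> cover (Suc n) \<Omega>" by (auto simp: cover_def)
  qed
qed

lemma reach_edge:
  assumes "e \<in> F"
  shows "(repl_lab S s e, repl_lab S t e) \<in> reach n F"
proof (cases "s = t")
  case False
  then have "ends (repl_graph S n) e = {repl_lab S s e, repl_lab S t e}"
    by (cases s; cases t) (auto simp: ends_repl UNIV_side)
  then show ?thesis using assms by (auto simp: edge_step_def)
qed auto

lemma connected_gen: "v \<in> verts (gen S) \<Longrightarrow> w \<in> verts (gen S) \<Longrightarrow> (v, w) \<in> (edge_step (gen S) E)\<^sup>*"
proof -
  assume "v \<in> verts (gen S)" "w \<in> verts (gen S)"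
  then have "paths (gen S) {v} {w} \<noteq> {}"
    using simple by (auto simp: simple_igs_def connected_multigraph_def)
  then obtain vs es where p: "is_path (gen S) vs es" "hd vs = v" "last vs = w"
    by (auto simp: paths_def)
  then have "set es \<subseteq> E" by (simp add: is_path_def)
  with path_reach[OF p(1)] p show ?thesis by (blast intro: reach_mono)
qed

text \<open>A cell is an image of the connected graph G_1: the map \<open>?p\<close> carries a path
  of the generator into the cell of \<open>e\<close>.\<close>

lemma reach_in_cell:
  assumes e: "e \<in> words n" and ab: "a \<in> E" "b \<in> E"
  shows "(repl_lab S s (a # e), repl_lab S t (b # e)) \<in> reach (Suc n) (lift {e})"
proof -
  let ?p = "\<lambda>v. vrel S n `` {(v, e)}"
  have "(lab S s a, lab S t b) \<in> (edge_step (gen S) E)\<^sup>*"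
    using ab by (intro connected_gen lab_verts)
  then have "(?p (lab S s a), ?p (lab S t b)) \<in> reach (Suc n) (lift {e})"
  proof (induction rule: rtrancl_induct)
    case (step v w)
    then obtain c where c: "c \<in> E" "ends (gen S) c = {v, w}" by (auto simp: edge_step_def)
    then obtain r u where "v = lab S r c" "w = lab S u c" using ends_gen_iff[OF c(1)] by blast
    moreover have "c # e \<in> lift {e}" using c by (simp add: lift_def)
    ultimately have "(?p v, ?p w) \<in> reach (Suc n) (lift {e})"
      using reach_edge[of "c # e" _ r u "Suc n"] e by (simp add: repl_lab_Cons length_words)
    with step.IH show ?case by (rule rtrancl_trans)
  qed auto
  then show ?thesis using e by (simp add: repl_lab_Cons length_words)
qed

lemma reach_lift_cell:
  assumes "e \<in> words n" "a \<in> E" "b \<in> E" "e \<in> F"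
  shows "(repl_lab S s (a # e), repl_lab S t (b # e)) \<in> reach (Suc n) (lift F)"
  using reach_in_cell[OF assms(1-3)] by (rule reach_mono) (use assms in \<open>auto simp: lift_def\<close>)

text \<open>Any index \<open>i\<close> will do: the children of \<open>e\<close> and
  \<open>f\<close> at the gluing vertices of index \<open>i\<close> meet, and each cell is connected
  in itself.\<close>

lemma reach_lift_touch:
  assumes ef: "e \<in> words (Suc n)" "f \<in> words (Suc n)" "e \<in> F" "f \<in> F"
    and ab: "a \<in> E" "b \<in> E" and eq: "repl_lab S s e = repl_lab S t f"
  shows "(repl_lab S s' (a # e), repl_lab S t' (b # f)) \<in> reach (Suc (Suc n)) (lift F)"
proof -
  obtain i where i: "i \<in> idx S" using idx_nonempty by auto
  obtain c r where c: "c \<in> E" "lab S r c = glue S s i" using glue_edge[OF i] by metis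
  obtain d u where d: "d \<in> E" "lab S u d = glue S t i" using glue_edge[OF i] by metis
  have "repl_lab S r (c # e) = repl_lab S u (d # f)"
    by (rule repl_lab_glued) (use ef c d i eq in auto)
  moreover have "(repl_lab S s' (a # e), repl_lab S r (c # e)) \<in> reach (Suc (Suc n)) (lift F)"
    using reach_lift_cell ef c ab by blast
  moreover have "(repl_lab S u (d # f), repl_lab S t' (b # f)) \<in> reach (Suc (Suc n)) (lift F)"
    using reach_lift_cell ef d ab by blast
  ultimately show ?thesis by (metis rtrancl_trans)
qed

text \<open>A vertex has no distinguished counterpart at the next level, where it is replaced by one
  vertex for each index. The connection is therefore transported through edges, and the ends
  \<open>s'\<close>, \<open>t'\<close> are free because cells are connected.\<close>

lemma reach_lift:
  assumes F: "F \<subseteq> words (Suc n)" and "e \<in> F" "f \<in> F" "a \<in> E" "b \<in> E"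
    and "(repl_lab S s e, repl_lab S t f) \<in> reach (Suc n) F"
  shows "(repl_lab S s' (a # e), repl_lab S t' (b # f)) \<in> reach (Suc (Suc n)) (lift F)"
proof -
  have "\<forall>f\<in>F. \<forall>t t'. repl_lab S t f = v \<longrightarrow>
      (repl_lab S s' (a # e), repl_lab S t' (b # f)) \<in> reach (Suc (Suc n)) (lift F)"
    if "(repl_lab S s e, v) \<in> reach (Suc n) F" for v
    using that
  proof (induction rule: rtrancl_induct)
    case base
    then show ?case
      using assms(2-5) F by (auto intro!: reach_lift_touch intro: sym)
  next
    case (step v w)
    then obtain h where h: "h \<in> F" "ends (repl_graph S (Suc n)) h = {v, w}"
      by (auto simp: edge_step_def)
    then obtain r u where r: "v = repl_lab S r h" "w = repl_lab S u h"
      unfolding ends_repl by (metis insertCI rangeE)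
    show ?case
    proof (intro ballI allI impI)
      fix f t t' assume f: "f \<in> F" "repl_lab S t f = w"
      have "(repl_lab S s' (a # e), repl_lab S u (b # h)) \<in> reach (Suc (Suc n)) (lift F)"
        using step.IH h(1) r(1) by blast
      moreover have "(repl_lab S u (b # h), repl_lab S t' (b # f)) \<in> reach (Suc (Suc n)) (lift F)"
        by (rule reach_lift_touch) (use h f r F assms in auto)
      ultimately show "(repl_lab S s' (a # e), repl_lab S t' (b # f)) \<in> reach (Suc (Suc n)) (lift F)"
        by (rule rtrancl_trans)
    qed
  qed
  with assms show ?thesis by blast
qed

section \<open>Families of cells that join two vertices\<close>

lemma joins_mono:
  assumes "joins n \<Omega> v w" "\<Omega> \<subseteq> \<Omega>'" "\<Omega>' \<subseteq> words_upto n"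
  shows "joins n \<Omega>' v w"
  using assms reach_mono[OF _ cover_mono[OF assms(2)]] by (auto simp: joins_def)

lemma joins_sym: "joins n \<Omega> v w \<Longrightarrow> joins n \<Omega> w v"
  by (auto simp: joins_def intro: sym_reach)

lemma joins_trans:
  assumes "joins n \<Omega> u v" "joins n \<Omega>' v w"
  shows "joins n (\<Omega> \<union> \<Omega>') u w"
proof -
  have "joins n (\<Omega> \<union> \<Omega>') u v" "joins n (\<Omega> \<union> \<Omega>') v w"
    by (rule joins_mono[OF assms(1)] joins_mono[OF assms(2)]; use assms in \<open>auto simp: joins_def\<close>)+
  then show ?thesis by (auto simp: joins_def)
qed

lemma joins_edge:
  assumes "e \<in> words n" "1 \<le> n"
  shows "joins n {e} (repl_lab S s e) (repl_lab S t e)"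
  unfolding joins_def using assms by (auto intro!: reach_edge simp: cover_same)

lemma joins_Suc:
  assumes "joins n \<Omega> (repl_lab S s e) (repl_lab S t f)" "e \<in> cover n \<Omega>" "f \<in> cover n \<Omega>"
    "a \<in> E" "b \<in> E" "1 \<le> n"
  shows "joins (Suc n) \<Omega> (repl_lab S s' (a # e)) (repl_lab S t' (b # f))"
proof -
  obtain m where m: "n = Suc m" using assms(6) by (cases n) auto
  have \<Omega>: "\<Omega> \<subseteq> words_upto n" using assms(1) by (simp add: joins_def)
  have "(repl_lab S s' (a # e), repl_lab S t' (b # f)) \<in> reach (Suc n) (lift (cover n \<Omega>))"
    unfolding m
    by (rule reach_lift[of _ _ _ _ _ _ s t]) (use assms m cover_subset[of n] in \<open>auto simp: joins_def\<close>)
  moreover have "\<Omega> \<subseteq> words_upto (Suc n)"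
    using \<Omega> by (rule order_trans) (intro UN_mono, auto)
  ultimately show ?thesis using cover_Suc[OF \<Omega>] by (simp add: joins_def)
qed

text \<open>A connection found at level \<open>n\<close> persists at all later levels with the same
  family, hence at the same cost. This makes the upper bounds on distances uniform in the
  level.\<close>

lemma joins_words:
  assumes "n \<le> m" "1 \<le> n" "\<Omega> \<subseteq> words n"
    and "e \<in> words m" "f \<in> words m" "drop (m - n) e \<in> \<Omega>" "drop (m - n) f \<in> \<Omega>"
    and "(repl_lab S s (drop (m - n) e), repl_lab S t (drop (m - n) f)) \<in> reach n \<Omega>"
  shows "joins m \<Omega> (repl_lab S s' e) (repl_lab S t' f)"
  using assms(1) assms(4-8)
proof (induction m arbitrary: e f s' t' rule: dec_induct)
  case base
  have "(repl_lab S s' e, repl_lab S s e) \<in> reach n \<Omega>" "(repl_lab S t f, repl_lab S t' f) \<in> reach n \<Omega>"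
    using base by (simp_all add: reach_edge)
  moreover have "(repl_lab S s e, repl_lab S t f) \<in> reach n \<Omega>" using base by simp
  ultimately have "(repl_lab S s' e, repl_lab S t' f) \<in> reach n \<Omega>" by (meson rtrancl_trans)
  moreover have "\<Omega> \<subseteq> words_upto n" using assms(2,3) by auto
  ultimately show ?case using assms(3) by (simp add: joins_def cover_same)
next
  case (step m)
  obtain a e' b f' where ab: "e = a # e'" "f = b # f'" "a \<in> E" "b \<in> E" "e' \<in> words m" "f' \<in> words m"
    using step.prems(1,2) by (auto simp: words_Suc)
  have d: "drop (Suc m - n) e = drop (m - n) e'" "drop (Suc m - n) f = drop (m - n) f'"
    using ab step.hyps by (auto simp: Suc_diff_le)
  have j: "joins m \<Omega> (repl_lab S s e') (repl_lab S t f')"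
    by (rule step.IH) (use ab step.prems d in auto)
  have "x \<in> cover m \<Omega>" if "x \<in> words m" "drop (m - n) x \<in> \<Omega>" for x
  proof -
    have "length (drop (m - n) x) = n" using that assms(3) length_words by blast
    with that show ?thesis unfolding cover_def mem_cell UN_iff by metis
  qed
  then show ?case
    unfolding ab by (intro joins_Suc[OF j]) (use ab step.prems d step.hyps assms(2) in auto)
qed

lemma joins_touch:
  assumes "n \<le> m" "1 \<le> n" "e \<in> words m" "f \<in> words m" "touch (drop (m - n) e) (drop (m - n) f)"
  shows "joins m {drop (m - n) e, drop (m - n) f} (repl_lab S s e) (repl_lab S t f)"
proof -
  from assms(5) obtain u v where "repl_lab S u (drop (m - n) e) = repl_lab S v (drop (m - n) f)"
    by (auto simp: touch_def)
  moreover have "drop (m - n) x \<in> words n" if "x \<in> words m" for x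
    using that assms(1) by (auto simp: repl_edges_def dest: in_set_dropD)
  ultimately show ?thesis
    using assms by (intro joins_words[of n m _ _ _ u v]) auto
qed

text \<open>Connectedness of G_1. The family keeps the infimum in \<open>vert_dist\<close> away from
  the empty set and also yields the diameter bound \<open>mass1\<close>.\<close>

lemma joins_all:
  assumes "1 \<le> m" "e \<in> words m" "f \<in> words m"
  shows "joins m (words 1) (repl_lab S s e) (repl_lab S t f)"
proof (rule joins_words[of 1 m _ _ _ Neg Neg])
  have d: "drop (m - 1) x \<in> words 1" if "x \<in> words m" for x
    using that assms(1) by (auto simp: repl_edges_def dest: in_set_dropD)
  then show "drop (m - 1) e \<in> words 1" "drop (m - 1) f \<in> words 1" using assms by auto
  then obtain a b where "drop (m - 1) e = [a]" "drop (m - 1) f = [b]" "a \<in> E" "b \<in> E"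
    by (auto simp: words_Suc words_0)
  \<comment> \<open>Level 1 is the cell of the empty word.\<close>
  moreover have "lift {[]} = words 1" by (auto simp: lift_def words_Suc words_0)
  ultimately show "(repl_lab S Neg (drop (m - 1) e), repl_lab S Neg (drop (m - 1) f)) \<in> reach 1 (words 1)"
    using reach_in_cell[of "[]" 0 a b Neg Neg] by (simp add: words_0)
qed (use assms in auto)

end

section \<open>Densities\<close>

locale laakso_density = laakso_igs S \<eta>\<^sub>V \<eta>\<^sub>E
  for S :: "('v, 'e, 'i) igs" and \<eta>\<^sub>V :: "'v \<Rightarrow> 'v" and \<eta>\<^sub>E :: "'e \<Rightarrow> 'e" +
  fixes \<rho> :: "'e \<Rightarrow> real"
  assumes density_range: "\<And>e. e \<in> E \<Longrightarrow> 0 < \<rho> e \<and> \<rho> e < 1"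
    and admissible: "admissible_density S \<rho>" and symmetric: "symmetric_density S \<eta>\<^sub>E \<rho>"
begin

abbreviation "w \<equiv> iter_density \<rho>"

text \<open>The common comparison constant: it bounds from below both the weight of a child relative
  to its parent and the relative weight of edges that meet.\<close>

definition "lo = Min (\<rho> ` E)"
definition "hi = Max (\<rho> ` E)"

lemma lo_le: "a \<in> E \<Longrightarrow> lo \<le> \<rho> a" and le_hi: "a \<in> E \<Longrightarrow> \<rho> a \<le> hi"
  by (simp_all add: lo_def hi_def finite_E)

lemma lo_hi: "0 < lo" "lo \<le> hi" "hi < 1"
proof -
  have "lo \<in> \<rho> ` E" "hi \<in> \<rho> ` E"
    unfolding lo_def hi_def using finite_E E_nonempty by (auto intro!: Min_in Max_in)
  then show "0 < lo" "hi < 1" "lo \<le> hi" using density_range lo_le by auto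
qed

lemma lo_lt_1: "lo < 1"
  using lo_hi by linarith

lemma w_pos: "e \<in> words n \<Longrightarrow> 0 < w e"
  by (induction e arbitrary: n) (auto simp: repl_edges_def density_range)

lemma w_le_hi: "e \<in> words n \<Longrightarrow> w e \<le> hi ^ n"
proof (induction n arbitrary: e)
  case (Suc n)
  then obtain a f where "e = a # f" "a \<in> E" "f \<in> words n" by (auto simp: words_Suc)
  then show ?case using Suc.IH[of f] w_pos[of f n] density_range[of a] le_hi[of a]
    by (auto intro!: mult_mono)
qed (simp add: words_0)

lemma w_le_1: "e \<in> words n \<Longrightarrow> w e \<le> 1"
  using w_le_hi[of e n] lo_hi power_le_one[of hi n] by linarith

lemma w_append: "w (u @ e) = w u * w e"
  by (induction u) auto

lemma w_suffix_ge: "u @ e \<in> words n \<Longrightarrow> w (u @ e) \<le> w e"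
proof -
  assume *: "u @ e \<in> words n"
  then have "u \<in> words (length u)" "e \<in> words (length e)" by (auto simp: repl_edges_def)
  then have "w u \<le> 1" "0 < w e" by (simp_all add: w_le_1 w_pos)
  then show ?thesis by (simp add: w_append)
qed

lemma w_Cons_ge: "a # e \<in> words n \<Longrightarrow> lo * w e \<le> w (a # e)"
  using lo_le[of a] w_pos[of e "n - 1"] by (auto simp: repl_edges_def)

text \<open>The factor \<open>lo\<close> is lost only once, at the level where the two words
  diverge. From then on the new letters lie at gluing vertices of the same index, so they coincide
  or are exchanged by \<open>\<eta>\<^sub>E\<close>, and the ratio of the weights does not
  change.\<close>

lemma w_comparable_aux:
  assumes "e \<in> words (Suc n)" "f \<in> words (Suc n)" "repl_lab S s e = repl_lab S t f"
  shows "lo * w e \<le> w f"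
  using assms
proof (induction n arbitrary: e f s t)
  case 0
  then obtain a b where "e = [a]" "f = [b]" "a \<in> E" "b \<in> E" by (auto simp: words_Suc words_0)
  then show ?case using density_range[of a] lo_le[of b] lo_hi
    by (simp add: mult_left_le order_trans[of "lo * \<rho> a" lo "\<rho> b"])
next
  case (Suc n)
  then obtain a b e' f' where ab: "e = a # e'" "f = b # f'" "a \<in> E" "b \<in> E"
    and ef: "e' \<in> words (Suc n)" "f' \<in> words (Suc n)" by (auto simp: words_Suc[of _ "Suc n"])
  from Suc.prems(3) show ?case unfolding ab(1,2)
  proof (rule repl_lab_eqE)
    show "a # e' \<in> words (Suc (Suc n))" "b # f' \<in> words (Suc (Suc n))"
      using ab Suc.prems by auto
  next
    assume "e' = f'"
    moreover have "lo * \<rho> a \<le> \<rho> b"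
      using density_range[OF ab(3)] lo_le[OF ab(4)] lo_hi
      by (simp add: mult_left_le order_trans[of "lo * \<rho> a" lo "\<rho> b"])
    ultimately show "lo * w (a # e') \<le> w (b # f')"
      using w_pos[OF ef(1)] by (simp add: mult.assoc[symmetric])
  next
    fix u v i m assume *: "i \<in> idx S" "lab S s a = glue S u i" "lab S t b = glue S v i"
      "repl_lab S u e' = repl_lab S v f'"
    have "\<rho> a = \<rho> b"
    proof (cases "u = v")
      case True
      then show ?thesis using glue_edge_unique[OF *(1) ab(3,4)] * by metis
    next
      case False
      then have "\<eta>\<^sub>E a = b" using glue_edge_swap[OF *(1) ab(3,4) *(2,3)] by simp
      then show ?thesis using symmetric ab(3) by (auto simp: symmetric_density_def)
    qed
    moreover have "lo * w e' \<le> w f'" using Suc.IH[OF ef *(4)] .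
    ultimately show "lo * w (a # e') \<le> w (b # f')"
      using density_range[OF ab(4)] by (simp add: mult.left_commute)
  qed
qed

lemma w_comparable: "touch e f \<Longrightarrow> e \<in> words (Suc n) \<Longrightarrow> f \<in> words (Suc n) \<Longrightarrow> lo * w e \<le> w f"
  using w_comparable_aux by (auto simp: touch_def)

section \<open>Cuts obtained from admissibility\<close>

lemma gen_cut:
  assumes B: "B \<subseteq> E" "sum \<rho> B < 1"
  shows "\<exists>u. (\<forall>i\<in>idx S. \<not> u (glue S Neg i) \<and> u (glue S Pos i)) \<and>
    (\<forall>a\<in>B. u (lab S Neg a) = u (lab S Pos a))"
proof -
  let ?R = "(edge_step (gen S) B)\<^sup>*"
  define u where "u v \<longleftrightarrow> \<not> (\<exists>i\<in>idx S. (glue S Neg i, v) \<in> ?R)" for v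
  have "(v, w) \<notin> ?R" if vw: "v = glue S Neg i" "w = glue S Pos j" "i \<in> idx S" "j \<in> idx S" for v w i j
  proof
    assume "(v, w) \<in> ?R"
    moreover have "ends (gen S) a \<subseteq> verts (gen S)" if "a \<in> B" for a
      using subsetD[OF B(1) that] by (auto simp: ends_gen lab_verts)
    ultimately obtain vs es where p: "is_path (gen S) vs es" "set es \<subseteq> B" "hd vs = v" "last vs = w"
      "distinct es"
      using reach_simple_path[of v w "gen S" B] B(1) vw glue_verts by auto
    then have "(vs, es) \<in> paths (gen S) (bdry S Neg) (bdry S Pos)"
      using vw by (auto simp: paths_def bdry_def)
    \<comment> \<open>The path uses each edge at most once, so its length is bounded by the sum over
      the set \<open>B\<close>.\<close>
    then have "1 \<le> (\<Sum>a\<leftarrow>es. \<rho> a)" using admissible by (auto simp: admissible_density_def)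
    also have "\<dots> = sum \<rho> (set es)" using p(5) by (simp add: sum_list_distinct_conv_sum_set)
    also have "\<dots> \<le> sum \<rho> B"
      using p(2) B(1) finite_subset[OF _ finite_E] density_range
      by (intro sum_mono2) (auto intro!: less_imp_le)
    finally show False using B by simp
  qed
  then have 1: "\<forall>i\<in>idx S. \<not> u (glue S Neg i) \<and> u (glue S Pos i)"
    by (auto simp: u_def)
  have "u (lab S Neg a) = u (lab S Pos a)" if "a \<in> B" for a
  proof -
    have "ends (gen S) a = {lab S Neg a, lab S Pos a}" using ends_gen B that by auto
    then have "(lab S Neg a, lab S Pos a) \<in> edge_step (gen S) B"
      "(lab S Pos a, lab S Neg a) \<in> edge_step (gen S) B"
      using that by (auto simp: edge_step_def insert_commute)
    then show ?thesis unfolding u_def by (meson rtrancl.rtrancl_into_rtrancl)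
  qed
  with 1 show ?thesis by blast
qed

text \<open>Otherwise \<open>gen_cut\<close> would apply to the set of all edges and contradict
  connectedness of G_1. The bound is the source of \<open>1 \<le> Q\<close>.\<close>

lemma sum_density_ge_1: "1 \<le> sum \<rho> E"
proof (rule ccontr)
  assume "\<not> 1 \<le> sum \<rho> E"
  then obtain u where u: "\<forall>i\<in>idx S. \<not> u (glue S Neg i) \<and> u (glue S Pos i)"
    "\<forall>a\<in>E. u (lab S Neg a) = u (lab S Pos a)" using gen_cut[of E] by force
  obtain i where i: "i \<in> idx S" using idx_nonempty by auto
  have "(glue S Neg i, glue S Pos i) \<in> (edge_step (gen S) E)\<^sup>*"
    using i by (intro connected_gen glue_verts)
  then have "u (glue S Pos i) = u (glue S Neg i)"
  proof (induction rule: rtrancl_induct)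
    case (step v w)
    then obtain a where "a \<in> E" "ends (gen S) a = {v, w}" by (auto simp: edge_step_def)
    then have "u v = u w" using u(2) ends_gen[of a] by (auto simp: doubleton_eq_iff)
    with step.IH show ?case by simp
  qed auto
  with u(1) i show False by auto
qed

text \<open>\<open>gen_cut\<close> for prescribed boundary colours, as the refinement inside a cell
  requires. If the two ends of the cell have the same colour, the whole cell is coloured constantly;
  otherwise the cut is complemented where necessary.\<close>

lemma gen_cut_values:
  fixes c :: "side \<Rightarrow> bool"
  assumes "c Neg \<noteq> c Pos \<Longrightarrow> B \<subseteq> E \<and> sum \<rho> B < 1"
  shows "\<exists>u. (\<forall>s. \<forall>i\<in>idx S. u (glue S s i) = c s) \<and>
    (if c Neg = c Pos then \<forall>v. u v = c Neg else \<forall>a\<in>B. u (lab S Neg a) = u (lab S Pos a))"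
proof (cases "c Neg = c Pos")
  case True
  then show ?thesis
    by (intro exI[of _ "\<lambda>_. c Neg"]) (auto, (metis side.exhaust)+)
next
  case False
  then have "B \<subseteq> E" "sum \<rho> B < 1" using assms by auto
  from gen_cut[OF this] obtain u where u: "\<forall>i\<in>idx S. \<not> u (glue S Neg i) \<and> u (glue S Pos i)"
    "\<forall>a\<in>B. u (lab S Neg a) = u (lab S Pos a)" by auto
  have "(u (glue S s i) \<noteq> c Neg) = c s" if "i \<in> idx S" for s i
    using u(1) that False by (cases s) auto
  with u(2) False show ?thesis by (intro exI[of _ "\<lambda>v. u v \<noteq> c Neg"]) auto
qed

text \<open>The \<open>\<Omega>\<close>-mass inside the cell of \<open>e\<close>, including
  \<open>e\<close> itself for empty \<open>u\<close>: extending a word at the front means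
  descending.\<close>

definition below :: "'e list set \<Rightarrow> 'e list \<Rightarrow> real" where
  "below \<Omega> e = (\<Sum>h\<in>{h \<in> \<Omega>. \<exists>u. h = u @ e}. w h)"

text \<open>Words below different children are different, so their masses add up within the mass of
  the parent.\<close>

lemma below_children:
  assumes "finite \<Omega>" "\<And>h. h \<in> \<Omega> \<Longrightarrow> 0 < w h" "B \<subseteq> E"
  shows "(\<Sum>a\<in>B. below \<Omega> (a # e)) \<le> below \<Omega> e"
proof -
  have "(\<Sum>a\<in>B. below \<Omega> (a # e)) = sum w (\<Union>a\<in>B. {h \<in> \<Omega>. \<exists>u. h = u @ a # e})"
    unfolding below_def using assms finite_subset[OF assms(3) finite_E]
    by (subst sum.UNION_disjoint) auto
  also have "\<dots> \<le> below \<Omega> e"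
    unfolding below_def using assms(1,2)
    by (intro sum_mono2) (auto intro: less_imp_le exI[of _ "_ @ [_]"])
  finally show ?thesis .
qed

lemma below_le: "finite \<Omega> \<Longrightarrow> (\<And>h. h \<in> \<Omega> \<Longrightarrow> 0 < w h) \<Longrightarrow> below \<Omega> e \<le> sum w \<Omega>"
  unfolding below_def by (intro sum_mono2) (auto intro: less_imp_le)

lemma below_ge: "finite \<Omega> \<Longrightarrow> (\<And>h. h \<in> \<Omega> \<Longrightarrow> 0 < w h) \<Longrightarrow> e \<in> \<Omega> \<Longrightarrow> w e \<le> below \<Omega> e"
  unfolding below_def by (rule member_le_sum) (auto intro: less_imp_le)

text \<open>A two-colouring of the vertices of level \<open>m\<close>, stored on edge ends; the
  first clause makes it depend on the vertex only. The mass bound on crossed edges is the budget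
  spent by the next refinement, and the exclusion of ancestors in \<open>\<Omega>\<close> is what
  finally keeps the cut away from \<open>cover m \<Omega>\<close>.\<close>

definition separates :: "nat \<Rightarrow> 'e list \<Rightarrow> 'e list set \<Rightarrow> nat \<Rightarrow> ('e list \<Rightarrow> side \<Rightarrow> bool) \<Rightarrow> bool" where
  "separates n g \<Omega> m U \<longleftrightarrow>
    (\<forall>e\<in>words m. \<forall>f\<in>words m. \<forall>s t. repl_lab S s e = repl_lab S t f \<longrightarrow> U e s = U f t) \<and>
    (\<forall>e\<in>words m. U e Neg \<noteq> U e Pos \<longrightarrow> below \<Omega> e < w e \<and> (\<forall>u h. e = u @ h \<longrightarrow> h \<notin> \<Omega>)) \<and>
    (\<forall>e\<in>words m. drop (m - n) e = g \<longrightarrow> (\<forall>s. \<not> U e s)) \<and>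
    (\<forall>e\<in>words m. \<not> touch (drop (m - n) e) g \<longrightarrow> (\<forall>s. U e s))"

text \<open>The cut is refined level by level: an edge \<open>e\<close> that is crossed by the cut has too little
  \<open>\<Omega>\<close>-mass below it for the children whose own \<open>\<Omega>\<close>-mass reaches their weight to connect the
  two sides of \<open>e\<close>, so the cut inside \<open>e\<close> can avoid these children.\<close>

lemma separates_exists:
  assumes nm: "n \<le> m" and n: "1 \<le> n" and g: "g \<in> words n"
    and \<Omega>: "finite \<Omega>" "\<And>h. h \<in> \<Omega> \<Longrightarrow> 0 < w h" and small: "sum w \<Omega> < lo * w g"
  shows "\<exists>U. separates n g \<Omega> m U"
  using nm
proof (induction m rule: dec_induct)
  case base
  obtain k where k: "n = Suc k" using n by (cases n) auto
  define U where "U e s \<longleftrightarrow> \<not> (\<exists>t. repl_lab S s e = repl_lab S t g)" for e s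
  have "below \<Omega> e < w e \<and> (\<forall>u h. e = u @ h \<longrightarrow> h \<notin> \<Omega>)" if e: "e \<in> words n" "U e Neg \<noteq> U e Pos" for e
  proof -
    \<comment> \<open>Only edges that meet \<open>g\<close> are crossed, and by \<open>small\<close>
      each of them outweighs the whole of \<open>\<Omega>\<close>.\<close>
    have "touch g e" using e by (auto simp: U_def touch_def intro: sym)
    then have "sum w \<Omega> < w e" using w_comparable[of g e k] e g k small by simp
    then have 1: "below \<Omega> e < w e" using below_le[OF \<Omega>, of e] by simp
    have "h \<notin> \<Omega>" if "e = u @ h" for u h
    proof
      assume h: "h \<in> \<Omega>"
      \<comment> \<open>An ancestor is at least as heavy as \<open>e\<close>, so it outweighs
        \<open>\<Omega>\<close> too and cannot belong to it.\<close>
      have "w e \<le> w h" using w_suffix_ge[of u h n] e that by simp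
      also have "\<dots> \<le> sum w \<Omega>" using h \<Omega> by (intro member_le_sum) (auto intro: less_imp_le)
      finally show False using \<open>sum w \<Omega> < w e\<close> by simp
    qed
    with 1 show ?thesis by blast
  qed
  then have "separates n g \<Omega> n U"
    unfolding separates_def by (auto simp: U_def touch_def)
  then show ?case by blast
next
  case (step m)
  then obtain U where sep: "separates n g \<Omega> m U" by blast
  have U: "\<And>e f s t. e \<in> words m \<Longrightarrow> f \<in> words m \<Longrightarrow> repl_lab S s e = repl_lab S t f \<Longrightarrow> U e s = U f t"
    "\<And>e. e \<in> words m \<Longrightarrow> U e Neg \<noteq> U e Pos \<Longrightarrow> below \<Omega> e < w e"
    "\<And>e u h. e \<in> words m \<Longrightarrow> U e Neg \<noteq> U e Pos \<Longrightarrow> e = u @ h \<Longrightarrow> h \<notin> \<Omega>"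
    "\<And>e s. e \<in> words m \<Longrightarrow> drop (m - n) e = g \<Longrightarrow> \<not> U e s"
    "\<And>e s. e \<in> words m \<Longrightarrow> \<not> touch (drop (m - n) e) g \<Longrightarrow> U e s"
    using sep unfolding separates_def by blast+
  define B where "B e = {a \<in> E. w (a # e) \<le> below \<Omega> (a # e)}" for e
  define good where "good e u \<longleftrightarrow> (\<forall>s. \<forall>i\<in>idx S. u (glue S s i) = U e s) \<and>
    (if U e Neg = U e Pos then \<forall>v. u v = U e Neg else \<forall>a\<in>B e. u (lab S Neg a) = u (lab S Pos a))" for e u
  have "\<exists>u. good e u" if e: "e \<in> words m" for e
    unfolding good_def
  proof (rule gen_cut_values, intro conjI)
    assume cross: "U e Neg \<noteq> U e Pos"
    show "B e \<subseteq> E" by (auto simp: B_def)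
    have "sum \<rho> (B e) * w e = (\<Sum>a\<in>B e. w (a # e))" by (simp add: sum_distrib_right)
    also have "\<dots> \<le> (\<Sum>a\<in>B e. below \<Omega> (a # e))" by (intro sum_mono) (simp add: B_def)
    also have "\<dots> \<le> below \<Omega> e" by (intro below_children \<Omega>) (auto simp: B_def)
    also have "\<dots> < 1 * w e" using U(2)[OF e cross] by simp
    finally show "sum \<rho> (B e) < 1" using w_pos[OF e] by (simp add: mult_less_cancel_right)
  qed
  then obtain u where u: "\<And>e. e \<in> words m \<Longrightarrow> good e (u e)" by metis
  have u_glue: "u e (glue S s i) = U e s" if "e \<in> words m" "i \<in> idx S" for e s i
    using u[OF that(1)] that(2) by (simp add: good_def)
  have u_const: "u e v = U e s" if "e \<in> words m" "U e Neg = U e Pos" for e v s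
    using u[OF that(1)] that(2) by (cases s) (auto simp: good_def)
  have u_B: "u e (lab S Neg a) = u e (lab S Pos a)" if "e \<in> words m" "U e Neg \<noteq> U e Pos" "a \<in> B e" for e a
    using u[OF that(1)] that(2,3) by (auto simp: good_def)
  define U' where "U' e s = u (tl e) (lab S s (hd e))" for e s
  have "separates n g \<Omega> (Suc m) U'"
    unfolding separates_def
  proof (intro conjI ballI allI impI)
    fix e f s t assume ef: "e \<in> words (Suc m)" "f \<in> words (Suc m)" and eq: "repl_lab S s e = repl_lab S t f"
    then obtain a b e' f' where ab: "e = a # e'" "f = b # f'" "e' \<in> words m" "f' \<in> words m"
      by (auto simp: words_Suc)
    show "U' e s = U' f t" using eq unfolding ab(1,2)
    proof (rule repl_lab_eqE[where n = m])
      show "a # e' \<in> words (Suc m)" "b # f' \<in> words (Suc m)" using ef ab by auto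
    next
      assume "e' = f'" "lab S s a = lab S t b"
      then show "U' (a # e') s = U' (b # f') t" by (simp add: U'_def)
    next
      fix r q i assume *: "i \<in> idx S" "lab S s a = glue S r i" "lab S t b = glue S q i"
        "repl_lab S r e' = repl_lab S q f'"
      then show "U' (a # e') s = U' (b # f') t"
        using U(1)[OF ab(3,4) *(4)] ab(3,4) by (simp add: U'_def u_glue)
    qed
  next
    fix e assume e: "e \<in> words (Suc m)" and cross: "U' e Neg \<noteq> U' e Pos"
    then obtain a e' where ab: "e = a # e'" "e' \<in> words m" "a \<in> E" by (auto simp: words_Suc)
    have cross': "U e' Neg \<noteq> U e' Pos"
      using cross u_const[OF ab(2)] by (auto simp: U'_def ab)
    then have "a \<notin> B e'" using u_B[OF ab(2)] cross by (auto simp: U'_def ab)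
    then show b: "below \<Omega> e < w e" using ab by (auto simp: B_def)
    fix v h assume vh: "e = v @ h"
    show "h \<notin> \<Omega>"
    \<comment> \<open>The word \<open>e\<close> itself is excluded by its mass bound, the proper
      ancestors by the invariant for the parent, which is crossed as well.\<close>
    proof (cases v)
      case Nil
      then show ?thesis using b below_ge[OF \<Omega>, of e] vh by auto
    next
      case (Cons c v')
      then show ?thesis using U(3)[OF ab(2) cross', of v' h] vh ab by auto
    qed
  next
    fix e s assume e: "e \<in> words (Suc m)" and d: "drop (Suc m - n) e = g"
    then obtain a e' where ab: "e = a # e'" "e' \<in> words m" by (auto simp: words_Suc)
    have "\<not> U e' s" for s using U(4)[OF ab(2)] d ab step.hyps by (auto simp: Suc_diff_le)
    then show "\<not> U' e s" using u_const[OF ab(2), of _ s] by (auto simp: U'_def ab)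
  next
    fix e s assume e: "e \<in> words (Suc m)" and d: "\<not> touch (drop (Suc m - n) e) g"
    then obtain a e' where ab: "e = a # e'" "e' \<in> words m" by (auto simp: words_Suc)
    have "U e' s" for s using U(5)[OF ab(2)] d ab step.hyps by (auto simp: Suc_diff_le)
    then show "U' e s" using u_const[OF ab(2), of _ s] by (auto simp: U'_def ab)
  qed
  then show ?case by blast
qed

text \<open>Every edge of the cover has an ancestor in \<open>\<Omega>\<close>, or lies in
  \<open>\<Omega>\<close> itself, and is thus not crossed. So the colour of the start is kept along
  the whole connection, while \<open>f\<close> has the other colour.\<close>

lemma joins_lower_bound:
  assumes "n \<le> m" "1 \<le> n" "e \<in> words m" "f \<in> words m" "\<not> touch (drop (m - n) e) (drop (m - n) f)"
    and j: "joins m \<Omega> (repl_lab S s e) (repl_lab S t f)"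
  shows "lo * w (drop (m - n) e) \<le> sum w \<Omega>"
proof (rule ccontr)
  assume "\<not> lo * w (drop (m - n) e) \<le> sum w \<Omega>"
  then have small: "sum w \<Omega> < lo * w (drop (m - n) e)" by simp
  have \<Omega>: "\<Omega> \<subseteq> words_upto m" using j by (simp add: joins_def)
  then have "finite \<Omega>" by (rule finite_subset) (simp add: finite_words)
  moreover have "0 < w h" if "h \<in> \<Omega>" for h using \<Omega> that w_pos by blast
  moreover have "drop (m - n) e \<in> words n"
    using assms(1,3) by (auto simp: repl_edges_def dest: in_set_dropD)
  ultimately obtain U where "separates n (drop (m - n) e) \<Omega> m U"
    using separates_exists[OF assms(1,2) _ _ _ small] by blast
  note sep = this[unfolded separates_def]
  have U: "\<And>e f s t. e \<in> words m \<Longrightarrow> f \<in> words m \<Longrightarrow> repl_lab S s e = repl_lab S t f \<Longrightarrow> U e s = U f t"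
    "\<And>e u h. e \<in> words m \<Longrightarrow> U e Neg \<noteq> U e Pos \<Longrightarrow> e = u @ h \<Longrightarrow> h \<notin> \<Omega>"
    "\<not> U e s"
    using sep assms(3) by blast+
  have "\<not> touch (drop (m - n) f) (drop (m - n) e)" using assms(5) touch_sym by blast
  then have U4: "U f t" using sep assms(4) by blast
  have "\<forall>h\<in>words m. \<forall>r. repl_lab S r h = v \<longrightarrow> \<not> U h r"
    if "(repl_lab S s e, v) \<in> reach m (cover m \<Omega>)" for v
    using that
  proof (induction rule: rtrancl_induct)
    case base
    then show ?case using U(1)[OF _ assms(3)] U(3) by metis
  next
    case (step v v')
    then obtain h where h: "h \<in> cover m \<Omega>" "ends (repl_graph S m) h = {v, v'}"
      by (auto simp: edge_step_def)
    then obtain r q where r: "v = repl_lab S r h" "v' = repl_lab S q h"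
      unfolding ends_repl by (metis insertCI rangeE)
    have hw: "h \<in> words m" using h(1) cover_subset by blast
    obtain k where k: "k \<in> \<Omega>" "drop (m - length k) h = k"
      using h(1) by (auto simp: cover_def mem_cell)
    then have "h = take (m - length k) h @ k" by (metis append_take_drop_id)
    then have "U h Neg = U h Pos" using U(2)[OF hw] k(1) by blast
    moreover have "\<not> U h r" using step.IH hw r by blast
    ultimately have "\<not> U h q" by (cases r; cases q) auto
    then show ?case using U(1)[OF _ hw] r by metis
  qed
  then have "\<not> U f t" using j assms(4) by (auto simp: joins_def)
  with U4 show False by simp
qed

end

section \<open>The metric\<close>

context laakso_igs
begin

lemma seq_words: "x \<in> seq_space S \<Longrightarrow> x n \<in> words n"
  by (simp add: seq_space_def)

lemma seq_Suc:
  assumes "x \<in> seq_space S"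
  obtains a where "a \<in> E" "x (Suc n) = a # x n"
proof -
  have "tl (x (Suc n)) = x n" using assms by (simp add: seq_space_def)
  moreover obtain a f where "x (Suc n) = a # f" "a \<in> E"
    using seq_words[OF assms, of "Suc n"] by (auto simp: words_Suc)
  ultimately show ?thesis using that by simp
qed

lemma seq_drop: "x \<in> seq_space S \<Longrightarrow> n \<le> m \<Longrightarrow> drop (m - n) (x m) = x n"
proof (induction m)
  case (Suc m)
  obtain a where "x (Suc m) = a # x m" using seq_Suc[OF Suc.prems(1)] .
  then show ?case using Suc by (cases "n = Suc m") (auto simp: Suc_diff_le)
qed simp

lemma mem_seq_rel:
  "(x, y) \<in> seq_rel S \<longleftrightarrow> x \<in> seq_space S \<and> y \<in> seq_space S \<and> (\<forall>n. touch (x (Suc n)) (y (Suc n)))"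
proof -
  have "(\<forall>n\<ge>1. P n) \<longleftrightarrow> (\<forall>n. P (Suc n))" for P
    by (metis One_nat_def Suc_le_D Suc_le_mono le0)
  then show ?thesis
    unfolding seq_rel_def touch_iff_ends[symmetric] by simp
qed

text \<open>If two words touch a third one at different ends, then by non-degeneracy no child of the
  third one touches children of both.\<close>

lemma touch_trans_children:
  assumes "touch (a # e) (b # f)" "touch (b # f) (c # g)"
    and w: "a # e \<in> words (Suc (Suc n))" "b # f \<in> words (Suc (Suc n))" "c # g \<in> words (Suc (Suc n))"
  shows "touch e g"
proof (rule ccontr)
  assume no: "\<not> touch e g"
  have ne: "e \<noteq> f" "f \<noteq> g"
    using no touch_Cons[OF assms(1) w(1,2)] touch_Cons[OF assms(2) w(2,3)] by auto
  from assms(1) obtain s t where st: "repl_lab S s (a # e) = repl_lab S t (b # f)"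
    by (auto simp: touch_def)
  obtain u v i where 1: "i \<in> idx S" "lab S t b = glue S v i" "repl_lab S u e = repl_lab S v f"
    using st w(1,2) by (rule repl_lab_eqE) (use ne in auto)
  from assms(2) obtain s' t' where st': "repl_lab S s' (b # f) = repl_lab S t' (c # g)"
    by (auto simp: touch_def)
  obtain u' v' j where 2: "j \<in> idx S" "lab S s' b = glue S u' j" "repl_lab S u' f = repl_lab S v' g"
    using st' w(2,3) by (rule repl_lab_eqE) (use ne in auto)
  \<comment> \<open>With equal sides, \<open>e\<close> and \<open>g\<close> would both contain the
    same end of \<open>f\<close>.\<close>
  have vu: "v \<noteq> u'" using 1(3) 2(3) no by (auto simp: touch_def)
  have bE: "b \<in> E" using w(2) by (simp add: Cons_words)
  have "t \<noteq> s'" using 1 2 vu glue_inj(1)[of i j v u'] by auto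
  then have ends_b: "ends (gen S) b = {glue S v i, glue S u' j}"
    using ends_gen[OF bE] 1(2) 2(2) by (cases t; cases s') auto
  \<comment> \<open>Thus the letter \<open>b\<close> joins I_- to I_+, the configuration that
    non-degeneracy forbids.\<close>
  have "\<exists>p\<in>bdry S Neg. \<exists>q\<in>bdry S Pos. ends (gen S) b = {p, q}"
  proof (cases v)
    case Neg
    with vu have "u' = Pos" by (cases u') auto
    with Neg show ?thesis using ends_b 1(1) 2(1) by (auto simp: bdry_def)
  next
    case Pos
    with vu have "u' = Neg" by (cases u') auto
    with Pos show ?thesis using ends_b 1(1) 2(1) unfolding bdry_def by (auto simp: insert_commute)
  qed
  then show False using nondegenerate bE by (auto simp: nondegenerate_igs_def)
qed

lemma equiv_seq_rel: "equiv (seq_space S) (seq_rel S)"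
proof (rule equivI)
  show "seq_rel S \<subseteq> seq_space S \<times> seq_space S" by (auto simp: mem_seq_rel)
  show "refl_on (seq_space S) (seq_rel S)" by (auto simp: refl_on_def mem_seq_rel touch_refl)
  show "sym (seq_rel S)" by (auto simp: sym_def mem_seq_rel intro: touch_sym)
  show "trans (seq_rel S)"
  proof (rule transI)
    fix x y z assume xy: "(x, y) \<in> seq_rel S" and yz: "(y, z) \<in> seq_rel S"
    then have sp: "x \<in> seq_space S" "y \<in> seq_space S" "z \<in> seq_space S" by (auto simp: mem_seq_rel)
    \<comment> \<open>Meeting one level deeper is used here: the conclusion of
      \<open>touch_trans_children\<close> concerns the parents.\<close>
    have "touch (x (Suc n)) (z (Suc n))" for n
    proof -
      obtain a where a: "x (Suc (Suc n)) = a # x (Suc n)" using seq_Suc[OF sp(1)] .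
      obtain b where b: "y (Suc (Suc n)) = b # y (Suc n)" using seq_Suc[OF sp(2)] .
      obtain c where c: "z (Suc (Suc n)) = c # z (Suc n)" using seq_Suc[OF sp(3)] .
      have "touch (a # x (Suc n)) (b # y (Suc n))" "touch (b # y (Suc n)) (c # z (Suc n))"
        using xy yz by (simp_all add: mem_seq_rel flip: a b c)
      then show ?thesis
        by (rule touch_trans_children[where n = n]) (use sp seq_words a b c in metis)+
    qed
    then show "(x, z) \<in> seq_rel S" using sp by (simp add: mem_seq_rel)
  qed
qed

abbreviation cls :: "(nat \<Rightarrow> 'e list) \<Rightarrow> (nat \<Rightarrow> 'e list) set" where
  "cls x \<equiv> seq_rel S `` {x}"

lemma limit_spaceE:
  assumes "p \<in> limit_space S"
  obtains x where "x \<in> seq_space S" "p = cls x"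
  using assms unfolding limit_space_def by (rule quotientE)

lemma cls_in_limit_space: "x \<in> seq_space S \<Longrightarrow> cls x \<in> limit_space S"
  unfolding limit_space_def by (rule quotientI)

lemma cls_eq_iff: "x \<in> seq_space S \<Longrightarrow> y \<in> seq_space S \<Longrightarrow> cls x = cls y \<longleftrightarrow> (x, y) \<in> seq_rel S"
  by (rule eq_equiv_class_iff[OF equiv_seq_rel])

text \<open>For distinct points this is the last level at which the sequences meet, and 0 if their
  edges of level 1 are already disjoint. No density occurs in it, so two metrics can share
  it.\<close>

definition sep :: "(nat \<Rightarrow> 'e list) \<Rightarrow> (nat \<Rightarrow> 'e list) \<Rightarrow> nat" where
  "sep x y = (LEAST k. \<not> touch (x (Suc k)) (y (Suc k)))"

lemma sep:
  assumes "x \<in> seq_space S" "y \<in> seq_space S" "cls x \<noteq> cls y"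
  shows "\<not> touch (x (Suc (sep x y))) (y (Suc (sep x y)))" "touch (x (sep x y)) (y (sep x y)) \<or> sep x y = 0"
proof -
  have "\<exists>k. \<not> touch (x (Suc k)) (y (Suc k))" using assms by (simp add: cls_eq_iff mem_seq_rel)
  then show "\<not> touch (x (Suc (sep x y))) (y (Suc (sep x y)))"
    unfolding sep_def by (rule LeastI_ex)
  show "touch (x (sep x y)) (y (sep x y)) \<or> sep x y = 0"
  proof (cases "sep x y")
    case (Suc k)
    then show ?thesis using not_less_Least[of k "\<lambda>k. \<not> touch (x (Suc k)) (y (Suc k))"]
      by (simp add: sep_def)
  qed simp
qed

end

context laakso_density
begin

section \<open>Distances at a finite level\<close>

lemma joins_finite: "joins n \<Omega> u v \<Longrightarrow> finite \<Omega>"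
  unfolding joins_def by (auto intro: finite_subset simp: finite_words)

lemma joins_w_pos: "joins n \<Omega> u v \<Longrightarrow> h \<in> \<Omega> \<Longrightarrow> 0 < w h"
  unfolding joins_def using w_pos by blast

lemma joins_sum_nonneg: "joins n \<Omega> u v \<Longrightarrow> 0 \<le> sum w \<Omega>"
  using joins_w_pos by (intro sum_nonneg) (auto intro: less_imp_le)

lemma joins_sum_Un:
  assumes "joins n \<Omega> u v" "joins n' \<Omega>' u' v'"
  shows "sum w (\<Omega> \<union> \<Omega>') \<le> sum w \<Omega> + sum w \<Omega>'"
proof -
  have "0 \<le> sum w (\<Omega> \<inter> \<Omega>')"
    using joins_w_pos[OF assms(1)] by (intro sum_nonneg) (auto intro: less_imp_le)
  then show ?thesis
    using sum.union_inter[OF joins_finite[OF assms(1)] joins_finite[OF assms(2)], of w] by linarith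
qed

lemma vert_dist_eq:
  "u \<noteq> v \<Longrightarrow> vert_dist S \<rho> n u v = Inf {sum w \<Omega> | \<Omega>. joins n \<Omega> u v}"
  by (simp add: vert_dist_def paths_edge_subgraph_iff joins_def cover_def)

lemma vert_dist_le:
  assumes "joins n \<Omega> u v"
  shows "vert_dist S \<rho> n u v \<le> sum w \<Omega>"
proof (cases "u = v")
  case True
  then show ?thesis using joins_sum_nonneg[OF assms] by (simp add: vert_dist_def)
next
  case False
  have "bdd_below {sum w \<Omega> | \<Omega>. joins n \<Omega> u v}"
    using joins_sum_nonneg by (intro bdd_belowI[of _ 0]) auto
  then show ?thesis unfolding vert_dist_eq[OF False] using assms by (intro cInf_lower) auto
qed

text \<open>The family \<open>\<Omega>\<^sub>0\<close> only witnesses that the infimum is taken over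
  a non-empty set.\<close>

lemma vert_dist_approx:
  assumes "joins n \<Omega>\<^sub>0 u v" "0 < \<epsilon>"
  shows "\<exists>\<Omega>. joins n \<Omega> u v \<and> sum w \<Omega> < vert_dist S \<rho> n u v + \<epsilon>"
proof (cases "u = v")
  case True
  then show ?thesis using assms by (intro exI[of _ "{}"]) (simp add: vert_dist_def joins_def)
next
  case False
  let ?X = "{sum w \<Omega> | \<Omega>. joins n \<Omega> u v}"
  have ne: "?X \<noteq> {}" using assms(1) by auto
  have lt: "Inf ?X < vert_dist S \<rho> n u v + \<epsilon>"
    using assms(2) vert_dist_eq[OF False, of n] by linarith
  from cInf_lessD[OF ne lt] show ?thesis by auto
qed

lemma edge_dist_eq:
  "edge_dist S \<rho> n e f = Min ((\<lambda>(s, t). vert_dist S \<rho> n (repl_lab S s e) (repl_lab S t f)) ` UNIV)"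
  unfolding edge_dist_def ends_repl by (rule arg_cong[of _ _ Min]) auto

lemma finite_side2: "finite (UNIV :: (side \<times> side) set)"
  using finite_side by (simp add: finite_Prod_UNIV)

lemma edge_dist_le:
  assumes "joins n \<Omega> (repl_lab S s e) (repl_lab S t f)"
  shows "edge_dist S \<rho> n e f \<le> sum w \<Omega>"
proof -
  have "edge_dist S \<rho> n e f \<le> vert_dist S \<rho> n (repl_lab S s e) (repl_lab S t f)"
    unfolding edge_dist_eq using finite_side2
    by (intro Min_le) (auto intro!: image_eqI[of _ _ "(s, t)"])
  also have "\<dots> \<le> sum w \<Omega>" by (rule vert_dist_le[OF assms])
  finally show ?thesis .
qed

lemma edge_dist_approx:
  assumes "1 \<le> n" "e \<in> words n" "f \<in> words n" "0 < \<epsilon>"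
  obtains \<Omega> s t where "joins n \<Omega> (repl_lab S s e) (repl_lab S t f)"
    "sum w \<Omega> < edge_dist S \<rho> n e f + \<epsilon>"
proof -
  have "edge_dist S \<rho> n e f \<in> (\<lambda>(s, t). vert_dist S \<rho> n (repl_lab S s e) (repl_lab S t f)) ` UNIV"
    unfolding edge_dist_eq using finite_side2 by (intro Min_in) auto
  then obtain s t where "edge_dist S \<rho> n e f = vert_dist S \<rho> n (repl_lab S s e) (repl_lab S t f)"
    by auto
  then show ?thesis
    using vert_dist_approx[OF joins_all[OF assms(1-3)] assms(4)] that by metis
qed

lemma edge_dist_nonneg:
  assumes "1 \<le> n" "e \<in> words n" "f \<in> words n"
  shows "0 \<le> edge_dist S \<rho> n e f"
proof (rule field_le_epsilon)
  fix \<epsilon> :: real assume "0 < \<epsilon>"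
  then obtain \<Omega> s t where "joins n \<Omega> (repl_lab S s e) (repl_lab S t f)"
    "sum w \<Omega> < edge_dist S \<rho> n e f + \<epsilon>" using edge_dist_approx[OF assms] by blast
  then show "0 \<le> edge_dist S \<rho> n e f + \<epsilon>" using joins_sum_nonneg by fastforce
qed

lemma edge_dist_touch:
  assumes "touch e f"
  shows "edge_dist S \<rho> n e f \<le> 0"
proof -
  from assms obtain s t where "repl_lab S s e = repl_lab S t f" by (auto simp: touch_def)
  then have "joins n {} (repl_lab S s e) (repl_lab S t f)" by (simp add: joins_def)
  from edge_dist_le[OF this] show ?thesis by simp
qed

lemma edge_dist_commute_le:
  assumes "1 \<le> n" "e \<in> words n" "f \<in> words n"
  shows "edge_dist S \<rho> n e f \<le> edge_dist S \<rho> n f e"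
proof (rule field_le_epsilon)
  fix \<epsilon> :: real assume "0 < \<epsilon>"
  then obtain \<Omega> s t where "joins n \<Omega> (repl_lab S s f) (repl_lab S t e)"
    "sum w \<Omega> < edge_dist S \<rho> n f e + \<epsilon>" using edge_dist_approx assms by blast
  then show "edge_dist S \<rho> n e f \<le> edge_dist S \<rho> n f e + \<epsilon>"
    using edge_dist_le[OF joins_sym] by fastforce
qed

text \<open>The two connections may use different ends of \<open>f\<close>; the term
  \<open>w f\<close> pays for crossing it and disappears in the limit.\<close>

lemma edge_dist_triangle:
  assumes "1 \<le> n" "e \<in> words n" "f \<in> words n" "g \<in> words n"
  shows "edge_dist S \<rho> n e g \<le> edge_dist S \<rho> n e f + edge_dist S \<rho> n f g + w f"
proof (rule field_le_epsilon)
  fix \<epsilon> :: real assume "0 < \<epsilon>"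
  then have \<epsilon>: "0 < \<epsilon> / 2" by simp
  obtain \<Omega> s t where 1: "joins n \<Omega> (repl_lab S s e) (repl_lab S t f)"
    "sum w \<Omega> < edge_dist S \<rho> n e f + \<epsilon> / 2" using edge_dist_approx[OF assms(1-3) \<epsilon>] .
  obtain \<Omega>' u v where 2: "joins n \<Omega>' (repl_lab S u f) (repl_lab S v g)"
    "sum w \<Omega>' < edge_dist S \<rho> n f g + \<epsilon> / 2" using edge_dist_approx[OF assms(1,3,4) \<epsilon>] .
  have 3: "joins n {f} (repl_lab S t f) (repl_lab S u f)" by (rule joins_edge[OF assms(3,1)])
  have 4: "joins n (\<Omega> \<union> {f}) (repl_lab S s e) (repl_lab S u f)" by (rule joins_trans[OF 1(1) 3])
  have "edge_dist S \<rho> n e g \<le> sum w (\<Omega> \<union> {f} \<union> \<Omega>')" by (rule edge_dist_le[OF joins_trans[OF 4 2(1)]])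
  also have "\<dots> \<le> sum w (\<Omega> \<union> {f}) + sum w \<Omega>'" by (rule joins_sum_Un[OF 4 2(1)])
  also have "sum w (\<Omega> \<union> {f}) \<le> sum w \<Omega> + sum w {f}" by (rule joins_sum_Un[OF 1(1) 3])
  finally show "edge_dist S \<rho> n e g \<le> edge_dist S \<rho> n e f + edge_dist S \<rho> n f g + w f + \<epsilon>"
    using 1(2) 2(2) by simp
qed

text \<open>A connection reaches \<open>e\<close> and \<open>f\<close> at some end without having to
  cover them. Adding both edges to the family makes arbitrary children reachable, and the resulting
  errors are summable over the levels.\<close>

lemma edge_dist_Suc:
  assumes "1 \<le> n" "e \<in> words n" "f \<in> words n" "a \<in> E" "b \<in> E"
  shows "edge_dist S \<rho> (Suc n) (a # e) (b # f) \<le> edge_dist S \<rho> n e f + w e + w f"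
proof (rule field_le_epsilon)
  fix \<epsilon> :: real assume "0 < \<epsilon>"
  then obtain \<Omega> s t where 1: "joins n \<Omega> (repl_lab S s e) (repl_lab S t f)"
    "sum w \<Omega> < edge_dist S \<rho> n e f + \<epsilon>" using edge_dist_approx assms by blast
  have e: "joins n {e} (repl_lab S s e) (repl_lab S s e)"
    and f: "joins n {f} (repl_lab S t f) (repl_lab S t f)"
    using assms by (auto intro!: joins_edge)
  let ?\<Omega> = "{e} \<union> \<Omega> \<union> {f}"
  have 2: "joins n ({e} \<union> \<Omega>) (repl_lab S s e) (repl_lab S t f)" by (rule joins_trans[OF e 1(1)])
  have 3: "joins n ?\<Omega> (repl_lab S s e) (repl_lab S t f)" by (rule joins_trans[OF 2 f])
  have "e \<in> cover n ?\<Omega>" "f \<in> cover n ?\<Omega>"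
    using assms by (auto simp: cover_def mem_cell length_words)
  then have "joins (Suc n) ?\<Omega> (repl_lab S s (a # e)) (repl_lab S t (b # f))"
    by (intro joins_Suc[OF 3]) (use assms in auto)
  then have "edge_dist S \<rho> (Suc n) (a # e) (b # f) \<le> sum w ?\<Omega>" by (rule edge_dist_le)
  also have "\<dots> \<le> sum w ({e} \<union> \<Omega>) + sum w {f}" by (rule joins_sum_Un[OF 2 f])
  also have "sum w ({e} \<union> \<Omega>) \<le> sum w {e} + sum w \<Omega>" by (rule joins_sum_Un[OF e 1(1)])
  finally show "edge_dist S \<rho> (Suc n) (a # e) (b # f) \<le> edge_dist S \<rho> n e f + w e + w f + \<epsilon>"
    using 1(2) by simp
qed

section \<open>Passage to the limit\<close>

abbreviation "edist x y n \<equiv> edge_dist S \<rho> n (x n) (y n)"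

definition ldist :: "(nat \<Rightarrow> 'e list) \<Rightarrow> (nat \<Rightarrow> 'e list) \<Rightarrow> real" where
  "ldist x y = lim (edist x y)"

lemma w_seq_tendsto_0:
  assumes "x \<in> seq_space S"
  shows "(\<lambda>n. w (x n)) \<longlonglongrightarrow> 0"
proof (rule tendsto_sandwich[of "\<lambda>_. 0" _ _ "\<lambda>n. hi ^ n"])
  show "(\<lambda>n. hi ^ n) \<longlonglongrightarrow> 0" using lo_hi by (intro LIMSEQ_realpow_zero) auto
qed (use w_pos[OF seq_words[OF assms]] w_le_hi[OF seq_words[OF assms]] in
    \<open>auto intro!: always_eventually less_imp_le\<close>)

lemma edist_tendsto:
  assumes x: "x \<in> seq_space S" and y: "y \<in> seq_space S"
  shows "edist x y \<longlonglongrightarrow> ldist x y"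
proof -
  \<comment> \<open>The added term is the tail of the geometric series that dominates all later
    errors, which makes \<open>b\<close> decreasing.\<close>
  define b where "b n = edist x y (Suc n) + 2 * hi ^ Suc n / (1 - hi)" for n
  have "decseq b"
  proof (rule decseq_SucI)
    fix n
    obtain a where a: "x (Suc (Suc n)) = a # x (Suc n)" "a \<in> E" using seq_Suc[OF x] by metis
    obtain c where c: "y (Suc (Suc n)) = c # y (Suc n)" "c \<in> E" using seq_Suc[OF y] by metis
    have "edist x y (Suc (Suc n)) \<le> edist x y (Suc n) + w (x (Suc n)) + w (y (Suc n))"
      unfolding a c by (rule edge_dist_Suc) (use seq_words x y a c in auto)
    also have "\<dots> \<le> edist x y (Suc n) + 2 * hi ^ Suc n"
      using w_le_hi[OF seq_words[OF x], of "Suc n"] w_le_hi[OF seq_words[OF y], of "Suc n"] by simp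
    finally have *: "edist x y (Suc (Suc n)) \<le> edist x y (Suc n) + 2 * hi ^ Suc n" .
    have "2 * hi ^ Suc n + 2 * hi ^ Suc (Suc n) / (1 - hi) = 2 * hi ^ Suc n / (1 - hi)"
      using lo_hi by (simp add: field_simps)
    with * show "b (Suc n) \<le> b n" by (simp add: b_def)
  qed
  moreover have "0 \<le> b n" for n
    using lo_hi edge_dist_nonneg[of "Suc n" "x (Suc n)" "y (Suc n)"] seq_words x y
    by (simp add: b_def)
  ultimately obtain L where "b \<longlonglongrightarrow> L" using decseq_convergent[of b 0] by metis
  moreover have "(\<lambda>n. 2 * hi ^ Suc n / (1 - hi)) \<longlonglongrightarrow> 0"
  proof -
    have "(\<lambda>n. hi ^ Suc n) \<longlonglongrightarrow> 0"
      using lo_hi by (intro LIMSEQ_Suc LIMSEQ_realpow_zero) auto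
    then have "(\<lambda>n. 2 * hi ^ Suc n / (1 - hi)) \<longlonglongrightarrow> 2 * 0 / (1 - hi)"
      using lo_hi by (intro tendsto_intros) auto
    then show ?thesis by simp
  qed
  ultimately have "(\<lambda>n. b n - 2 * hi ^ Suc n / (1 - hi)) \<longlonglongrightarrow> L - 0" by (rule tendsto_diff)
  then have "(\<lambda>n. edist x y (Suc n)) \<longlonglongrightarrow> L" by (simp add: b_def)
  then have "edist x y \<longlonglongrightarrow> L" by (rule LIMSEQ_imp_Suc)
  then show ?thesis by (simp add: ldist_def limI)
qed

lemma ldist_le:
  assumes "x \<in> seq_space S" "y \<in> seq_space S" "\<And>m. N \<le> m \<Longrightarrow> edist x y m \<le> c"
  shows "ldist x y \<le> c"
  using edist_tendsto[OF assms(1,2)] assms(3) by (intro LIMSEQ_le_const2) auto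

lemma ldist_ge:
  assumes "x \<in> seq_space S" "y \<in> seq_space S" "\<And>m. N \<le> m \<Longrightarrow> c \<le> edist x y m"
  shows "c \<le> ldist x y"
  using edist_tendsto[OF assms(1,2)] assms(3) by (intro LIMSEQ_le_const) auto

lemma ldist_nonneg: "x \<in> seq_space S \<Longrightarrow> y \<in> seq_space S \<Longrightarrow> 0 \<le> ldist x y"
  by (rule ldist_ge[of _ _ 1]) (auto intro!: edge_dist_nonneg seq_words)

lemma ldist_commute:
  assumes "x \<in> seq_space S" "y \<in> seq_space S"
  shows "ldist x y = ldist y x"
proof (rule antisym)
  have le: "ldist x y \<le> ldist y x" if "x \<in> seq_space S" "y \<in> seq_space S" for x y
    by (rule LIMSEQ_le[OF edist_tendsto[OF that] edist_tendsto[OF that(2,1)]])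
      (use that in \<open>auto intro!: exI[of _ 1] edge_dist_commute_le seq_words\<close>)
  from le[OF assms] le[OF assms(2,1)] show "ldist x y \<le> ldist y x" "ldist y x \<le> ldist x y" .
qed

lemma ldist_triangle:
  assumes "x \<in> seq_space S" "y \<in> seq_space S" "z \<in> seq_space S"
  shows "ldist x z \<le> ldist x y + ldist y z"
proof -
  have "(\<lambda>n. edist x y n + edist y z n + w (y n)) \<longlonglongrightarrow> ldist x y + ldist y z + 0"
    by (intro tendsto_add edist_tendsto w_seq_tendsto_0 assms)
  from LIMSEQ_le[OF edist_tendsto[OF assms(1,3)] this] show ?thesis
    using assms by (auto intro!: exI[of _ 1] edge_dist_triangle seq_words)
qed

lemma ldist_same_word:
  assumes "x \<in> seq_space S" "y \<in> seq_space S" "1 \<le> n" "x n = y n"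
  shows "ldist x y \<le> w (x n)"
proof (rule ldist_le[OF assms(1,2)])
  fix m assume "n \<le> m"
  have "joins m {drop (m - n) (x m), drop (m - n) (y m)} (repl_lab S Neg (x m)) (repl_lab S Neg (y m))"
    by (rule joins_touch) (use assms \<open>n \<le> m\<close> seq_words in \<open>auto simp: seq_drop touch_refl\<close>)
  from edge_dist_le[OF this] show "edist x y m \<le> w (x n)"
    using assms \<open>n \<le> m\<close> by (simp add: seq_drop)
qed

lemma ldist_touch:
  assumes "x \<in> seq_space S" "y \<in> seq_space S" "touch (x (Suc n)) (y (Suc n))"
  shows "ldist x y \<le> (1 + 1 / lo) * w (x (Suc n))"
proof (rule ldist_le[OF assms(1,2)])
  fix m assume m: "Suc n \<le> m"
  let ?n = "Suc n"
  have "joins m {drop (m - ?n) (x m), drop (m - ?n) (y m)} (repl_lab S Neg (x m)) (repl_lab S Neg (y m))"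
    by (rule joins_touch) (use assms m seq_words in \<open>auto simp: seq_drop\<close>)
  from edge_dist_le[OF this] have "edist x y m \<le> sum w {x ?n, y ?n}"
    using assms m by (simp add: seq_drop)
  also have "\<dots> \<le> w (x ?n) + w (y ?n)"
    using w_pos[OF seq_words[OF assms(1)], of ?n] by (cases "x ?n = y ?n") auto
  also have "w (y ?n) \<le> w (x ?n) / lo"
    using w_comparable[OF touch_sym[OF assms(3)], of n] seq_words[OF assms(1)] seq_words[OF assms(2)] lo_hi
    by (simp add: pos_le_divide_eq mult.commute)
  finally show "edist x y m \<le> (1 + 1 / lo) * w (x ?n)" by (simp add: distrib_right)
qed

definition "mass1 = sum w (words 1)"

lemma ldist_le_mass1:
  assumes "x \<in> seq_space S" "y \<in> seq_space S"
  shows "ldist x y \<le> mass1"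
  unfolding mass1_def
  by (rule ldist_le[OF assms, of 1], rule edge_dist_le[OF joins_all]) (simp_all add: seq_words assms)

lemma mass1_pos: "0 < mass1"
proof -
  obtain a where "a \<in> E" using E_nonempty by auto
  then have "[a] \<in> words 1" by (simp add: repl_edges_def)
  then have "words 1 \<noteq> {}" by blast
  then show ?thesis unfolding mass1_def using w_pos[of _ 1] by (intro sum_pos finite_words) auto
qed

lemma ldist_not_touch:
  assumes "x \<in> seq_space S" "y \<in> seq_space S" "\<not> touch (x (Suc n)) (y (Suc n))"
  shows "lo * w (x (Suc n)) \<le> ldist x y"
proof (rule ldist_ge[OF assms(1,2)])
  fix m assume m: "Suc n \<le> m"
  show "lo * w (x (Suc n)) \<le> edist x y m"
  proof (rule field_le_epsilon)
    fix \<epsilon> :: real assume "0 < \<epsilon>"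
    then obtain \<Omega> s t where 1: "joins m \<Omega> (repl_lab S s (x m)) (repl_lab S t (y m))"
      "sum w \<Omega> < edist x y m + \<epsilon>" using edge_dist_approx[of m "x m" "y m" \<epsilon>] m seq_words assms by auto
    have "lo * w (drop (m - Suc n) (x m)) \<le> sum w \<Omega>"
      by (rule joins_lower_bound[OF m _ _ _ _ 1(1)]) (use assms m seq_words in \<open>auto simp: seq_drop\<close>)
    with 1(2) show "lo * w (x (Suc n)) \<le> edist x y m + \<epsilon>"
      using assms m by (simp add: seq_drop)
  qed
qed

lemma ldist_eq_0_iff:
  assumes "x \<in> seq_space S" "y \<in> seq_space S"
  shows "ldist x y = 0 \<longleftrightarrow> (x, y) \<in> seq_rel S"
proof
  assume "(x, y) \<in> seq_rel S"
  then have "touch (x (Suc n)) (y (Suc n))" for n by (simp add: mem_seq_rel)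
  then have "ldist x y \<le> 0"
    by (intro ldist_le[OF assms, of 1] edge_dist_touch) (metis Suc_le_D One_nat_def)
  with ldist_nonneg[OF assms] show "ldist x y = 0" by simp
next
  assume 0: "ldist x y = 0"
  have "touch (x (Suc n)) (y (Suc n))" for n
  proof (rule ccontr)
    assume "\<not> touch (x (Suc n)) (y (Suc n))"
    from ldist_not_touch[OF assms this] show False
      using 0 lo_hi w_pos[OF seq_words[OF assms(1)], of "Suc n"] by (simp add: mult_le_0_iff)
  qed
  then show "(x, y) \<in> seq_rel S" using assms by (simp add: mem_seq_rel)
qed

lemma ldist_cong:
  assumes "(x, x') \<in> seq_rel S" "(y, y') \<in> seq_rel S"
  shows "ldist x y = ldist x' y'"
proof (rule antisym)
  have le: "ldist x y \<le> ldist x' y'" if "(x, x') \<in> seq_rel S" "(y', y) \<in> seq_rel S" for x y x' y'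
  proof -
    have sp: "x \<in> seq_space S" "y \<in> seq_space S" "x' \<in> seq_space S" "y' \<in> seq_space S"
      using that by (auto simp: mem_seq_rel)
    have "ldist x x' = 0" "ldist y' y = 0" using that sp by (simp_all add: ldist_eq_0_iff)
    then show ?thesis
      using ldist_triangle[OF sp(1,3,2)] ldist_triangle[OF sp(3,4,2)] by simp
  qed
  have s: "sym (seq_rel S)" using equiv_seq_rel by (simp add: equiv_def)
  show "ldist x y \<le> ldist x' y'" using le assms s by (meson symD)
  show "ldist x' y' \<le> ldist x y" using le assms s by (meson symD)
qed

section \<open>The metric on the quotient\<close>

lemma limit_dist_cls:
  assumes "x \<in> seq_space S" "y \<in> seq_space S"
  shows "limit_dist S \<rho> (cls x) (cls y) = ldist x y"
proof -
  have "(THE r. \<forall>x'\<in>cls x. \<forall>y'\<in>cls y. edist x' y' \<longlonglongrightarrow> r) = ldist x y"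
  proof (rule the_equality)
    show "\<forall>x'\<in>cls x. \<forall>y'\<in>cls y. edist x' y' \<longlonglongrightarrow> ldist x y"
    proof (intro ballI)
      fix x' y' assume "x' \<in> cls x" "y' \<in> cls y"
      then have r: "(x, x') \<in> seq_rel S" "(y, y') \<in> seq_rel S" by auto
      then have "edist x' y' \<longlonglongrightarrow> ldist x' y'" by (intro edist_tendsto) (auto simp: mem_seq_rel)
      then show "edist x' y' \<longlonglongrightarrow> ldist x y" using ldist_cong[OF r] by simp
    qed
  next
    fix r assume "\<forall>x'\<in>cls x. \<forall>y'\<in>cls y. edist x' y' \<longlonglongrightarrow> r"
    then have "edist x y \<longlonglongrightarrow> r" using assms by (auto simp: mem_seq_rel touch_refl)
    then show "r = ldist x y" using edist_tendsto[OF assms] LIMSEQ_unique by blast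
  qed
  then show ?thesis using assms by (simp add: limit_dist_def cls_in_limit_space)
qed

sublocale Metric_space "limit_space S" "limit_dist S \<rho>"
proof
  have off: "limit_dist S \<rho> p q = 0" if "p \<notin> limit_space S \<or> q \<notin> limit_space S" for p q
    using that by (auto simp: limit_dist_def)
  show "0 \<le> limit_dist S \<rho> p q" for p q
  proof (cases "p \<in> limit_space S \<and> q \<in> limit_space S")
    case True
    then have "p \<in> limit_space S" "q \<in> limit_space S" by auto
    then obtain x y where "x \<in> seq_space S" "p = cls x" "y \<in> seq_space S" "q = cls y"
      by (elim limit_spaceE)
    then show ?thesis by (simp only: limit_dist_cls ldist_nonneg)
  qed (simp add: off)
  show "limit_dist S \<rho> p q = limit_dist S \<rho> q p" for p q
  proof (cases "p \<in> limit_space S \<and> q \<in> limit_space S")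
    case True
    then have "p \<in> limit_space S" "q \<in> limit_space S" by auto
    then obtain x y where xy: "x \<in> seq_space S" "p = cls x" "y \<in> seq_space S" "q = cls y"
      by (elim limit_spaceE)
    from ldist_commute[OF xy(1,3)] xy show ?thesis by (simp only: limit_dist_cls)
  qed (auto simp: off)
  show "limit_dist S \<rho> p q = 0 \<longleftrightarrow> p = q" if pq: "p \<in> limit_space S" "q \<in> limit_space S" for p q
  proof -
    obtain x where "x \<in> seq_space S" "p = cls x" by (rule limit_spaceE[OF pq(1)])
    moreover obtain y where "y \<in> seq_space S" "q = cls y" by (rule limit_spaceE[OF pq(2)])
    ultimately show ?thesis by (simp add: limit_dist_cls ldist_eq_0_iff cls_eq_iff)
  qed
  show "limit_dist S \<rho> p r \<le> limit_dist S \<rho> p q + limit_dist S \<rho> q r"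
    if pq: "p \<in> limit_space S" "q \<in> limit_space S" "r \<in> limit_space S" for p q r
  proof -
    obtain x where "x \<in> seq_space S" "p = cls x" by (rule limit_spaceE[OF pq(1)])
    moreover obtain y where "y \<in> seq_space S" "q = cls y" by (rule limit_spaceE[OF pq(2)])
    moreover obtain z where "z \<in> seq_space S" "r = cls z" by (rule limit_spaceE[OF pq(3)])
    ultimately show ?thesis by (simp only: limit_dist_cls ldist_triangle)
  qed
qed

text \<open>In the lower bound one factor \<open>lo\<close> comes from the step to the next level,
  where the edges are disjoint, and the other from the cut. In the upper bound \<open>mass1\<close>
  serves the case \<open>sep x y = 0\<close>, in which the empty word has weight 1.\<close>

lemma ldist_sep:
  assumes "x \<in> seq_space S" "y \<in> seq_space S" "cls x \<noteq> cls y"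
  shows "lo * lo * w (x (sep x y)) \<le> ldist x y"
    and "ldist x y \<le> (mass1 + 1 + 1 / lo) * w (x (sep x y))"
proof -
  let ?k = "sep x y"
  obtain a where a: "x (Suc ?k) = a # x ?k" "a \<in> E" using seq_Suc[OF assms(1)] by metis
  have "lo * (lo * w (x ?k)) \<le> lo * w (x (Suc ?k))"
    using w_Cons_ge[of a "x ?k" "Suc ?k"] seq_words[OF assms(1), of "Suc ?k"] lo_hi a
    by (intro mult_left_mono) auto
  also have "\<dots> \<le> ldist x y" by (rule ldist_not_touch[OF assms(1,2) sep(1)[OF assms]])
  finally show "lo * lo * w (x ?k) \<le> ldist x y" by (simp add: mult.assoc)
  show "ldist x y \<le> (mass1 + 1 + 1 / lo) * w (x ?k)"
  proof (cases ?k)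
    case 0
    then have "w (x ?k) = 1" using seq_words[OF assms(1), of 0] by (simp add: words_0)
    moreover have "0 \<le> 1 + 1 / lo" using lo_hi by simp
    then have "mass1 \<le> mass1 + (1 + 1 / lo)" by (simp only: le_add_same_cancel1)
    ultimately show ?thesis using ldist_le_mass1[OF assms(1,2)] by (simp add: add.assoc)
  next
    case (Suc n)
    then have "ldist x y \<le> (1 + 1 / lo) * w (x ?k)"
      using ldist_touch[OF assms(1,2), of n] sep(2)[OF assms] by simp
    also have "\<dots> \<le> (mass1 + 1 + 1 / lo) * w (x ?k)"
      using mass1_pos w_pos[OF seq_words[OF assms(1)], of ?k] by (intro mult_right_mono) auto
    finally show ?thesis .
  qed
qed

end

section \<open>Quasisymmetry\<close>

text \<open>In the variable \<open>L * t\<close>, the power with exponent \<open>\<alpha>\<close>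
  dominates up to 1 and the one with exponent \<open>\<beta>\<close> beyond. The inverse is
  therefore the minimum with the reciprocal exponents.\<close>

lemma homeomorphism_powr_max:
  fixes \<alpha> \<beta> K L :: real
  assumes ab: "0 < \<alpha>" "\<alpha> \<le> \<beta>" and KL: "0 < K" "0 < L"
  shows "homeomorphism {0..} {0..} (\<lambda>t. K * max ((L * t) powr \<alpha>) ((L * t) powr \<beta>))
    (\<lambda>r. min ((r / K) powr (1 / \<alpha>)) ((r / K) powr (1 / \<beta>)) / L)"
proof -
  define f where "f s = max (s powr \<alpha>) (s powr \<beta>)" for s :: real
  define g where "g r = min (r powr (1 / \<alpha>)) (r powr (1 / \<beta>))" for r :: real
  have b: "0 < \<beta>" using ab by simp
  have inv: "1 / \<beta> \<le> 1 / \<alpha>" using ab by (simp add: field_simps)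
  have f1: "f s = s powr \<alpha>" if "0 \<le> s" "s \<le> 1" for s
    using powr_mono'[OF ab(2) that] by (simp add: f_def)
  have f2: "f s = s powr \<beta>" if "1 \<le> s" for s
    using powr_mono[OF ab(2) that] by (simp add: f_def)
  have g1: "g r = r powr (1 / \<alpha>)" if "0 \<le> r" "r \<le> 1" for r
    using powr_mono'[OF inv that] by (simp add: g_def)
  have g2: "g r = r powr (1 / \<beta>)" if "1 \<le> r" for r
    using powr_mono[OF inv that] by (simp add: g_def)
  have gf: "g (f s) = s" if "0 \<le> s" for s
  proof (cases "s \<le> 1")
    case True
    then have "s powr \<alpha> \<le> 1" using ab that by (simp add: powr_le1)
    then show ?thesis using True that ab by (simp add: f1 g1 powr_powr)
  next
    case False
    then have "1 \<le> s powr \<beta>" using b by (simp add: ge_one_powr_ge_zero)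
    then show ?thesis using False b by (simp add: f2 g2 powr_powr)
  qed
  have fg: "f (g r) = r" if "0 \<le> r" for r
  proof (cases "r \<le> 1")
    case True
    then have "r powr (1 / \<alpha>) \<le> 1" using ab that by (simp add: powr_le1)
    then show ?thesis using True that ab by (simp add: f1 g1 powr_powr)
  next
    case False
    then have "1 \<le> r powr (1 / \<beta>)" using b by (simp add: ge_one_powr_ge_zero)
    then show ?thesis using False b by (simp add: f2 g2 powr_powr)
  qed
  have f0: "0 \<le> f s" and g0: "0 \<le> g s" for s by (simp_all add: f_def g_def le_max_iff_disj)
  have cf: "continuous_on {0..} (\<lambda>t. K * f (L * t))"
    unfolding f_def using ab b KL by (intro continuous_intros continuous_on_powr') auto
  have cg: "continuous_on {0..} (\<lambda>r. g (r / K) / L)"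
    unfolding g_def using ab b KL by (intro continuous_intros continuous_on_powr') auto
  have "homeomorphism {0..} {0..} (\<lambda>t. K * f (L * t)) (\<lambda>r. g (r / K) / L)"
  proof (rule homeomorphismI[OF cf cg])
    show "(\<lambda>t. K * f (L * t)) ` {0..} \<subseteq> {0..}" using KL f0 by auto
    show "(\<lambda>r. g (r / K) / L) ` {0..} \<subseteq> {0..}" using KL g0 by auto
    show "g (K * f (L * t) / K) / L = t" if "t \<in> {0..}" for t using that KL gf by simp
    show "K * f (L * (g (r / K) / L)) = r" if "r \<in> {0..}" for r using that KL fg by simp
  qed
  then show ?thesis by (simp add: f_def g_def)
qed

context laakso_density
begin

lemma ldist_ratio:
  obtains K where "1 \<le> K"
    "\<And>x y z. x \<in> seq_space S \<Longrightarrow> y \<in> seq_space S \<Longrightarrow> z \<in> seq_space S \<Longrightarrow> cls x \<noteq> cls y \<Longrightarrow> cls x \<noteq> cls z \<Longrightarrow>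
      ldist x y / ldist x z \<le> K * (w (x (sep x y)) / w (x (sep x z)))"
    "\<And>x y z. x \<in> seq_space S \<Longrightarrow> y \<in> seq_space S \<Longrightarrow> z \<in> seq_space S \<Longrightarrow> cls x \<noteq> cls y \<Longrightarrow> cls x \<noteq> cls z \<Longrightarrow>
      w (x (sep x y)) / w (x (sep x z)) \<le> K * (ldist x y / ldist x z)"
proof -
  define c where "c = lo * lo"
  define C where "C = mass1 + 1 + 1 / lo"
  have c: "0 < c" using lo_hi by (simp add: c_def)
  have C: "0 < C" using mass1_pos lo_hi by (simp add: C_def add_pos_pos)
  have bounds: "c * w (x (sep x y)) \<le> ldist x y" "ldist x y \<le> C * w (x (sep x y))" "0 < w (x (sep x y))"
    "0 < ldist x y"
    if "x \<in> seq_space S" "y \<in> seq_space S" "cls x \<noteq> cls y" for x y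
  proof -
    show 1: "c * w (x (sep x y)) \<le> ldist x y" "ldist x y \<le> C * w (x (sep x y))"
      using ldist_sep[OF that] by (simp_all add: c_def C_def)
    show 2: "0 < w (x (sep x y))" using w_pos[OF seq_words[OF that(1)]] .
    have "0 < c * w (x (sep x y))" using c 2 by simp
    with 1(1) show "0 < ldist x y" by linarith
  qed
  show ?thesis
  proof (rule that)
    show "1 \<le> max 1 (C / c)" by simp
    fix x y z assume sp: "x \<in> seq_space S" "y \<in> seq_space S" "z \<in> seq_space S" "cls x \<noteq> cls y" "cls x \<noteq> cls z"
    note y = bounds[OF sp(1,2,4)] and z = bounds[OF sp(1,3,5)]
    let ?wy = "w (x (sep x y))" and ?wz = "w (x (sep x z))"
    have "ldist x y / ldist x z \<le> (C * ?wy) / (c * ?wz)"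
      using y z c C by (intro frac_le) auto
    also have "\<dots> = C / c * (?wy / ?wz)" by simp
    also have "\<dots> \<le> max 1 (C / c) * (?wy / ?wz)" using y z by (intro mult_right_mono) auto
    finally show "ldist x y / ldist x z \<le> max 1 (C / c) * (?wy / ?wz)" .
    have "?wy / ?wz \<le> (ldist x y / c) / (ldist x z / C)"
    proof (rule frac_le)
      show "?wy \<le> ldist x y / c" using y c by (simp add: pos_le_divide_eq mult.commute)
      show "ldist x z / C \<le> ?wz" using z C by (simp add: pos_divide_le_eq mult.commute)
    qed (use y z c C in auto)
    also have "\<dots> = C / c * (ldist x y / ldist x z)" by simp
    also have "\<dots> \<le> max 1 (C / c) * (ldist x y / ldist x z)" using y z by (intro mult_right_mono) auto
    finally show "?wy / ?wz \<le> max 1 (C / c) * (ldist x y / ldist x z)" .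
  qed
qed

end

section \<open>Comparison of two densities\<close>

locale laakso_densities = \<rho>: laakso_density S \<eta>\<^sub>V \<eta>\<^sub>E \<rho> + \<nu>: laakso_density S \<eta>\<^sub>V \<eta>\<^sub>E \<nu>
  for S :: "('v, 'e, 'i) igs" and \<eta>\<^sub>V :: "'v \<Rightarrow> 'v" and \<eta>\<^sub>E :: "'e \<Rightarrow> 'e" and \<rho> \<nu> :: "'e \<Rightarrow> real"
begin

lemma flip: "laakso_densities S \<eta>\<^sub>V \<eta>\<^sub>E \<nu> \<rho>"
  by unfold_locales

lemma exponent:
  obtains \<alpha> where "0 < \<alpha>" "\<And>a. a \<in> edges (gen S) \<Longrightarrow> \<nu> a \<le> \<rho> a powr \<alpha>"
proof
  \<comment> \<open>The solution of \<open>\<nu>.hi = \<rho>.lo powr ?\<alpha>\<close>; it is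
    positive because both numbers lie below 1.\<close>
  let ?\<alpha> = "ln \<nu>.hi / ln \<rho>.lo"
  have neg: "ln \<nu>.hi < 0" "ln \<rho>.lo < 0"
    using \<nu>.lo_hi \<rho>.lo_hi by (simp_all add: ln_less_zero)
  then show pos: "0 < ?\<alpha>" by (simp add: divide_neg_neg)
  fix a assume a: "a \<in> edges (gen S)"
  have "\<nu> a \<le> \<nu>.hi" by (rule \<nu>.le_hi[OF a])
  also have "\<nu>.hi = \<rho>.lo powr ?\<alpha>"
    using neg \<nu>.lo_hi \<rho>.lo_hi by (simp add: powr_def)
  also have "\<dots> \<le> \<rho> a powr ?\<alpha>"
    using pos \<rho>.lo_le[OF a] \<rho>.lo_hi by (intro powr_mono2) auto
  finally show "\<nu> a \<le> \<rho> a powr ?\<alpha>" .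
qed

lemma w_le_powr:
  assumes "\<And>a. a \<in> edges (gen S) \<Longrightarrow> \<nu> a \<le> \<rho> a powr \<alpha>"
  shows "u \<in> repl_edges S n \<Longrightarrow> iter_density \<nu> u \<le> iter_density \<rho> u powr \<alpha>"
proof (induction u arbitrary: n)
  case (Cons a u)
  then have a: "a \<in> edges (gen S)" and u: "u \<in> repl_edges S (length u)" by (auto simp: repl_edges_def)
  have "\<nu> a * iter_density \<nu> u \<le> \<rho> a powr \<alpha> * iter_density \<rho> u powr \<alpha>"
    using assms[OF a] Cons.IH[OF u] \<nu>.w_pos[OF u] \<nu>.density_range[OF a]
    by (intro mult_mono) auto
  then show ?case
    using \<rho>.density_range[OF a] \<rho>.w_pos[OF u] by (simp add: powr_mult)
qed simp

text \<open>Both distances are comparable to weights of the same word \<open>x (sep x y)\<close>,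
  and these are related by \<open>w_le_powr\<close>. The radius solves the resulting Hoelder
  estimate for \<open>\<epsilon>\<close>.\<close>

lemma dist_holder:
  assumes "0 < \<epsilon>"
  obtains r where "0 < r" "\<And>x y. x \<in> seq_space S \<Longrightarrow> y \<in> seq_space S \<Longrightarrow> \<rho>.ldist x y < r \<Longrightarrow> \<nu>.ldist x y < \<epsilon>"
proof -
  obtain \<alpha> where \<alpha>: "0 < \<alpha>" "\<And>a. a \<in> edges (gen S) \<Longrightarrow> \<nu> a \<le> \<rho> a powr \<alpha>" using exponent by blast
  define c where "c = \<rho>.lo * \<rho>.lo"
  define C where "C = \<nu>.mass1 + 1 + 1 / \<nu>.lo"
  have c: "0 < c" using \<rho>.lo_hi by (simp add: c_def)
  have C: "0 < C" using \<nu>.mass1_pos \<nu>.lo_hi by (simp add: C_def add_pos_pos)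
  define r where "r = c * (\<epsilon> / C) powr (1 / \<alpha>)"
  show ?thesis
  proof (rule that)
    show "0 < r" using c C assms by (simp add: r_def)
    fix x y assume sp: "x \<in> seq_space S" "y \<in> seq_space S" and lt: "\<rho>.ldist x y < r"
    show "\<nu>.ldist x y < \<epsilon>"
    proof (cases "\<rho>.cls x = \<rho>.cls y")
      case True
      then have "\<nu>.ldist x y = 0" using sp by (simp add: \<nu>.ldist_eq_0_iff \<rho>.cls_eq_iff)
      then show ?thesis using assms by simp
    next
      case False
      let ?k = "\<rho>.sep x y"
      have "c * iter_density \<rho> (x ?k) < c * (\<epsilon> / C) powr (1 / \<alpha>)"
        using \<rho>.ldist_sep(1)[OF sp False] lt by (simp add: c_def r_def)
      then have "iter_density \<rho> (x ?k) < (\<epsilon> / C) powr (1 / \<alpha>)" using c by simp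
      then have "iter_density \<rho> (x ?k) powr \<alpha> < ((\<epsilon> / C) powr (1 / \<alpha>)) powr \<alpha>"
        using \<alpha>(1) \<rho>.w_pos[OF \<rho>.seq_words[OF sp(1)]] by (intro powr_less_mono2) (auto intro: less_imp_le)
      also have "\<dots> = \<epsilon> / C" using \<alpha>(1) assms C by (simp add: powr_powr)
      finally have "C * iter_density \<rho> (x ?k) powr \<alpha> < \<epsilon>" using C by (simp add: pos_less_divide_eq mult.commute)
      moreover have "iter_density \<nu> (x ?k) \<le> iter_density \<rho> (x ?k) powr \<alpha>"
        by (rule w_le_powr[OF \<alpha>(2) \<rho>.seq_words[OF sp(1)]])
      then have "C * iter_density \<nu> (x ?k) \<le> C * iter_density \<rho> (x ?k) powr \<alpha>"
        using C by (intro mult_left_mono) auto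
      moreover have "\<nu>.ldist x y \<le> C * iter_density \<nu> (x ?k)"
        using \<nu>.ldist_sep(2)[OF sp False] by (simp add: C_def)
      ultimately show ?thesis by linarith
    qed
  qed
qed

lemma openin_mtopology_imp:
  assumes "openin \<nu>.mtopology U"
  shows "openin \<rho>.mtopology U"
  unfolding \<rho>.openin_mtopology
proof (intro conjI allI impI)
  show U: "U \<subseteq> limit_space S" using assms by (simp add: \<nu>.openin_mtopology)
  fix p assume p: "p \<in> U"
  then obtain \<epsilon> where \<epsilon>: "0 < \<epsilon>" "\<nu>.mball p \<epsilon> \<subseteq> U" using assms by (auto simp: \<nu>.openin_mtopology)
  obtain r where r: "0 < r" "\<And>x y. x \<in> seq_space S \<Longrightarrow> y \<in> seq_space S \<Longrightarrow> \<rho>.ldist x y < r \<Longrightarrow> \<nu>.ldist x y < \<epsilon>"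
    using dist_holder[OF \<epsilon>(1)] by blast
  have "\<rho>.mball p r \<subseteq> \<nu>.mball p \<epsilon>"
  proof
    fix q assume q: "q \<in> \<rho>.mball p r"
    then have "p \<in> limit_space S" "q \<in> limit_space S" by auto
    then obtain x y where xy: "x \<in> seq_space S" "p = \<rho>.cls x" "y \<in> seq_space S" "q = \<rho>.cls y"
      by (elim \<rho>.limit_spaceE)
    then have "\<rho>.ldist x y < r" using q by (simp add: \<rho>.limit_dist_cls)
    from r(2)[OF xy(1,3) this] show "q \<in> \<nu>.mball p \<epsilon>"
      using xy q by (simp add: \<nu>.limit_dist_cls)
  qed
  with \<epsilon>(2) r(1) show "\<exists>r>0. \<rho>.mball p r \<subseteq> U" by blast
qed

lemma mtopology_eq: "\<nu>.mtopology = \<rho>.mtopology"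
proof -
  interpret flip: laakso_densities S \<eta>\<^sub>V \<eta>\<^sub>E \<nu> \<rho> by (rule flip)
  show ?thesis
    unfolding topology_eq using openin_mtopology_imp flip.openin_mtopology_imp by blast
qed

lemma quasisymmetric:
  obtains \<alpha> \<beta> K L where "0 < \<alpha>" "\<alpha> \<le> \<beta>" "0 < K" "0 < L"
    "\<And>x y z. x \<in> seq_space S \<Longrightarrow> y \<in> seq_space S \<Longrightarrow> z \<in> seq_space S \<Longrightarrow> \<rho>.cls x \<noteq> \<rho>.cls z \<Longrightarrow>
      \<nu>.ldist x y / \<nu>.ldist x z \<le> K * max ((L * (\<rho>.ldist x y / \<rho>.ldist x z)) powr \<alpha>)
        ((L * (\<rho>.ldist x y / \<rho>.ldist x z)) powr \<beta>)"
proof -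
  interpret flip: laakso_densities S \<eta>\<^sub>V \<eta>\<^sub>E \<nu> \<rho> by (rule flip)
  obtain \<alpha> where \<alpha>: "0 < \<alpha>" "\<And>a. a \<in> edges (gen S) \<Longrightarrow> \<nu> a \<le> \<rho> a powr \<alpha>" using exponent by blast
  obtain \<gamma> where \<gamma>: "0 < \<gamma>" "\<And>a. a \<in> edges (gen S) \<Longrightarrow> \<rho> a \<le> \<nu> a powr \<gamma>" using flip.exponent by blast
  define \<beta> where "\<beta> = 1 / \<gamma>"
  have \<beta>: "0 < \<beta>" using \<gamma> by (simp add: \<beta>_def)
  have lower: "iter_density \<rho> u powr \<beta> \<le> iter_density \<nu> u" if u: "u \<in> repl_edges S n" for u n
  proof -
    have "iter_density \<rho> u powr \<beta> \<le> (iter_density \<nu> u powr \<gamma>) powr \<beta>"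
      using flip.w_le_powr[OF \<gamma>(2) u] \<rho>.w_pos[OF u] \<beta> by (intro powr_mono2) auto
    also have "\<dots> = iter_density \<nu> u" using \<gamma>(1) \<nu>.w_pos[OF u] by (simp add: powr_powr \<beta>_def)
    finally show ?thesis .
  qed
  \<comment> \<open>The two power bounds are compared at a single letter, whose weight is below
    1.\<close>
  have "\<alpha> \<le> \<beta>"
  proof -
    obtain a where a: "a \<in> edges (gen S)" using \<rho>.E_nonempty by auto
    then have "\<rho> a powr \<beta> \<le> \<rho> a powr \<alpha>" using \<alpha>(2)[OF a] lower[of "[a]" 1]
      by (simp add: repl_edges_def)
    then show ?thesis using \<rho>.density_range[OF a] by (metis linorder_not_le powr_less_mono')
  qed
  obtain K where K: "1 \<le> K"
    "\<And>x y z. x \<in> seq_space S \<Longrightarrow> y \<in> seq_space S \<Longrightarrow> z \<in> seq_space S \<Longrightarrow> \<rho>.cls x \<noteq> \<rho>.cls y \<Longrightarrow> \<rho>.cls x \<noteq> \<rho>.cls z \<Longrightarrow>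
      \<nu>.ldist x y / \<nu>.ldist x z \<le> K * (iter_density \<nu> (x (\<rho>.sep x y)) / iter_density \<nu> (x (\<rho>.sep x z)))"
    by (rule \<nu>.ldist_ratio) blast
  obtain L where L: "1 \<le> L"
    "\<And>x y z. x \<in> seq_space S \<Longrightarrow> y \<in> seq_space S \<Longrightarrow> z \<in> seq_space S \<Longrightarrow> \<rho>.cls x \<noteq> \<rho>.cls y \<Longrightarrow> \<rho>.cls x \<noteq> \<rho>.cls z \<Longrightarrow>
      iter_density \<rho> (x (\<rho>.sep x y)) / iter_density \<rho> (x (\<rho>.sep x z)) \<le> L * (\<rho>.ldist x y / \<rho>.ldist x z)"
    by (rule \<rho>.ldist_ratio) blast
  show ?thesis
  proof (rule that[OF \<alpha>(1) \<open>\<alpha> \<le> \<beta>\<close>, of K L])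
    show "0 < K" "0 < L" using K(1) L(1) by auto
    fix x y z assume sp: "x \<in> seq_space S" "y \<in> seq_space S" "z \<in> seq_space S" and xz: "\<rho>.cls x \<noteq> \<rho>.cls z"
    let ?T = "L * (\<rho>.ldist x y / \<rho>.ldist x z)"
    show "\<nu>.ldist x y / \<nu>.ldist x z \<le> K * max (?T powr \<alpha>) (?T powr \<beta>)"
    proof (cases "\<rho>.cls x = \<rho>.cls y")
      case True
      then have "\<nu>.ldist x y = 0" using sp by (simp add: \<nu>.ldist_eq_0_iff \<rho>.cls_eq_iff)
      then show ?thesis using K(1) by (simp add: le_max_iff_disj)
    next
      case xy: False
      let ?n = "\<rho>.sep x y" and ?m = "\<rho>.sep x z"
      \<comment> \<open>The deeper of two words along \<open>x\<close> extends the other by some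
        \<open>u\<close>, so the ratio of their weights is the weight of \<open>u\<close> or its
        reciprocal. The first case is bounded with \<open>\<alpha>\<close>, the second with
        \<open>\<beta>\<close>.\<close>
      have split: "\<exists>u. u \<in> repl_edges S (j - i) \<and> x j = u @ x i" if "i \<le> j" for i j
      proof (intro exI conjI)
        show "x j = take (j - i) (x j) @ x i"
          using \<rho>.seq_drop[OF sp(1) that] by (metis append_take_drop_id)
        show "take (j - i) (x j) \<in> repl_edges S (j - i)"
          using \<rho>.seq_words[OF sp(1), of j] by (auto simp: repl_edges_def dest: in_set_takeD)
      qed
      have pos: "0 < iter_density \<rho> (x i)" "0 < iter_density \<nu> (x i)" for i
        using \<rho>.w_pos \<nu>.w_pos \<rho>.seq_words[OF sp(1)] by blast+
      have T: "iter_density \<rho> (x ?n) / iter_density \<rho> (x ?m) \<le> ?T" by (rule L(2)[OF sp xy xz])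
      have "iter_density \<nu> (x ?n) / iter_density \<nu> (x ?m) \<le> max (?T powr \<alpha>) (?T powr \<beta>)"
      proof (cases "?m \<le> ?n")
        case True
        then obtain u where u: "u \<in> repl_edges S (?n - ?m)" "x ?n = u @ x ?m" using split by blast
        have "iter_density \<nu> (x ?n) / iter_density \<nu> (x ?m) = iter_density \<nu> u"
          using pos[of ?m] by (simp add: u \<nu>.w_append)
        also have "\<dots> \<le> iter_density \<rho> u powr \<alpha>" by (rule w_le_powr[OF \<alpha>(2) u(1)])
        also have "\<dots> \<le> ?T powr \<alpha>"
          using T pos[of ?m] \<alpha>(1) \<rho>.w_pos[OF u(1)] by (intro powr_mono2) (auto simp: u \<rho>.w_append)
        finally show ?thesis by simp
      next
        case False
        then obtain u where u: "u \<in> repl_edges S (?m - ?n)" "x ?m = u @ x ?n" using split[of ?n ?m] by auto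
        have "iter_density \<nu> (x ?n) / iter_density \<nu> (x ?m) = 1 / iter_density \<nu> u"
          using pos[of ?n] by (simp add: u \<nu>.w_append)
        also have "\<dots> \<le> 1 / (iter_density \<rho> u powr \<beta>)"
          using lower[OF u(1)] \<rho>.w_pos[OF u(1)] by (intro frac_le) auto
        also have "\<dots> = (1 / iter_density \<rho> u) powr \<beta>"
          using \<rho>.w_pos[OF u(1)] by (simp add: powr_divide)
        also have "\<dots> \<le> ?T powr \<beta>"
          using T pos[of ?n] \<beta> \<rho>.w_pos[OF u(1)] by (intro powr_mono2) (auto simp: u \<rho>.w_append)
        finally show ?thesis by simp
      qed
      then have "K * (iter_density \<nu> (x ?n) / iter_density \<nu> (x ?m)) \<le> K * max (?T powr \<alpha>) (?T powr \<beta>)"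
        using K(1) by (intro mult_left_mono) auto
      with K(2)[OF sp xy xz] show ?thesis by linarith
    qed
  qed
qed

theorem quasisymmetrically_equivalent_limit_dist:
  "quasisymmetrically_equivalent (limit_space S) (limit_dist S \<rho>) (limit_dist S \<nu>)"
proof -
  obtain \<alpha> \<beta> K L where *: "0 < \<alpha>" "\<alpha> \<le> \<beta>" "0 < K" "0 < L"
    and qs: "\<And>x y z. x \<in> seq_space S \<Longrightarrow> y \<in> seq_space S \<Longrightarrow> z \<in> seq_space S \<Longrightarrow> \<rho>.cls x \<noteq> \<rho>.cls z \<Longrightarrow>
      \<nu>.ldist x y / \<nu>.ldist x z \<le> K * max ((L * (\<rho>.ldist x y / \<rho>.ldist x z)) powr \<alpha>)
        ((L * (\<rho>.ldist x y / \<rho>.ldist x z)) powr \<beta>)"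
    using quasisymmetric by metis
  let ?\<psi> = "\<lambda>t. K * max ((L * t) powr \<alpha>) ((L * t) powr \<beta>)"
  have "limit_dist S \<nu> p q / limit_dist S \<nu> p r \<le> ?\<psi> (limit_dist S \<rho> p q / limit_dist S \<rho> p r)"
    if pqr: "p \<in> limit_space S" "q \<in> limit_space S" "r \<in> limit_space S" "p \<noteq> r" for p q r
  proof -
    obtain x where x: "x \<in> seq_space S" "p = \<rho>.cls x" by (rule \<rho>.limit_spaceE[OF pqr(1)])
    obtain y where y: "y \<in> seq_space S" "q = \<rho>.cls y" by (rule \<rho>.limit_spaceE[OF pqr(2)])
    obtain z where z: "z \<in> seq_space S" "r = \<rho>.cls z" by (rule \<rho>.limit_spaceE[OF pqr(3)])
    show ?thesis
      using qs[OF x(1) y(1) z(1)] pqr(4) x y z by (simp add: \<rho>.limit_dist_cls \<nu>.limit_dist_cls)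
  qed
  then show ?thesis
    unfolding quasisymmetrically_equivalent_def
    using homeomorphism_powr_max[OF *] \<rho>.Metric_space_axioms \<nu>.Metric_space_axioms mtopology_eq
    by (intro conjI exI[of _ ?\<psi>] exI[of _ "\<lambda>r. min ((r / K) powr (1 / \<alpha>)) ((r / K) powr (1 / \<beta>)) / L"]) auto
qed

end

section \<open>Radon measures on metric spaces\<close>

lemma (in Metric_space) open_closed_sets:
  assumes sp: "space \<mu> = M" and st: "sets \<mu> = sigma_sets M {U. openin mtopology U}"
  shows "openin mtopology U \<Longrightarrow> U \<in> sets \<mu>" and "closedin mtopology K \<Longrightarrow> K \<in> sets \<mu>"
proof -
  have *: "U \<in> sets \<mu>" if "openin mtopology U" for U
    unfolding st using that by (intro sigma_sets.Basic) auto
  then show "openin mtopology U \<Longrightarrow> U \<in> sets \<mu>" .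
  assume K: "closedin mtopology K"
  then have "M - K \<in> sets \<mu>" using * by (simp add: closedin_def)
  then have "M - (M - K) \<in> sets \<mu>" using sets.compl_sets[of "M - K" \<mu>] by (simp add: sp)
  moreover have "M - (M - K) = K" using closedin_subset[OF K] by auto
  ultimately show "K \<in> sets \<mu>" by (simp only:)
qed

text \<open>Sets squeezed between a closed and an open set of almost equal measure form a
  sigma-algebra, and \<open>inner\<close> places the open sets in it.\<close>

lemma (in Metric_space) closed_open_approx:
  assumes \<mu>: "finite_measure \<mu>" and sp: "space \<mu> = M" and st: "sets \<mu> = sigma_sets M {U. openin mtopology U}"
    and inner: "\<And>U \<epsilon>. openin mtopology U \<Longrightarrow> 0 < \<epsilon> \<Longrightarrow> \<exists>K. compactin mtopology K \<and> K \<subseteq> U \<and> measure \<mu> (U - K) < \<epsilon>"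
    and A: "A \<in> sets \<mu>" and \<epsilon>: "0 < (\<epsilon>::real)"
  shows "\<exists>K U. closedin mtopology K \<and> openin mtopology U \<and> K \<subseteq> A \<and> A \<subseteq> U \<and> measure \<mu> (U - K) < \<epsilon>"
proof -
  interpret finite_measure \<mu> by (rule \<mu>)
  note open_sets = open_closed_sets(1)[OF sp st] and closed_sets = open_closed_sets(2)[OF sp st]
  have "A \<in> sigma_sets M {U. openin mtopology U}" using A st by simp
  then show ?thesis using \<epsilon>
  proof (induction arbitrary: \<epsilon> rule: sigma_sets.induct)
    case (Basic U)
    then obtain K where "compactin mtopology K" "K \<subseteq> U" "measure \<mu> (U - K) < \<epsilon>"
      using inner[of U \<epsilon>] by auto
    moreover from this(1) have "closedin mtopology K"
      by (rule compactin_imp_closedin[OF Hausdorff_space_mtopology])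
    moreover have "openin mtopology U" using Basic by simp
    ultimately show ?case by blast
  next
    case Empty
    then show ?case by (intro exI[of _ "{}"]) auto
  next
    case (Compl A)
    from Compl.IH[OF Compl.prems] obtain K U where KU: "closedin mtopology K" "openin mtopology U"
      "K \<subseteq> A" "A \<subseteq> U" "measure \<mu> (U - K) < \<epsilon>" by (elim exE conjE)
    have "closedin mtopology (M - U)" "openin mtopology (M - K)"
      using closedin_diff[OF closedin_topspace KU(2)] openin_diff[OF openin_topspace KU(1)] by simp_all
    moreover have "(M - K) - (M - U) = U - K" using openin_subset[OF KU(2)] by auto
    then have "measure \<mu> ((M - K) - (M - U)) < \<epsilon>" using KU(5) by (simp only:)
    moreover have "M - U \<subseteq> M - A" "M - A \<subseteq> M - K" using KU(3,4) by auto
    ultimately show ?case by blast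
  next
    case (Union A)
    \<comment> \<open>Half of \<open>\<epsilon>\<close> is spread over the sets by a geometric
      series. The other half pays for replacing the union of all \<open>K i\<close>, which need not
      be closed, by a finite one.\<close>
    have "\<exists>K U. closedin mtopology K \<and> openin mtopology U \<and> K \<subseteq> A i \<and> A i \<subseteq> U \<and>
        measure \<mu> (U - K) < \<epsilon> / 2 * (1 / 2) ^ Suc i" for i
      by (rule Union.IH) (simp add: Union.prems)
    then obtain K U where KU: "\<And>i. closedin mtopology (K i)" "\<And>i. openin mtopology (U i)"
      "\<And>i. K i \<subseteq> A i" "\<And>i. A i \<subseteq> U i" "\<And>i::nat. measure \<mu> (U i - K i) < \<epsilon> / 2 * (1 / 2) ^ Suc i"
      by metis
    have [measurable]: "K i \<in> sets \<mu>" "U i \<in> sets \<mu>" for i using KU open_sets closed_sets by auto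
    have sums: "(\<lambda>i. \<epsilon> / 2 * (1 / 2) ^ Suc i) sums (\<epsilon> / 2)"
      using sums_mult[OF power_half_series, of "\<epsilon> / 2"] by simp
    have summ: "summable (\<lambda>i. measure \<mu> (U i - K i))"
      by (rule summable_comparison_test'[OF sums_summable[OF sums], of 0])
        (use less_imp_le[OF KU(5)] in \<open>simp only: real_norm_def abs_of_nonneg[OF measure_nonneg]\<close>)
    have "measure \<mu> (\<Union>i. U i - K i) \<le> (\<Sum>i. measure \<mu> (U i - K i))"
      by (rule finite_measure_subadditive_countably) (auto simp: summ)
    also have "\<dots> \<le> \<epsilon> / 2"
      using suminf_le[OF _ summ sums_summable[OF sums]] KU(5) sums_unique[OF sums]
      by (simp add: less_imp_le)
    finally have 1: "measure \<mu> (\<Union>i. U i - K i) \<le> \<epsilon> / 2" .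
    have "(\<lambda>n. measure \<mu> (\<Union>i\<le>n. K i)) \<longlonglongrightarrow> measure \<mu> (\<Union>n. \<Union>i\<le>n. K i)"
      by (rule finite_Lim_measure_incseq) (auto simp: incseq_def intro: order_trans)
    moreover have "(\<Union>n. \<Union>i\<le>n. K i) = (\<Union>i. K i)" by auto
    ultimately have "\<forall>\<^sub>F n in sequentially. measure \<mu> (\<Union>i. K i) - \<epsilon> / 2 < measure \<mu> (\<Union>i\<le>n. K i)"
      using Union.prems by (intro order_tendstoD(1)) auto
    then obtain n where n: "measure \<mu> (\<Union>i. K i) - \<epsilon> / 2 < measure \<mu> (\<Union>i\<le>n. K i)"
      by (auto simp: eventually_sequentially)
    let ?K = "\<Union>i\<le>n. K i"
    have "measure \<mu> ((\<Union>i. K i) - ?K) = measure \<mu> (\<Union>i. K i) - measure \<mu> ?K"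
      by (intro finite_measure_Diff) auto
    with n have 2: "measure \<mu> ((\<Union>i. K i) - ?K) < \<epsilon> / 2" by simp
    have "measure \<mu> ((\<Union>i. U i) - ?K) \<le> measure \<mu> ((\<Union>i. U i - K i) \<union> ((\<Union>i. K i) - ?K))"
      by (intro finite_measure_mono) auto
    also have "\<dots> \<le> measure \<mu> (\<Union>i. U i - K i) + measure \<mu> ((\<Union>i. K i) - ?K)"
      by (intro measure_Un_le) auto
    finally have "measure \<mu> ((\<Union>i. U i) - ?K) < \<epsilon>" using 1 2 by simp
    moreover have "closedin mtopology ?K" using KU(1) by (intro closedin_Union) auto
    moreover have "openin mtopology (\<Union>i. U i)" using KU(2) by (intro openin_Union) auto
    ultimately show ?case
      using KU(3,4) by (intro exI[of _ ?K] exI[of _ "\<Union>i. U i"]) blast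
  qed
qed

text \<open>Outer regularity follows from \<open>closed_open_approx\<close>, since
  \<open>U - A\<close> lies in \<open>U - K\<close>; inner regularity on open sets is a
  reformulation of \<open>inner\<close>.\<close>

lemma (in Metric_space) radon_measure_finite:
  assumes \<mu>: "finite_measure \<mu>" and sp: "space \<mu> = M" and st: "sets \<mu> = sigma_sets M {U. openin mtopology U}"
    and inner: "\<And>U \<epsilon>. openin mtopology U \<Longrightarrow> 0 < \<epsilon> \<Longrightarrow> \<exists>K. compactin mtopology K \<and> K \<subseteq> U \<and> measure \<mu> (U - K) < \<epsilon>"
  shows "radon_measure mtopology \<mu>"
proof -
  interpret finite_measure \<mu> by (rule \<mu>)
  note open_sets = open_closed_sets(1)[OF sp st] and closed_sets = open_closed_sets(2)[OF sp st]
  have approx: "emeasure \<mu> B \<le> emeasure \<mu> K + ennreal \<epsilon>"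
    if "K \<subseteq> B" "K \<in> sets \<mu>" "B \<in> sets \<mu>" "measure \<mu> (B - K) \<le> \<epsilon>" for K B \<epsilon>
  proof -
    have "emeasure \<mu> B = emeasure \<mu> (K \<union> (B - K))" using that by (simp add: Un_absorb1)
    also have "\<dots> \<le> emeasure \<mu> K + emeasure \<mu> (B - K)" using that by (intro emeasure_subadditive) auto
    also have "\<dots> \<le> emeasure \<mu> K + ennreal \<epsilon>"
      using that(4) by (intro add_left_mono) (simp add: emeasure_eq_measure ennreal_leI)
    finally show ?thesis .
  qed
  have outer: "emeasure \<mu> A = (INF U\<in>{U. openin mtopology U \<and> A \<subseteq> U}. emeasure \<mu> U)" if A: "A \<in> sets \<mu>" for A
  proof (rule antisym)
    show "emeasure \<mu> A \<le> (INF U\<in>{U. openin mtopology U \<and> A \<subseteq> U}. emeasure \<mu> U)"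
      by (rule INF_greatest) (auto intro!: emeasure_mono open_sets)
    show "(INF U\<in>{U. openin mtopology U \<and> A \<subseteq> U}. emeasure \<mu> U) \<le> emeasure \<mu> A"
    proof (rule ennreal_le_epsilon)
      fix \<epsilon> :: real assume "0 < \<epsilon>"
      from closed_open_approx[OF \<mu> sp st inner A this]
      obtain K U where KU: "closedin mtopology K" "openin mtopology U" "K \<subseteq> A" "A \<subseteq> U" "measure \<mu> (U - K) < \<epsilon>"
        by blast
      have "measure \<mu> (U - A) \<le> measure \<mu> (U - K)"
        using KU A open_sets[OF KU(2)] closed_sets[OF KU(1)] by (intro finite_measure_mono) auto
      then have "emeasure \<mu> U \<le> emeasure \<mu> A + ennreal \<epsilon>"
        using KU A by (intro approx) (auto intro!: open_sets)
      moreover have "(INF U\<in>{U. openin mtopology U \<and> A \<subseteq> U}. emeasure \<mu> U) \<le> emeasure \<mu> U"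
        using KU by (intro INF_lower) auto
      ultimately show "(INF U\<in>{U. openin mtopology U \<and> A \<subseteq> U}. emeasure \<mu> U) \<le> emeasure \<mu> A + ennreal \<epsilon>"
        by (rule order_trans[rotated])
    qed
  qed
  have inner': "emeasure \<mu> U = (SUP K\<in>{K. compactin mtopology K \<and> K \<subseteq> U}. emeasure \<mu> K)" if U: "openin mtopology U" for U
  proof (rule antisym)
    show "(SUP K\<in>{K. compactin mtopology K \<and> K \<subseteq> U}. emeasure \<mu> K) \<le> emeasure \<mu> U"
      by (rule SUP_least) (auto intro!: emeasure_mono open_sets U)
    show "emeasure \<mu> U \<le> (SUP K\<in>{K. compactin mtopology K \<and> K \<subseteq> U}. emeasure \<mu> K)"
    proof (rule ennreal_le_epsilon)
      fix \<epsilon> :: real assume "0 < \<epsilon>"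
      from inner[OF U this] obtain K where K: "compactin mtopology K" "K \<subseteq> U" "measure \<mu> (U - K) < \<epsilon>" by blast
      have "emeasure \<mu> U \<le> emeasure \<mu> K + ennreal \<epsilon>"
        using K open_sets[OF U] closed_sets[OF compactin_imp_closedin[OF Hausdorff_space_mtopology K(1)]]
        by (intro approx) auto
      also have "emeasure \<mu> K \<le> (SUP K\<in>{K. compactin mtopology K \<and> K \<subseteq> U}. emeasure \<mu> K)"
        using K by (intro SUP_upper) auto
      finally show "emeasure \<mu> U \<le> (SUP K\<in>{K. compactin mtopology K \<and> K \<subseteq> U}. emeasure \<mu> K) + ennreal \<epsilon>"
        by (simp add: add_right_mono)
    qed
  qed
  show ?thesis
    unfolding radon_measure_def using sp st outer inner' by (auto simp: emeasure_eq_measure)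
qed

section \<open>Ahlfors regularity\<close>

text \<open>Reads a sequence of letters as a sequence of edges: the letter \<open>\<omega> n\<close>
  is put in front at level \<open>n + 1\<close>.\<close>

primrec word :: "(nat \<Rightarrow> 'e) \<Rightarrow> nat \<Rightarrow> 'e list" where
  "word \<omega> 0 = []"
| "word \<omega> (Suc n) = \<omega> n # word \<omega> n"

lemma length_word [simp]: "length (word \<omega> n) = n"
  by (induction n) auto

lemma word_eq_iff: "word \<omega> n = word \<omega>' n \<longleftrightarrow> (\<forall>i<n. \<omega> i = \<omega>' i)"
  by (induction n) (auto simp: less_Suc_eq)

context laakso_igs
begin

section \<open>Coding of the limit space by sequences of letters\<close>

lemma word_in_words: "\<omega> \<in> UNIV \<rightarrow> E \<Longrightarrow> word \<omega> n \<in> words n"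
  by (induction n) (auto simp: words_0 Cons_words)

lemma word_in_seq_space: "\<omega> \<in> UNIV \<rightarrow> E \<Longrightarrow> word \<omega> \<in> seq_space S"
  by (simp add: seq_space_def word_in_words)

lemma seq_space_word:
  assumes "x \<in> seq_space S"
  obtains \<omega> where "\<omega> \<in> UNIV \<rightarrow> E" "x = word \<omega>"
proof -
  define \<omega> where "\<omega> n = hd (x (Suc n))" for n
  have step: "x (Suc n) = \<omega> n # x n \<and> \<omega> n \<in> E" for n
    using seq_Suc[OF assms, of n] unfolding \<omega>_def by (metis list.sel(1))
  have "x n = word \<omega> n" for n
    using seq_words[OF assms, of 0] by (induction n) (simp_all add: words_0 step)
  then have "x = word \<omega>" by auto
  with step show ?thesis by (intro that[of \<omega>]) auto
qed

lemma words_word: "u \<in> words n \<Longrightarrow> \<exists>\<omega>\<in>UNIV \<rightarrow> E. word \<omega> n = u"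
proof (induction n arbitrary: u)
  case 0
  obtain a where "a \<in> E" using E_nonempty by auto
  then show ?case using 0 by (intro bexI[of _ "\<lambda>_. a"]) (auto simp: words_0)
next
  case (Suc n)
  then obtain a v where av: "u = a # v" "a \<in> E" "v \<in> words n" by (auto simp: words_Suc)
  then obtain \<omega> where \<omega>: "\<omega> \<in> UNIV \<rightarrow> E" "word \<omega> n = v" using Suc.IH by blast
  let ?\<omega> = "\<lambda>i. if i = n then a else \<omega> i"
  have "word ?\<omega> n = word \<omega> n" by (simp add: word_eq_iff)
  then have "word ?\<omega> (Suc n) = u" using av \<omega> by simp
  moreover have "?\<omega> \<in> UNIV \<rightarrow> E" using av \<omega> by auto
  ultimately show ?case by blast
qed

definition cyl :: "'e list \<Rightarrow> (nat \<Rightarrow> 'e) set" where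
  "cyl u = {\<omega> \<in> UNIV \<rightarrow> E. word \<omega> (length u) = u}"

definition point :: "(nat \<Rightarrow> 'e) \<Rightarrow> (nat \<Rightarrow> 'e list) set" where
  "point \<omega> = cls (word \<omega>)"

lemma cyl_word: "\<omega>\<^sub>0 \<in> UNIV \<rightarrow> E \<Longrightarrow> cyl (word \<omega>\<^sub>0 n) = {\<omega> \<in> UNIV \<rightarrow> E. \<forall>i<n. \<omega> i = \<omega>\<^sub>0 i}"
  by (auto simp: cyl_def word_eq_iff)

text \<open>As a product of finitely many singletons and otherwise full finite factors, a cylinder
  is open and, by Tychonoff's theorem, compact in \<open>coding\<close>.\<close>

lemma cyl_word_PiE:
  "\<omega>\<^sub>0 \<in> UNIV \<rightarrow> E \<Longrightarrow> cyl (word \<omega>\<^sub>0 n) = Pi\<^sub>E UNIV (\<lambda>i. if i < n then {\<omega>\<^sub>0 i} else E)"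
  by (auto simp: cyl_word PiE_def Pi_iff split: if_splits)

abbreviation "coding \<equiv> product_topology (\<lambda>_::nat. discrete_topology E) UNIV"

lemma openin_cyl:
  assumes "\<omega>\<^sub>0 \<in> UNIV \<rightarrow> E"
  shows "openin coding (cyl (word \<omega>\<^sub>0 n))"
proof -
  have "finite {i \<in> UNIV. (if i < n then {\<omega>\<^sub>0 i} else E) \<noteq> topspace (discrete_topology E)}"
    by (rule finite_subset[of _ "{..<n}"]) auto
  then show ?thesis
    unfolding cyl_word_PiE[OF assms] openin_PiE_gen using assms by auto
qed

lemma compactin_cyl:
  assumes "\<omega>\<^sub>0 \<in> UNIV \<rightarrow> E"
  shows "compactin coding (cyl (word \<omega>\<^sub>0 n))"
  unfolding cyl_word_PiE[OF assms] compactin_PiE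
  using assms by (auto simp: compactin_discrete_topology finite_E)

end

context laakso_density
begin

lemma mball_cyl:
  assumes \<omega>: "\<omega> \<in> UNIV \<rightarrow> E" and "1 \<le> n" "w (word \<omega> n) < r"
  shows "point ` cyl (word \<omega> n) \<subseteq> mball (point \<omega>) r"
proof
  fix p assume "p \<in> point ` cyl (word \<omega> n)"
  then obtain \<omega>' where \<omega>': "p = point \<omega>'" "\<omega>' \<in> UNIV \<rightarrow> E" "word \<omega>' n = word \<omega> n" by (auto simp: cyl_def)
  then have "ldist (word \<omega>) (word \<omega>') \<le> w (word \<omega> n)"
    using assms by (intro ldist_same_word word_in_seq_space) auto
  then show "p \<in> mball (point \<omega>) r"
    using assms \<omega>' by (simp add: point_def limit_dist_cls word_in_seq_space cls_in_limit_space)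
qed

lemma small_cyl:
  assumes "\<omega> \<in> UNIV \<rightarrow> E" "0 < r"
  obtains n where "1 \<le> n" "w (word \<omega> n) < r"
proof -
  have "\<forall>\<^sub>F n in sequentially. w (word \<omega> n) < r"
    using w_seq_tendsto_0[OF word_in_seq_space[OF assms(1)]] assms(2) by (intro order_tendstoD(2)) auto
  then obtain N where "\<forall>n\<ge>N. w (word \<omega> n) < r" by (auto simp: eventually_sequentially)
  then have "w (word \<omega> (Suc N)) < r" by (meson le_SucI order_refl)
  then show ?thesis by (intro that[of "Suc N"]) simp
qed

lemma open_cyl:
  assumes "openin mtopology U" "\<omega> \<in> UNIV \<rightarrow> E" "point \<omega> \<in> U"
  obtains n where "point ` cyl (word \<omega> n) \<subseteq> U"
proof -
  obtain r where r: "0 < r" "mball (point \<omega>) r \<subseteq> U" using assms by (auto simp: openin_mtopology)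
  obtain n where "1 \<le> n" "w (word \<omega> n) < r" using small_cyl[OF assms(2) r(1)] .
  from mball_cyl[OF assms(2) this] r show ?thesis using that by blast
qed

lemma continuous_point: "continuous_map coding mtopology point"
  unfolding continuous_map_to_metric
proof (intro ballI allI impI)
  fix \<omega> and \<epsilon> :: real assume "\<omega> \<in> topspace coding" and \<epsilon>: "0 < \<epsilon>"
  then have \<omega>: "\<omega> \<in> UNIV \<rightarrow> E" by auto
  obtain n where "1 \<le> n" "w (word \<omega> n) < \<epsilon>" using small_cyl[OF \<omega> \<epsilon>] .
  from mball_cyl[OF \<omega> this]
  have "\<forall>\<omega>'\<in>cyl (word \<omega> n). point \<omega>' \<in> mball (point \<omega>) \<epsilon>" by blast
  moreover have "\<omega> \<in> cyl (word \<omega> n)" using \<omega> by (simp add: cyl_def)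
  ultimately show "\<exists>U. openin coding U \<and> \<omega> \<in> U \<and> (\<forall>y\<in>U. point y \<in> mball (point \<omega>) \<epsilon>)"
    using openin_cyl[OF \<omega>] by blast
qed

end

locale laakso_measure = laakso_density S \<eta>\<^sub>V \<eta>\<^sub>E \<rho>
  for S :: "('v, 'e, 'i) igs" and \<eta>\<^sub>V :: "'v \<Rightarrow> 'v" and \<eta>\<^sub>E :: "'e \<Rightarrow> 'e" and \<rho> :: "'e \<Rightarrow> real" +
  fixes Q :: real
  assumes Q_pos: "0 < Q" and sum_Q: "(\<Sum>e\<in>E. \<rho> e powr Q) = 1"
begin

section \<open>The Bernoulli measure and its push-forward\<close>

definition letter :: "'e measure" where
  "letter = point_measure E (\<lambda>a. ennreal (\<rho> a powr Q))"

definition bernoulli :: "(nat \<Rightarrow> 'e) measure" where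
  "bernoulli = PiM UNIV (\<lambda>_. letter)"

definition \<mu> :: "(nat \<Rightarrow> 'e list) set measure" where
  "\<mu> = distr bernoulli (sigma (limit_space S) {U. openin mtopology U}) point"

lemma prob_space_letter: "prob_space letter"
proof
  show "emeasure letter (space letter) = 1"
    unfolding letter_def using sum_Q finite_E
    by (simp add: space_point_measure emeasure_point_measure_finite sum_ennreal)
qed

lemma product_prob_space_letter: "product_prob_space (\<lambda>_::nat. letter)"
  using prob_space_letter by (rule product_prob_spaceI)

lemma prob_space_bernoulli: "prob_space bernoulli"
  unfolding bernoulli_def using prob_space_letter by (rule prob_space_PiM)

lemma space_bernoulli: "space bernoulli = UNIV \<rightarrow> E"
  by (simp add: bernoulli_def space_PiM letter_def space_point_measure PiE_UNIV_domain)

lemma cyl_bernoulli: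
  assumes "u \<in> words n"
  shows sets_cyl: "cyl u \<in> sets bernoulli" and emeasure_cyl: "emeasure bernoulli (cyl u) = ennreal (w u powr Q)"
proof -
  interpret product_prob_space "\<lambda>_::nat. letter" UNIV by (rule product_prob_space_letter)
  obtain \<omega>\<^sub>0 where \<omega>\<^sub>0: "\<omega>\<^sub>0 \<in> UNIV \<rightarrow> E" "word \<omega>\<^sub>0 n = u" using words_word[OF assms] by blast
  have cyl: "cyl u = {\<omega> \<in> space (PiM UNIV (\<lambda>_. letter)). \<forall>i\<in>{..<n}. \<omega> i \<in> {\<omega>\<^sub>0 i}}"
    using space_bernoulli cyl_word[OF \<omega>\<^sub>0(1), of n] \<omega>\<^sub>0(2) by (simp add: bernoulli_def Ball_def)
  have single: "{\<omega>\<^sub>0 i} \<in> sets letter" for i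
    using \<omega>\<^sub>0 by (auto simp: letter_def sets_point_measure)
  have "emeasure bernoulli (cyl u) = (\<Prod>i<n. emeasure letter {\<omega>\<^sub>0 i})"
    unfolding bernoulli_def cyl by (rule emeasure_PiM_Collect) (auto simp: single)
  also have "\<dots> = (\<Prod>i<n. ennreal (\<rho> (\<omega>\<^sub>0 i) powr Q))"
  proof (rule prod.cong)
    fix i
    have "\<omega>\<^sub>0 i \<in> E" using \<omega>\<^sub>0 by auto
    then show "emeasure letter {\<omega>\<^sub>0 i} = ennreal (\<rho> (\<omega>\<^sub>0 i) powr Q)"
      using finite_E by (simp add: letter_def emeasure_point_measure_finite)
  qed simp
  also have "\<dots> = ennreal (\<Prod>i<n. \<rho> (\<omega>\<^sub>0 i) powr Q)" by (rule prod_ennreal) simp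
  also have "(\<Prod>i<n. \<rho> (\<omega>\<^sub>0 i) powr Q) = w (word \<omega>\<^sub>0 n) powr Q"
  proof (induction n)
    case (Suc n)
    have "0 < \<rho> (\<omega>\<^sub>0 n)" "0 < w (word \<omega>\<^sub>0 n)"
      using \<omega>\<^sub>0(1) density_range w_pos[OF word_in_words[OF \<omega>\<^sub>0(1)]] by auto
    then show ?case using Suc by (simp add: powr_mult)
  qed simp
  finally show "emeasure bernoulli (cyl u) = ennreal (w u powr Q)" using \<omega>\<^sub>0(2) by simp
  \<comment> \<open>The factor \<open>space bernoulli\<close> matters for \<open>n = 0\<close>,
    where the intersection runs over no index.\<close>
  have "cyl u = (\<Inter>i<n. {\<omega> \<in> space bernoulli. \<omega> i \<in> {\<omega>\<^sub>0 i}}) \<inter> space bernoulli"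
    unfolding cyl bernoulli_def by auto
  moreover have "{\<omega> \<in> space bernoulli. \<omega> i \<in> {\<omega>\<^sub>0 i}} \<in> sets bernoulli" for i
    unfolding bernoulli_def by (rule sets_Collect_single) (auto simp: single)
  ultimately show "cyl u \<in> sets bernoulli" by (cases n) (auto intro!: sets.finite_INT sets.Int)
qed

text \<open>Exhausts the preimage of an open set by finite unions of cylinders. This gives both the
  measurability of \<open>point\<close> and, as images of cylinders are compact, the compact sets
  for the Radon property.\<close>

definition filled :: "(nat \<Rightarrow> 'e list) set set \<Rightarrow> nat \<Rightarrow> (nat \<Rightarrow> 'e) set" where
  "filled U n = (\<Union>u\<in>{u \<in> words n. point ` cyl u \<subseteq> U}. cyl u)"

lemma sets_filled: "filled U n \<in> sets bernoulli"
  unfolding filled_def by (intro sets.finite_UN) (auto simp: finite_words sets_cyl)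

lemma incseq_filled: "incseq (filled U)"
proof (rule incseq_SucI, rule subsetI)
  fix n \<omega> assume "\<omega> \<in> filled U n"
  then have \<omega>: "\<omega> \<in> UNIV \<rightarrow> E" "point ` cyl (word \<omega> n) \<subseteq> U"
    by (auto simp: filled_def cyl_def length_words)
  have "cyl (word \<omega> (Suc n)) \<subseteq> cyl (word \<omega> n)" unfolding cyl_word[OF \<omega>(1)] by auto
  then have "point ` cyl (word \<omega> (Suc n)) \<subseteq> U" using \<omega>(2) by blast
  then show "\<omega> \<in> filled U (Suc n)"
    using \<omega>(1) word_in_words[OF \<omega>(1), of "Suc n"] unfolding filled_def
    by (intro UN_I[of "word \<omega> (Suc n)"]) (auto simp: cyl_def)
qed

lemma UN_filled:
  assumes "openin mtopology U"
  shows "(\<Union>n. filled U n) = point -` U \<inter> space bernoulli"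
proof (intro set_eqI iffI)
  fix \<omega> assume "\<omega> \<in> (\<Union>n. filled U n)"
  then show "\<omega> \<in> point -` U \<inter> space bernoulli"
    by (auto simp: filled_def cyl_def space_bernoulli length_words)
next
  fix \<omega> assume "\<omega> \<in> point -` U \<inter> space bernoulli"
  then have \<omega>: "\<omega> \<in> UNIV \<rightarrow> E" "point \<omega> \<in> U" by (auto simp: space_bernoulli)
  then obtain n where "point ` cyl (word \<omega> n) \<subseteq> U" using open_cyl[OF assms] by blast
  then have "\<omega> \<in> filled U n"
    using \<omega>(1) word_in_words[OF \<omega>(1), of n] unfolding filled_def
    by (intro UN_I[of "word \<omega> n"]) (auto simp: cyl_def)
  then show "\<omega> \<in> (\<Union>n. filled U n)" by blast
qed

lemma compactin_filled: "compactin mtopology (point ` filled U n)"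
proof -
  have "compactin mtopology (point ` cyl u)" if u: "u \<in> words n" for u
  proof -
    obtain \<omega> where "\<omega> \<in> UNIV \<rightarrow> E" "word \<omega> n = u" using words_word[OF u] by blast
    then have "compactin coding (cyl u)" using compactin_cyl by blast
    then show ?thesis by (rule image_compactin[OF _ continuous_point])
  qed
  then have "compactin mtopology (\<Union>u\<in>{u \<in> words n. point ` cyl u \<subseteq> U}. point ` cyl u)"
    by (intro compactin_Union) (auto simp: finite_words)
  then show ?thesis by (simp add: filled_def image_UN)
qed

lemma point_in_limit_space: "\<omega> \<in> UNIV \<rightarrow> E \<Longrightarrow> point \<omega> \<in> limit_space S"
  by (simp add: point_def cls_in_limit_space word_in_seq_space)

lemma open_subset_Pow: "{U. openin mtopology U} \<subseteq> Pow (limit_space S)"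
  using openin_subset[of mtopology] by auto

lemma measurable_point: "point \<in> measurable bernoulli (sigma (limit_space S) {U. openin mtopology U})"
proof (rule measurable_measure_of[OF open_subset_Pow])
  show "point \<in> space bernoulli \<rightarrow> limit_space S" by (auto simp: space_bernoulli point_in_limit_space)
  fix U assume "U \<in> {U. openin mtopology U}"
  then show "point -` U \<inter> space bernoulli \<in> sets bernoulli"
    using UN_filled[of U, symmetric] sets_filled by auto
qed

lemma space_\<mu>: "space \<mu> = limit_space S"
  using open_subset_Pow by (simp add: \<mu>_def space_measure_of)

lemma sets_\<mu>: "sets \<mu> = sigma_sets (limit_space S) {U. openin mtopology U}"
  using open_subset_Pow by (simp add: \<mu>_def sets_measure_of)

lemma prob_space_\<mu>: "prob_space \<mu>"
  unfolding \<mu>_def by (rule prob_space.prob_space_distr[OF prob_space_bernoulli measurable_point])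

lemma open_in_sets_\<mu>: "openin mtopology U \<Longrightarrow> U \<in> sets \<mu>"
  unfolding sets_\<mu> by (intro sigma_sets.Basic) auto

lemma emeasure_\<mu>: "A \<in> sets \<mu> \<Longrightarrow> emeasure \<mu> A = emeasure bernoulli (point -` A \<inter> space bernoulli)"
  unfolding \<mu>_def by (rule emeasure_distr[OF measurable_point]) simp

lemma radon_\<mu>: "radon_measure mtopology \<mu>"
proof (rule radon_measure_finite[OF _ space_\<mu> sets_\<mu>])
  interpret B: prob_space bernoulli by (rule prob_space_bernoulli)
  interpret \<mu>: prob_space \<mu> by (rule prob_space_\<mu>)
  show "finite_measure \<mu>" by unfold_locales
  fix U and \<epsilon> :: real assume U: "openin mtopology U" and "0 < \<epsilon>"
  let ?P = "point -` U \<inter> space bernoulli"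
  have meas: "?P \<in> sets bernoulli" using UN_filled[OF U, symmetric] sets_filled by auto
  have "(\<lambda>n. measure bernoulli (filled U n)) \<longlonglongrightarrow> measure bernoulli ?P"
    using B.finite_Lim_measure_incseq[of "filled U"] incseq_filled sets_filled UN_filled[OF U] by auto
  then have "\<forall>\<^sub>F n in sequentially. measure bernoulli ?P - \<epsilon> < measure bernoulli (filled U n)"
    using \<open>0 < \<epsilon>\<close> by (intro order_tendstoD(1)) auto
  then obtain n where n: "measure bernoulli ?P - \<epsilon> < measure bernoulli (filled U n)"
    by (auto simp: eventually_sequentially)
  let ?K = "point ` filled U n"
  have K: "compactin mtopology ?K" by (rule compactin_filled)
  have KU: "?K \<subseteq> U" by (auto simp: filled_def)
  have sub: "filled U n \<subseteq> ?P" unfolding UN_filled[OF U, symmetric] by (rule UN_upper) simp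
  have "limit_space S - ?K \<in> sets \<mu>"
    using compactin_imp_closedin[OF Hausdorff_space_mtopology K]
    by (intro open_in_sets_\<mu>) (simp add: closedin_def)
  then have "U \<inter> (limit_space S - ?K) \<in> sets \<mu>" by (rule sets.Int[OF open_in_sets_\<mu>[OF U]])
  moreover have "U \<inter> (limit_space S - ?K) = U - ?K" using openin_subset[OF U] by auto
  ultimately have UK: "U - ?K \<in> sets \<mu>" by (simp only:)
  have "emeasure \<mu> (U - ?K) = emeasure bernoulli (point -` (U - ?K) \<inter> space bernoulli)"
    by (rule emeasure_\<mu>[OF UK])
  also have "\<dots> \<le> emeasure bernoulli (?P - filled U n)"
    using meas sets_filled by (intro emeasure_mono) auto
  finally have "measure \<mu> (U - ?K) \<le> measure bernoulli (?P - filled U n)"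
    by (simp add: \<mu>.emeasure_eq_measure B.emeasure_eq_measure)
  also have "\<dots> = measure bernoulli ?P - measure bernoulli (filled U n)"
    by (rule B.finite_measure_Diff[OF meas sets_filled sub])
  also have "\<dots> < \<epsilon>" using n by simp
  finally show "\<exists>K. compactin mtopology K \<and> K \<subseteq> U \<and> measure \<mu> (U - K) < \<epsilon>"
    using K KU by blast
qed

section \<open>Measure of balls\<close>

lemma mball_\<mu>: "mball p r \<in> sets \<mu>"
  by (intro open_in_sets_\<mu>) simp

text \<open>The ball contains the whole cell around its centre at the earliest positive level where
  the weight drops below \<open>r\<close>; one letter costs at most a factor \<open>lo\<close>, so
  this weight is still at least \<open>lo / D * r\<close>.\<close>

lemma ball_lower:
  assumes \<omega>: "\<omega> \<in> UNIV \<rightarrow> E" and r: "0 < r" "r \<le> D" "1 \<le> D"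
  shows "ennreal ((lo / D * r) powr Q) \<le> emeasure \<mu> (mball (point \<omega>) r)"
proof -
  let ?x = "word \<omega>"
  let ?P = "\<lambda>k. w (?x (Suc k)) < r"
  obtain n where "1 \<le> n" "w (?x n) < r" using small_cyl[OF \<omega> r(1)] .
  then have "\<exists>k. ?P k" by (metis One_nat_def Suc_le_D)
  then have k: "?P (LEAST k. ?P k)" by (rule LeastI_ex)
  define k where "k = (LEAST k. ?P k)"
  \<comment> \<open>By minimality of \<open>k\<close>; for \<open>k = 0\<close> the word is empty,
    its weight is 1, and \<open>r \<le> D\<close> suffices.\<close>
  have "r / D \<le> w (?x k)"
  proof (cases k)
    case 0
    then show ?thesis using r by simp
  next
    case (Suc j)
    then have "r \<le> w (?x k)" using not_less_Least[of j ?P] by (simp add: k_def)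
    moreover have "r / D \<le> r" using r by (simp add: pos_divide_le_eq)
    ultimately show ?thesis by simp
  qed
  then have "lo * (r / D) \<le> lo * w (?x k)" using lo_hi by (intro mult_left_mono) auto
  also have "\<dots> \<le> w (?x (Suc k))"
    using w_Cons_ge[of "\<omega> k" "?x k" "Suc k"] word_in_words[OF \<omega>, of "Suc k"] by simp
  finally have "ennreal ((lo / D * r) powr Q) \<le> ennreal (w (?x (Suc k)) powr Q)"
    using lo_hi r Q_pos by (intro ennreal_leI powr_mono2) auto
  also have "\<dots> = emeasure bernoulli (cyl (?x (Suc k)))"
    using emeasure_cyl[OF word_in_words[OF \<omega>, of "Suc k"]] by simp
  also have "\<dots> \<le> emeasure bernoulli (point -` mball (point \<omega>) r \<inter> space bernoulli)"
  proof (rule emeasure_mono)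
    have "point ` cyl (?x (Suc k)) \<subseteq> mball (point \<omega>) r"
      using k by (intro mball_cyl[OF \<omega>]) (auto simp: k_def)
    then show "cyl (?x (Suc k)) \<subseteq> point -` mball (point \<omega>) r \<inter> space bernoulli"
      by (auto simp: space_bernoulli cyl_def)
    show "point -` mball (point \<omega>) r \<inter> space bernoulli \<in> sets bernoulli"
      using mball_\<mu> measurable_sets[OF measurable_point, of "mball (point \<omega>) r"] by (simp add: \<mu>_def)
  qed
  also have "\<dots> = emeasure \<mu> (mball (point \<omega>) r)" by (rule emeasure_\<mu>[OF mball_\<mu>, symmetric])
  finally show ?thesis .
qed

text \<open>By \<open>ldist_not_touch\<close>, every point of the ball has an edge of level
  \<open>n + 1\<close> that meets the edge of the centre. There are at most
  \<open>4 * card E\<close> such edges, each heavier by at most the factor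
  \<open>1 / lo\<close>.\<close>

lemma ball_cover:
  assumes \<omega>: "\<omega> \<in> UNIV \<rightarrow> E" and r: "r \<le> lo * w (word \<omega> (Suc n))"
  shows "emeasure \<mu> (mball (point \<omega>) r) \<le> ennreal (4 * card E * (w (word \<omega> (Suc n)) / lo) powr Q)"
proof -
  let ?x = "word \<omega>"
  let ?F = "{f \<in> words (Suc n). touch (?x (Suc n)) f}"
  have xw: "?x (Suc n) \<in> words (Suc n)" by (rule word_in_words[OF \<omega>])
  have finF: "finite ?F" using finite_words by simp
  have "point -` mball (point \<omega>) r \<inter> space bernoulli \<subseteq> (\<Union>f\<in>?F. cyl f)"
  proof
    fix \<omega>' assume "\<omega>' \<in> point -` mball (point \<omega>) r \<inter> space bernoulli"
    then have \<omega>': "\<omega>' \<in> UNIV \<rightarrow> E" "limit_dist S \<rho> (point \<omega>) (point \<omega>') < r"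
      by (auto simp: space_bernoulli)
    then have "ldist ?x (word \<omega>') < r"
      using \<omega> by (simp add: point_def limit_dist_cls word_in_seq_space)
    then have "touch (?x (Suc n)) (word \<omega>' (Suc n))"
      using ldist_not_touch[OF word_in_seq_space[OF \<omega>] word_in_seq_space[OF \<omega>'(1)], of n] r
      by (meson linorder_not_le order_trans)
    then have "word \<omega>' (Suc n) \<in> ?F" using word_in_words[OF \<omega>'(1), of "Suc n"] by simp
    moreover have "\<omega>' \<in> cyl (word \<omega>' (Suc n))" unfolding cyl_word[OF \<omega>'(1)] using \<omega>'(1) by simp
    ultimately show "\<omega>' \<in> (\<Union>f\<in>?F. cyl f)" by blast
  qed
  moreover have sets: "cyl f \<in> sets bernoulli" if "f \<in> ?F" for f
    using that sets_cyl[of f "Suc n"] by simp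
  ultimately have "emeasure \<mu> (mball (point \<omega>) r) \<le> emeasure bernoulli (\<Union>f\<in>?F. cyl f)"
    unfolding emeasure_\<mu>[OF mball_\<mu>] using finF by (intro emeasure_mono sets.finite_UN) auto
  also have "\<dots> \<le> (\<Sum>f\<in>?F. emeasure bernoulli (cyl f))"
    using finF sets by (intro emeasure_subadditive_finite) auto
  also have "\<dots> \<le> (\<Sum>f\<in>?F. ennreal ((w (?x (Suc n)) / lo) powr Q))"
  proof (rule sum_mono)
    fix f assume f: "f \<in> ?F"
    have "lo * w f \<le> w (?x (Suc n))" using w_comparable[OF touch_sym] f xw by blast
    then have "w f \<le> w (?x (Suc n)) / lo" using lo_hi by (simp add: pos_le_divide_eq mult.commute)
    then show "emeasure bernoulli (cyl f) \<le> ennreal ((w (?x (Suc n)) / lo) powr Q)"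
      using f w_pos[of f "Suc n"] Q_pos emeasure_cyl[of f "Suc n"]
      by (auto intro!: ennreal_leI powr_mono2)
  qed
  also have "\<dots> = ennreal (card ?F * (w (?x (Suc n)) / lo) powr Q)"
    by (simp add: ennreal_mult ennreal_of_nat_eq_real_of_nat)
  also have "\<dots> \<le> ennreal (4 * card E * (w (?x (Suc n)) / lo) powr Q)"
  proof (intro ennreal_leI mult_right_mono)
    have "real (card ?F) \<le> real (4 * card E)" using card_touch[OF xw] by (rule of_nat_mono)
    then show "real (card ?F) \<le> real (4 * card E)" .
  qed simp
  finally show ?thesis .
qed

text \<open>The three factors \<open>lo\<close> come from the cut, from one step between levels, and
  from the comparison of meeting edges in \<open>ball_cover\<close>.\<close>

lemma ball_upper:
  assumes \<omega>: "\<omega> \<in> UNIV \<rightarrow> E" and r: "0 < r"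
  shows "emeasure \<mu> (mball (point \<omega>) r) \<le> ennreal (4 * card E * (r / lo ^ 3) powr Q)"
proof (cases "r \<le> lo * w (word \<omega> (Suc 0))")
  \<comment> \<open>For such radii the claimed bound is at least 1, the total mass.\<close>
  case False
  interpret \<mu>: prob_space \<mu> by (rule prob_space_\<mu>)
  have "\<omega> 0 \<in> E" using \<omega> by auto
  have "lo ^ 3 \<le> lo ^ 2" using lo_hi lo_lt_1 by (intro power_decreasing) auto
  also have "\<dots> \<le> lo * w (word \<omega> (Suc 0))"
    using lo_le[OF \<open>\<omega> 0 \<in> E\<close>] lo_hi by (simp add: power2_eq_square)
  also have "\<dots> < r" using False by simp
  finally have "1 \<le> r / lo ^ 3" using lo_hi by simp
  then have "1 \<le> (r / lo ^ 3) powr Q" using Q_pos by (simp add: ge_one_powr_ge_zero)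
  moreover have "1 \<le> card E" using E_nonempty finite_E by (simp add: Suc_le_eq card_gt_0_iff)
  then have "1 \<le> 4 * real (card E)" by simp
  ultimately have "1 \<le> 4 * card E * (r / lo ^ 3) powr Q"
    using mult_mono[of 1 "4 * real (card E)" 1 "(r / lo ^ 3) powr Q"] by simp
  then have "ennreal 1 \<le> ennreal (4 * card E * (r / lo ^ 3) powr Q)" by (rule ennreal_leI)
  then have "1 \<le> ennreal (4 * card E * (r / lo ^ 3) powr Q)" by (simp only: ennreal_1)
  with \<mu>.emeasure_le_1 show ?thesis by (rule order_trans)
next
  case True
  let ?x = "word \<omega>"
  let ?P = "\<lambda>k. lo * w (?x (Suc (Suc k))) < r"
  obtain n where n: "1 \<le> n" "w (?x n) < r / lo" using small_cyl[OF \<omega>, of "r / lo"] r lo_hi by auto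
  have "w (?x (Suc n)) \<le> w (?x n)"
    using w_suffix_ge[of "[\<omega> n]" "?x n" "Suc n"] word_in_words[OF \<omega>, of "Suc n"] by simp
  with n obtain m where "n = Suc m" "w (?x (Suc (Suc m))) < r / lo" by (cases n) auto
  then have "\<exists>k. ?P k" using lo_hi by (auto simp: pos_less_divide_eq mult.commute)
  then have k: "?P (LEAST k. ?P k)" by (rule LeastI_ex)
  \<comment> \<open>As weights decrease along the sequence, \<open>k + 1\<close> is the last level
    at which \<open>ball_cover\<close> applies to \<open>r\<close>.\<close>
  define k where "k = (LEAST k. ?P k)"
  have le: "r \<le> lo * w (?x (Suc k))"
  proof (cases k)
    case (Suc j)
    then show ?thesis using not_less_Least[of j ?P] by (simp add: k_def)
  qed (use True in simp)
  have "lo * w (?x (Suc k)) \<le> w (?x (Suc (Suc k)))"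
    using w_Cons_ge[of "\<omega> (Suc k)" "?x (Suc k)" "Suc (Suc k)"] word_in_words[OF \<omega>, of "Suc (Suc k)"] by simp
  then have "lo * (lo * w (?x (Suc k))) \<le> lo * w (?x (Suc (Suc k)))"
    using lo_hi by (intro mult_left_mono) auto
  also have "\<dots> < r" using k by (simp add: k_def)
  finally have "w (?x (Suc k)) / lo \<le> r / lo ^ 3"
    using lo_hi by (simp add: field_simps power3_eq_cube)
  then have "4 * card E * (w (?x (Suc k)) / lo) powr Q \<le> 4 * card E * (r / lo ^ 3) powr Q"
    using Q_pos lo_hi w_pos[OF word_in_words[OF \<omega>], of "Suc k"]
    by (intro mult_left_mono powr_mono2 divide_nonneg_pos) (auto simp del: word.simps iter_density.simps)
  then have "ennreal (4 * card E * (w (?x (Suc k)) / lo) powr Q) \<le> ennreal (4 * card E * (r / lo ^ 3) powr Q)"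
    by (rule ennreal_leI)
  with ball_cover[OF \<omega> le] show ?thesis by (rule order_trans)
qed

theorem ahlfors_regular_limit_dist: "ahlfors_regular Q (limit_space S) (limit_dist S \<rho>)"
proof -
  \<comment> \<open>Large enough for every radius up to twice the diameter, and at least 1 because
    level 0 in \<open>ball_lower\<close> compares \<open>r\<close> with the weight of the empty
    word.\<close>
  define D where "D = max 1 (2 * mass1)"
  define C\<^sub>1 where "C\<^sub>1 = (D / lo) powr Q"
  define C\<^sub>2 where "C\<^sub>2 = 4 * real (card E) * (1 / lo ^ 3) powr Q"
  have D: "1 \<le> D" "2 * mass1 \<le> D" by (auto simp: D_def)
  have "1 \<le> D / lo" using D lo_hi lo_lt_1 by (simp add: pos_le_divide_eq)
  then have C1: "1 \<le> C\<^sub>1" using Q_pos by (simp add: C\<^sub>1_def ge_one_powr_ge_zero)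
  have C2: "0 \<le> C\<^sub>2" by (simp add: C\<^sub>2_def)
  have diam: "metric_diam (limit_space S) (limit_dist S \<rho>) \<le> ennreal mass1"
    unfolding metric_diam_def
  proof (intro SUP_least ennreal_leI)
    fix p q assume "p \<in> limit_space S" "q \<in> limit_space S"
    then obtain x y where "x \<in> seq_space S" "p = cls x" "y \<in> seq_space S" "q = cls y" by (elim limit_spaceE)
    then show "limit_dist S \<rho> p q \<le> mass1" by (simp add: limit_dist_cls ldist_le_mass1)
  qed
  have bounds: "ennreal (inverse (C\<^sub>1 + C\<^sub>2) * r powr Q) \<le> emeasure \<mu> (mball p r)"
    "emeasure \<mu> (mball p r) \<le> ennreal ((C\<^sub>1 + C\<^sub>2) * r powr Q)"
    if p: "p \<in> limit_space S" and r: "0 < r"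
      and rd: "ennreal r \<le> 2 * metric_diam (limit_space S) (limit_dist S \<rho>)" for p r
  proof -
    obtain x where "x \<in> seq_space S" "p = cls x" by (rule limit_spaceE[OF p])
    moreover from this(1) obtain \<omega> where \<omega>: "\<omega> \<in> UNIV \<rightarrow> E" "x = word \<omega>" by (rule seq_space_word)
    ultimately have p': "p = point \<omega>" by (simp add: point_def)
    have "ennreal r \<le> 2 * ennreal mass1" using rd diam by (meson mult_left_mono order_trans zero_le)
    also have "\<dots> = ennreal (2 * mass1)" using mass1_pos by (simp add: ennreal_mult)
    finally have "r \<le> D" using mass1_pos D by (simp add: ennreal_le_iff)
    have "inverse (C\<^sub>1 + C\<^sub>2) \<le> inverse C\<^sub>1" using C1 C2 by (intro le_imp_inverse_le) auto
    also have "inverse C\<^sub>1 = (lo / D) powr Q"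
      using D lo_hi by (simp add: C\<^sub>1_def powr_divide)
    finally have "inverse (C\<^sub>1 + C\<^sub>2) * r powr Q \<le> (lo / D) powr Q * r powr Q" by (intro mult_right_mono) auto
    also have "\<dots> = (lo / D * r) powr Q" using D lo_hi r by (simp only: powr_mult)
    finally have "ennreal (inverse (C\<^sub>1 + C\<^sub>2) * r powr Q) \<le> ennreal ((lo / D * r) powr Q)" by (rule ennreal_leI)
    also have "\<dots> \<le> emeasure \<mu> (mball p r)" unfolding p' by (rule ball_lower[OF \<omega>(1) r \<open>r \<le> D\<close> D(1)])
    finally show "ennreal (inverse (C\<^sub>1 + C\<^sub>2) * r powr Q) \<le> emeasure \<mu> (mball p r)" .
    have "emeasure \<mu> (mball p r) \<le> ennreal (4 * card E * (r / lo ^ 3) powr Q)"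
      unfolding p' by (rule ball_upper[OF \<omega>(1) r])
    also have "4 * card E * (r / lo ^ 3) powr Q = C\<^sub>2 * r powr Q"
      using lo_hi r by (simp add: C\<^sub>2_def powr_divide)
    also have "ennreal (C\<^sub>2 * r powr Q) \<le> ennreal ((C\<^sub>1 + C\<^sub>2) * r powr Q)"
      using C1 by (intro ennreal_leI mult_right_mono) auto
    finally show "emeasure \<mu> (mball p r) \<le> ennreal ((C\<^sub>1 + C\<^sub>2) * r powr Q)" .
  qed
  show ?thesis
    unfolding ahlfors_regular_def
    using Metric_space_axioms Q_pos radon_\<mu> bounds C1 C2
    by (intro conjI exI[of _ \<mu>] exI[of _ "C\<^sub>1 + C\<^sub>2"] ballI allI impI) auto
qed

end

section \<open>The exponent Q\<close>

context laakso_density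
begin

lemma dimension_unique:
  assumes "(\<Sum>e\<in>E. \<rho> e powr p) = 1" "(\<Sum>e\<in>E. \<rho> e powr q) = 1"
  shows "p = q"
proof (rule ccontr)
  have less: "(\<Sum>e\<in>E. \<rho> e powr b) < (\<Sum>e\<in>E. \<rho> e powr a)" if "a < b" for a b
    using finite_E E_nonempty density_range that by (intro sum_strict_mono powr_less_mono') auto
  assume "p \<noteq> q"
  then show False using less[of p q] less[of q p] assms by linarith
qed

text \<open>Intermediate value theorem: the sum is at least 1 at exponent 1 by
  \<open>sum_density_ge_1\<close>, and at most 1 at a large exponent because all weights are bounded
  by \<open>hi\<close>, which is below 1.\<close>

lemma dimension_exists: "\<exists>Q\<ge>1. (\<Sum>e\<in>E. \<rho> e powr Q) = 1"
proof -
  let ?f = "\<lambda>q. \<Sum>e\<in>E. \<rho> e powr q"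
  have card: "0 < real (card E)" using E_nonempty finite_E by (simp add: card_gt_0_iff)
  then obtain n where n: "hi ^ n < 1 / card E" using real_arch_pow_inv[of "1 / card E" hi] lo_hi by auto
  \<comment> \<open>The successor guarantees \<open>1 \<le> b\<close>, so that the interval for the
    intermediate value theorem is not empty.\<close>
  define b where "b = real (Suc n)"
  have "?f b \<le> (\<Sum>e\<in>E. 1 / card E)"
  proof (rule sum_mono)
    fix e assume e: "e \<in> E"
    have "\<rho> e powr b = \<rho> e ^ Suc n" using density_range[OF e] by (simp only: b_def powr_realpow)
    also have "\<dots> \<le> \<rho> e ^ n" using density_range[OF e] by (intro power_decreasing) auto
    also have "\<dots> \<le> hi ^ n" using density_range[OF e] le_hi[OF e] by (intro power_mono) auto
    finally show "\<rho> e powr b \<le> 1 / card E" using n by linarith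
  qed
  then have b: "?f b \<le> 1" using card by simp
  have a: "1 \<le> ?f 1"
    using sum_density_ge_1 density_range by (simp add: less_imp_le)
  have "continuous_on {1..b} ?f"
    using density_range by (intro continuous_intros) (auto simp: less_imp_neq[symmetric])
  from IVT2'[OF b a _ this] show ?thesis by (auto simp: b_def)
qed

end

lemma laakso_densityI:
  assumes "laakso_igs S \<eta>\<^sub>V \<eta>\<^sub>E" "\<forall>e\<in>edges (gen S). 0 < \<rho> e \<and> \<rho> e < 1"
    "admissible_density S \<rho>" "symmetric_density S \<eta>\<^sub>E \<rho>"
  shows "laakso_density S \<eta>\<^sub>V \<eta>\<^sub>E \<rho>"
  using assms by (simp add: laakso_density_def laakso_density_axioms_def)

theorem theorem1p5:
  fixes S :: "('v, 'e, 'i) igs"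
    and \<eta>\<^sub>V :: "'v \<Rightarrow> 'v" and \<eta>\<^sub>E :: "'e \<Rightarrow> 'e"
  assumes "simple_igs S"
    and "doubling_igs S"
    and "nondegenerate_igs S"
    and "igs_symmetry S \<eta>\<^sub>V \<eta>\<^sub>E"
  shows "(\<forall>\<rho>. (\<forall>e\<in>edges (gen S). 0 < \<rho> e \<and> \<rho> e < 1) \<and>
              admissible_density S \<rho> \<and> symmetric_density S \<eta>\<^sub>E \<rho> \<longrightarrow>
            (\<exists>Q\<ge>1. (\<Sum>e\<in>edges (gen S). \<rho> e powr Q) = 1 \<and>
                   (\<forall>Q'. (\<Sum>e\<in>edges (gen S). \<rho> e powr Q') = 1 \<longrightarrow> Q' = Q) \<and>
                   ahlfors_regular Q (limit_space S) (limit_dist S \<rho>)))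
       \<and> (\<forall>\<rho> \<nu>. (\<forall>e\<in>edges (gen S). 0 < \<rho> e \<and> \<rho> e < 1) \<and>
              admissible_density S \<rho> \<and> symmetric_density S \<eta>\<^sub>E \<rho> \<and>
              (\<forall>e\<in>edges (gen S). 0 < \<nu> e \<and> \<nu> e < 1) \<and>
              admissible_density S \<nu> \<and> symmetric_density S \<eta>\<^sub>E \<nu> \<longrightarrow>
            quasisymmetrically_equivalent (limit_space S) (limit_dist S \<rho>) (limit_dist S \<nu>))"
proof -
  have igs: "laakso_igs S \<eta>\<^sub>V \<eta>\<^sub>E" using assms by (rule laakso_igs.intro)
  have "\<exists>Q\<ge>1. (\<Sum>e\<in>edges (gen S). \<rho> e powr Q) = 1 \<and>
      (\<forall>Q'. (\<Sum>e\<in>edges (gen S). \<rho> e powr Q') = 1 \<longrightarrow> Q' = Q) \<and>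
      ahlfors_regular Q (limit_space S) (limit_dist S \<rho>)"
    if "\<forall>e\<in>edges (gen S). 0 < \<rho> e \<and> \<rho> e < 1" "admissible_density S \<rho>" "symmetric_density S \<eta>\<^sub>E \<rho>" for \<rho>
  proof -
    interpret laakso_density S \<eta>\<^sub>V \<eta>\<^sub>E \<rho> using igs that by (rule laakso_densityI)
    obtain Q where Q: "1 \<le> Q" "(\<Sum>e\<in>edges (gen S). \<rho> e powr Q) = 1" using dimension_exists by blast
    interpret laakso_measure S \<eta>\<^sub>V \<eta>\<^sub>E \<rho> Q by unfold_locales (use Q in auto)
    show ?thesis using Q dimension_unique ahlfors_regular_limit_dist by blast
  qed
  moreover have "quasisymmetrically_equivalent (limit_space S) (limit_dist S \<rho>) (limit_dist S \<nu>)"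
    if "\<forall>e\<in>edges (gen S). 0 < \<rho> e \<and> \<rho> e < 1" "admissible_density S \<rho>" "symmetric_density S \<eta>\<^sub>E \<rho>"
      "\<forall>e\<in>edges (gen S). 0 < \<nu> e \<and> \<nu> e < 1" "admissible_density S \<nu>" "symmetric_density S \<eta>\<^sub>E \<nu>" for \<rho> \<nu>
  proof -
    interpret laakso_densities S \<eta>\<^sub>V \<eta>\<^sub>E \<rho> \<nu>
      by (intro laakso_densities.intro laakso_densityI igs that)
    show ?thesis by (rule quasisymmetrically_equivalent_limit_dist)
  qed
  ultimately show ?thesis by blast
qed

end
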